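(* Let $n\geqslant1$, $\mu\in(0,1)$ and $s\geqslant0$. Suppose that $v_0\in H^s\cap L^1$ and $v_1\in H^s\cap L^{1,1}$, and let $v$ be the solution to the linearized dissipative Boussinesq equation $$\begin{cases}v_{tt}-\Delta v+\Delta^2v+2\mu\Delta^2v_t=0,&x\in\mathbb{R}^n,\ t>0,\\ v(0,x)=v_0(x),\ v_t(0,x)=v_1(x),&x\in\mathbb{R}^n.\end{cases}$$ Set $$v^{(1,p)}(t,x):=\mathcal{G}_1(t,x)P_{v_1},\qquad v^{(2,p)}(t,x):=\mathcal{G}_0(t,x)P_{v_0}-\nabla\mathcal{G}_1(t,x)\cdot M_{v_1}-\frac{t}{8}\Delta^2\mathcal{G}_0(t,x)P_{v_1}.$$ Then, provided that $\mathbb{A}_{\mathrm{lin}}:=|P_{v_1}|+|P_{v_c}|+|M_{v_1}|\neq0$, where $v_c(x):=v_0(x)-\frac{2s+n}{64\mu}v_1(x)$, the following optimal error estimate holds for large time $t\gg1$: $$t^{-\frac{2s+n}{8}}\mathbb{A}_{\mathrm{lin}}\lesssim\|v(t,\cdot)-v^{(1,p)}(t,\cdot)\|_{\dot H^s}\lesssim t^{-\frac{2s+n}{8}}\|(v_0,v_1)\|_{(H^s\cap L^1)\times(H^{(s-1)_+}\cap L^{1,1})}.$$ Moreover, the further error estimate $$\|v(t,\cdot)-v^{(1,p)}(t,\cdot)-v^{(2,p)}(t,\cdot)\|_{\dot H^s}=o\big(t^{-\frac{2s+n}{8}}\big)$$ holds for large time $t\gg1$ (i.e. as $t\to\infty$),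 where the right-hand side depends on $\|v_0\|_{H^s\cap L^1}$ and $\|v_1\|_{H^s\cap L^{1,1}}$.
   Context: All function spaces are over $\mathbb{R}^n$ and functions are real-valued. $H^\sigma$, $\dot H^\sigma$ are the inhomogeneous and homogeneous $L^2$-based Sobolev spaces ($\dot H^0=L^2$); $(a)_+:=\max\{a,0\}$; intersection and product spaces carry the sum of the norms. The weighted space is $L^{1,1}:=\{g\in L^1:\|g\|_{L^{1,1}}:=\int_{\mathbb{R}^n}(1+|x|)|g(x)|\,\mathrm{d}x<\infty\}$. $P_g:=\int_{\mathbb{R}^n}g(x)\,\mathrm{d}x\in\mathbb{R}$ and $M_g:=\int_{\mathbb{R}^n}x\,g(x)\,\mathrm{d}x\in\mathbb{R}^n$. With the Fourier convention $\widehat g(\xi)=\int_{\mathbb{R}^n}\mathrm{e}^{-ix\cdot\xi}g(x)\,\mathrm{d}x$, define $$\mathcal{G}_0(t,x):=\mathcal{F}^{-1}_{\xi\to x}\left[\cos\left(|\xi|t+\tfrac12|\xi|^3t\right)\mathrm{e}^{-\mu|\xi|^4t}\right],\quad \mathcal{G}_1(t,x):=\mathcal{F}^{-1}_{\xi\to x}\left[\frac{1}{|\xi|}\sin\left(|\xi|t+\tfrac12|\xi|^3t\right)\mathrm{e}^{-\mu|\xi|^4t}\right].$$ $h\lesssim g$ means $h\leqslant Cg$ with a constant $C>0$ independent of $t$ and of the data; "for large time $t\gg1$" means for all $t\geqslant t_0$ with some sufficiently large $t_0$ (which, for the lower bound, may depend on the data). The letter $p$ in the superscripts stands for "profile" and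 is not a parameter. The solution $v$ is given by $\widehat v=\widehat K_0\widehat v_0+\widehat K_1\widehat v_1$ with $$\widehat K_0=\frac{\lambda_+\mathrm{e}^{\lambda_-t}-\lambda_-\mathrm{e}^{\lambda_+t}}{\lambda_+-\lambda_-},\quad \widehat K_1=\frac{\mathrm{e}^{\lambda_+t}-\mathrm{e}^{\lambda_-t}}{\lambda_+-\lambda_-},\quad \lambda_\pm=-\mu|\xi|^4\pm\sqrt{\mu^2|\xi|^8-|\xi|^2-|\xi|^4}$$ (extended by continuity where $\lambda_+=\lambda_-$). *)

theory Defs
  imports "HOL-Analysis.Analysis" "HOL-Library.Landau_Symbols"
begin

section \<open>Fourier transform and function spaces\<close>

definition fourier :: "(real^'n \<Rightarrow> real) \<Rightarrow> real^'n \<Rightarrow> complex" where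
  "fourier f \<xi> = (LINT x|lborel. cis (- (x \<bullet> \<xi>)) * complex_of_real (f x))"

definition inv_fourier :: "(real^'n \<Rightarrow> complex) \<Rightarrow> real^'n \<Rightarrow> complex" where
  "inv_fourier F x =
     complex_of_real (1 / (2 * pi) ^ CARD('n)) * (LINT \<xi>|lborel. cis (x \<bullet> \<xi>) * F \<xi>)"

definition square_integrable :: "(real^'n \<Rightarrow> 'b::euclidean_space) \<Rightarrow> bool" where
  "square_integrable f \<longleftrightarrow> f \<in> borel_measurable lborel \<and> integrable lborel (\<lambda>x. (norm (f x))\<^sup>2)"

text \<open>The Fourier--Plancherel transform on \<open>L\<^sup>2\<close>: the limit in \<open>L\<^sup>2\<close> of the transforms of the
  truncations to balls (which lie in \<open>L\<^sup>1\<close>). The transform is determined only almost everywhere.\<close>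

definition has_l2_fourier :: "(real^'n \<Rightarrow> real) \<Rightarrow> (real^'n \<Rightarrow> complex) \<Rightarrow> bool" where
  "has_l2_fourier f F \<longleftrightarrow> square_integrable f \<and> square_integrable F \<and>
     ((\<lambda>R. \<integral>\<^sup>+\<xi>. ennreal ((cmod (fourier (\<lambda>x. indicator (cball 0 R) x * f x) \<xi> - F \<xi>))\<^sup>2) \<partial>lborel)
        \<longlongrightarrow> 0) at_top"

definition l2_fourier :: "(real^'n \<Rightarrow> real) \<Rightarrow> real^'n \<Rightarrow> complex" where
  "l2_fourier f = (SOME F. has_l2_fourier f F)"

text \<open>Sobolev spaces of order \<open>s \<ge> 0\<close>. The factor \<open>(2 * pi) ^ CARD('n)\<close> is the Plancherel constant
  of the above convention, so that for \<open>s = 0\<close> both norms are the \<open>L\<^sup>2\<close> norm. Of the homogeneous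
  space only the square integrable elements are considered. The norms are meaningful only on
  elements of the respective space.\<close>

definition sobolev :: "real \<Rightarrow> (real^'n \<Rightarrow> real) set" where
  "sobolev s = {f. \<exists>F. has_l2_fourier f F \<and>
     integrable lborel (\<lambda>\<xi>. (1 + (norm \<xi>)\<^sup>2) powr s * (cmod (F \<xi>))\<^sup>2)}"

definition sobolev_norm :: "real \<Rightarrow> (real^'n \<Rightarrow> real) \<Rightarrow> real" where
  "sobolev_norm s f = sqrt (1 / (2 * pi) ^ CARD('n) *
     (LINT \<xi>|lborel. (1 + (norm \<xi>)\<^sup>2) powr s * (cmod (l2_fourier f \<xi>))\<^sup>2))"

definition hom_sobolev :: "real \<Rightarrow> (real^'n \<Rightarrow> real) set" where
  "hom_sobolev s = {f. \<exists>F. has_l2_fourier f F \<and>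
     integrable lborel (\<lambda>\<xi>. norm \<xi> powr (2 * s) * (cmod (F \<xi>))\<^sup>2)}"

definition hom_sobolev_norm :: "real \<Rightarrow> (real^'n \<Rightarrow> real) \<Rightarrow> real" where
  "hom_sobolev_norm s f = sqrt (1 / (2 * pi) ^ CARD('n) *
     (LINT \<xi>|lborel. norm \<xi> powr (2 * s) * (cmod (l2_fourier f \<xi>))\<^sup>2))"

definition L1 :: "(real^'n \<Rightarrow> real) set" where
  "L1 = {g. integrable lborel g}"

definition L1_norm :: "(real^'n \<Rightarrow> real) \<Rightarrow> real" where
  "L1_norm g = (LINT x|lborel. \<bar>g x\<bar>)"

definition L11 :: "(real^'n \<Rightarrow> real) set" where
  "L11 = {g \<in> L1. integrable lborel (\<lambda>x. (1 + norm x) * \<bar>g x\<bar>)}"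

definition L11_norm :: "(real^'n \<Rightarrow> real) \<Rightarrow> real" where
  "L11_norm g = (LINT x|lborel. (1 + norm x) * \<bar>g x\<bar>)"

definition mass :: "(real^'n \<Rightarrow> real) \<Rightarrow> real" where
  "mass g = (LINT x|lborel. g x)"

definition moment :: "(real^'n \<Rightarrow> real) \<Rightarrow> real^'n" where
  "moment g = (LINT x|lborel. g x *\<^sub>R x)"

definition partial_deriv :: "'n \<Rightarrow> (real^'n \<Rightarrow> real) \<Rightarrow> real^'n \<Rightarrow> real" where
  "partial_deriv i f x = deriv (\<lambda>h. f (x + h *\<^sub>R axis i 1)) 0"

definition gradient :: "(real^'n \<Rightarrow> real) \<Rightarrow> real^'n \<Rightarrow> real^'n" where
  "gradient f x = (\<chi> i. partial_deriv i f x)"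

definition laplacian :: "(real^'n \<Rightarrow> real) \<Rightarrow> real^'n \<Rightarrow> real" where
  "laplacian f x = (\<Sum>i\<in>UNIV. partial_deriv i (partial_deriv i f) x)"

section \<open>The linearized dissipative Boussinesq equation\<close>

text \<open>The characteristic roots and kernels depend on \<open>\<xi>\<close> only through \<open>r = norm \<xi>\<close>.\<close>

definition lam_plus :: "real \<Rightarrow> real \<Rightarrow> complex" where
  "lam_plus \<mu> r = - complex_of_real (\<mu> * r ^ 4) + csqrt (complex_of_real (\<mu>\<^sup>2 * r ^ 8 - r\<^sup>2 - r ^ 4))"

definition lam_minus :: "real \<Rightarrow> real \<Rightarrow> complex" where
  "lam_minus \<mu> r = - complex_of_real (\<mu> * r ^ 4) - csqrt (complex_of_real (\<mu>\<^sup>2 * r ^ 8 - r\<^sup>2 - r ^ 4))"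

text \<open>At a double root the values are the limits for merging roots.\<close>

definition K0_hat :: "real \<Rightarrow> real \<Rightarrow> real^'n \<Rightarrow> complex" where
  "K0_hat \<mu> t \<xi> =
     (let a = lam_plus \<mu> (norm \<xi>); b = lam_minus \<mu> (norm \<xi>) in
      if a = b then (1 - a * of_real t) * exp (a * of_real t)
      else (a * exp (b * of_real t) - b * exp (a * of_real t)) / (a - b))"

definition K1_hat :: "real \<Rightarrow> real \<Rightarrow> real^'n \<Rightarrow> complex" where
  "K1_hat \<mu> t \<xi> =
     (let a = lam_plus \<mu> (norm \<xi>); b = lam_minus \<mu> (norm \<xi>) in
      if a = b then of_real t * exp (a * of_real t)
      else (exp (a * of_real t) - exp (b * of_real t)) / (a - b))"

text \<open>For integrable data, \<open>v t x\<close> is the solution of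
  \<open>v_tt - \<Delta>v + \<Delta>\<^sup>2v + 2\<mu>\<Delta>\<^sup>2v_t = 0\<close>, \<open>v(0) = v0\<close>, \<open>v_t(0) = v1\<close>, given by its spatial Fourier
  transform. In general that transform is not integrable, so it is taken in \<open>L\<^sup>2\<close>.\<close>

definition boussinesq_solution ::
  "real \<Rightarrow> (real^'n \<Rightarrow> real) \<Rightarrow> (real^'n \<Rightarrow> real) \<Rightarrow> (real \<Rightarrow> real^'n \<Rightarrow> real) \<Rightarrow> bool" where
  "boussinesq_solution \<mu> v0 v1 v \<longleftrightarrow>
     (\<forall>t\<ge>0. has_l2_fourier (v t)
        (\<lambda>\<xi>. K0_hat \<mu> t \<xi> * fourier v0 \<xi> + K1_hat \<mu> t \<xi> * fourier v1 \<xi>))"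

section \<open>Profiles\<close>

text \<open>The symbols are real and even, so the inverse transforms are real and \<open>Re\<close> only changes
  the type. The value of the second symbol at the origin is irrelevant for the integral.\<close>

definition G0 :: "real \<Rightarrow> real \<Rightarrow> real^'n \<Rightarrow> real" where
  "G0 \<mu> t x = Re (inv_fourier (\<lambda>\<xi>. complex_of_real
     (cos (norm \<xi> * t + 1/2 * norm \<xi> ^ 3 * t) * exp (- \<mu> * norm \<xi> ^ 4 * t))) x)"

definition G1 :: "real \<Rightarrow> real \<Rightarrow> real^'n \<Rightarrow> real" where
  "G1 \<mu> t x = Re (inv_fourier (\<lambda>\<xi>. complex_of_real
     (1 / norm \<xi> * sin (norm \<xi> * t + 1/2 * norm \<xi> ^ 3 * t) * exp (- \<mu> * norm \<xi> ^ 4 * t))) x)"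

definition profile1 :: "real \<Rightarrow> (real^'n \<Rightarrow> real) \<Rightarrow> real \<Rightarrow> real^'n \<Rightarrow> real" where
  "profile1 \<mu> v1 t x = G1 \<mu> t x * mass v1"

definition profile2 ::
  "real \<Rightarrow> (real^'n \<Rightarrow> real) \<Rightarrow> (real^'n \<Rightarrow> real) \<Rightarrow> real \<Rightarrow> real^'n \<Rightarrow> real" where
  "profile2 \<mu> v0 v1 t x =
     G0 \<mu> t x * mass v0 - gradient (G1 \<mu> t) x \<bullet> moment v1
       - t / 8 * laplacian (laplacian (G0 \<mu> t)) x * mass v1"

definition A_lin :: "real \<Rightarrow> real \<Rightarrow> (real^'n \<Rightarrow> real) \<Rightarrow> (real^'n \<Rightarrow> real) \<Rightarrow> real" where
  "A_lin \<mu> s v0 v1 =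
     \<bar>mass v1\<bar> + \<bar>mass (\<lambda>x. v0 x - (2 * s + real CARD('n)) / (64 * \<mu>) * v1 x)\<bar> + norm (moment v1)"

definition data_norm :: "real \<Rightarrow> (real^'n \<Rightarrow> real) \<Rightarrow> (real^'n \<Rightarrow> real) \<Rightarrow> real" where
  "data_norm s v0 v1 =
     (sobolev_norm s v0 + L1_norm v0) + (sobolev_norm (max (s - 1) 0) v1 + L11_norm v1)"

end

theory Submission
  imports Defs "HOL-Probability.Characteristic_Functions" "HOL-Real_Asymp.Real_Asymp"
begin

text \<open>All functions involved have explicit Fourier transforms, so the norms are weighted integrals in
  frequency. Multiplying an inverse transform by a Gaussian and using Bessel's inequality shows that
  the profiles have their symbols as Fourier--Plancherel transforms. At frequencies above 1 the
  kernels decay exponentially in time. Below 1 the oscillation frequency has the expansion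
  \<open>r + r ^ 3 / 2 - r ^ 5 / 8 + O(r ^ 7)\<close>; scaling by \<open>t powr (- 1 / 4)\<close> and dominated convergence
  then give the upper bound and the second-order expansion, the \<open>r ^ 5\<close> term producing the
  \<open>t / 8\<close> correction of the second profile.

  For the lower bound it suffices to bound the second profile from below. Its transform has real part
  proportional to \<open>cos\<close> and imaginary part proportional to \<open>sin\<close> of a large phase, so the two parts do not
  interact. A small dilation shifts the phase by about \<open>pi / 2\<close>, hence \<open>cos\<^sup>2\<close> and \<open>sin\<^sup>2\<close> keep a
  fixed share of any conical shell.\<close>

text \<open>The data are integrable, so their transforms have values at every frequency, while the
  norms use Plancherel transforms, fixed only almost everywhere; \<open>has_l2_fourier_L1\<close>
  and \<open>has_l2_fourier_inverse\<close> connect the two, and Bessel's inequality is all the L2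
  theory behind them. The scale \<open>r = t powr (- 1 / 4)\<close> is the one at which the damping
  \<open>\<mu> * r ^ 4 * t\<close> stays fixed. There the phase error \<open>r ^ 5 * t\<close> of
  the frequency \<open>r + r ^ 3 / 2\<close> is only of size \<open>r\<close>, but the kernel
  \<open>K1_hat\<close> divides by \<open>r\<close>. The correction is therefore as large as the
  contributions of the mass of \<open>v0\<close> and of the moment of \<open>v1\<close>, and all
  three belong to one profile. The obstacle in the lower bound is that both amplitudes can vanish:
  \<open>P0 - r ^ 4 / 8 * P1\<close> at one radius, \<open>\<xi> \<bullet> M\<close> on a
  hyperplane. The cone and the shell are therefore chosen from the data, while the bound on the
  oscillation is uniform over all of them. Since \<open>v1\<close> has just one moment, the
  remainder is small without a rate. Hence the time from which the lower bound holds depends on the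
  data, whereas the upper bound starts at a common time.\<close>

lemma integrable_scaleR_iff:
  fixes f :: "'a \<Rightarrow> 'b::{banach,second_countable_topology}"
  assumes "c \<noteq> 0"
  shows "integrable M (\<lambda>x. c *\<^sub>R f x) \<longleftrightarrow> integrable M f"
proof
  assume "integrable M (\<lambda>x. c *\<^sub>R f x)"
  from integrable_scaleR_right[OF this, of "inverse c"] show "integrable M f"
    unfolding scaleR_scaleR using assms by (simp del: scaleR_scaleR)
qed auto

lemma cis_borel_measurable [measurable]: "cis \<in> borel_measurable borel"
  by (intro borel_measurable_continuous_onI continuous_intros)

section \<open>Affine changes of variables and product integrands\<close>

text \<open>\<open>lborel_affine\<close> presents Lebesgue measure as an image under the affine map
  with constant density. The equivalence, rather than one implication, lets the parabolic scaling
  transfer integrability in both directions.\<close>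

lemma lborel_integrable_affine_iff:
  fixes f :: "'a::euclidean_space \<Rightarrow> 'b::{banach,second_countable_topology}"
  assumes "c \<noteq> 0" and [measurable]: "f \<in> borel_measurable borel"
  shows "integrable lborel (\<lambda>x. f (t + c *\<^sub>R x)) \<longleftrightarrow> integrable lborel f"
proof -
  have "integrable lborel f \<longleftrightarrow>
      integrable (density (distr lborel borel (\<lambda>x. t + c *\<^sub>R x)) (\<lambda>_. ennreal (\<bar>c\<bar> ^ DIM('a)))) f"
    using lborel_affine[OF assms(1), of t] by (simp add: ennreal_power)
  also have "\<dots> \<longleftrightarrow> integrable (distr lborel borel (\<lambda>x. t + c *\<^sub>R x)) f"
    using assms(1) by (subst integrable_density) (auto simp: integrable_scaleR_iff)
  also have "\<dots> \<longleftrightarrow> integrable lborel (\<lambda>x. f (t + c *\<^sub>R x))"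
    using assms(1) by (subst integrable_distr_eq) auto
  finally show ?thesis ..
qed

lemma lborel_integral_affine:
  fixes f :: "'a::euclidean_space \<Rightarrow> 'b::{banach,second_countable_topology}"
  assumes "c \<noteq> 0" and [measurable]: "f \<in> borel_measurable borel"
  shows "(LINT x|lborel. f x) = (\<bar>c\<bar> ^ DIM('a)) *\<^sub>R (LINT x|lborel. f (t + c *\<^sub>R x))"
proof -
  have "(LINT x|lborel. f x) =
      (LINT x|density (distr lborel borel (\<lambda>x. t + c *\<^sub>R x)) (\<lambda>_. ennreal (\<bar>c\<bar> ^ DIM('a))). f x)"
    using lborel_affine[OF assms(1), of t] by (simp add: ennreal_power)
  also have "\<dots> = (LINT x|distr lborel borel (\<lambda>x. t + c *\<^sub>R x). (\<bar>c\<bar> ^ DIM('a)) *\<^sub>R f x)"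
    by (subst integral_density) auto
  also have "\<dots> = (\<bar>c\<bar> ^ DIM('a)) *\<^sub>R (LINT x|lborel. f (t + c *\<^sub>R x))"
    using assms(1) by (subst integral_distr) auto
  finally show ?thesis .
qed

lemma nn_integral_lborel_affine:
  fixes f :: "'a::euclidean_space \<Rightarrow> ennreal"
  assumes "c \<noteq> 0" and [measurable]: "f \<in> borel_measurable borel"
  shows "(\<integral>\<^sup>+x. f x \<partial>lborel) = ennreal (\<bar>c\<bar> ^ DIM('a)) * (\<integral>\<^sup>+x. f (t + c *\<^sub>R x) \<partial>lborel)"
proof -
  have "(\<integral>\<^sup>+x. f x \<partial>lborel) =
      (\<integral>\<^sup>+x. f x \<partial>density (distr lborel borel (\<lambda>x. t + c *\<^sub>R x)) (\<lambda>_. ennreal (\<bar>c\<bar> ^ DIM('a))))"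
    using lborel_affine[OF assms(1), of t] by (simp add: ennreal_power)
  also have "\<dots> = ennreal (\<bar>c\<bar> ^ DIM('a)) * (\<integral>\<^sup>+x. f (t + c *\<^sub>R x) \<partial>lborel)"
    using assms(1) by (subst nn_integral_density) (auto simp: nn_integral_cmult nn_integral_distr)
  finally show ?thesis .
qed

text \<open>By \<open>lborel_eq\<close> the measure is the image of a product measure indexed by
  \<open>Basis\<close>, so Fubini factors the integrand. This reduces Gaussian integrals to one
  dimension.\<close>

lemma lborel_prod_Basis:
  fixes f :: "'a::euclidean_space \<Rightarrow> real \<Rightarrow> 'b::{real_normed_field,banach,second_countable_topology}"
  assumes "\<And>b. b \<in> Basis \<Longrightarrow> integrable lborel (f b)"
  shows lborel_integrable_prod_Basis: "integrable lborel (\<lambda>x::'a. \<Prod>b\<in>Basis. f b (x \<bullet> b))"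
    and lborel_integral_prod_Basis:
      "(LINT x|lborel. (\<Prod>b\<in>Basis. f b (x \<bullet> b))) = (\<Prod>b\<in>Basis. LINT y|lborel. f b y)"
proof -
  interpret product_sigma_finite "\<lambda>_::'a. lborel :: real measure" ..
  have meas: "f b \<in> borel_measurable borel" if "b \<in> Basis" for b
    using borel_measurable_integrable[OF assms[OF that]] by simp
  have "(\<lambda>x. f b (x \<bullet> b)) \<in> borel_measurable borel" if "b \<in> Basis" for b
    using meas[OF that] by measurable
  then have m: "(\<lambda>x::'a. \<Prod>b\<in>Basis. f b (x \<bullet> b)) \<in> borel_measurable borel"
    by (intro borel_measurable_prod)
  have comp: "(\<lambda>g. \<Prod>b\<in>Basis. f b ((\<Sum>c\<in>Basis. g c *\<^sub>R c :: 'a) \<bullet> b)) = (\<lambda>g. \<Prod>b\<in>Basis. f b (g b))"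
    by (intro ext prod.cong refl) simp
  show "integrable lborel (\<lambda>x::'a. \<Prod>b\<in>Basis. f b (x \<bullet> b))"
    using m product_integrable_prod[of Basis f, OF finite_Basis assms] unfolding comp[symmetric]
    by (subst lborel_eq, subst integrable_distr_eq) auto
  show "(LINT x|lborel. (\<Prod>b\<in>Basis. f b (x \<bullet> b))) = (\<Prod>b\<in>Basis. LINT y|lborel. f b y)"
    using m product_integral_prod[of Basis f, OF finite_Basis assms] unfolding comp[symmetric]
    by (subst lborel_eq, subst integral_distr) auto
qed

section \<open>Gaussians\<close>

text \<open>Up to the normalization \<open>1 / sqrt (2 * pi)\<close> of the density, the integral is
  the characteristic function of the standard normal distribution at \<open>- \<xi>\<close>.\<close>

lemma gaussian_fourier_real:
  fixes \<xi> :: real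
  shows "integrable lborel (\<lambda>x. cis (- (x * \<xi>)) * complex_of_real (exp (- x\<^sup>2 / 2)))" (is ?A)
    and "(LINT x|lborel. cis (- (x * \<xi>)) * complex_of_real (exp (- x\<^sup>2 / 2)))
           = complex_of_real (sqrt (2 * pi) * exp (- \<xi>\<^sup>2 / 2))" (is ?B)
proof -
  have i: "integrable lborel (\<lambda>x::real. exp (- x\<^sup>2 / 2))"
  proof -
    have "integrable lborel (\<lambda>x. sqrt (2 * pi) * std_normal_density x)"
      by (intro integrable_mult_right integrable_normal_density) auto
    then show ?thesis
      by (simp add: std_normal_density_def)
  qed
  show ?A
    by (rule Bochner_Integration.integrable_bound[OF i]) (auto simp: norm_mult)
  have "char std_normal_distribution (-\<xi>) =
      (LINT x|lborel. std_normal_density x *\<^sub>R cis (- (x * \<xi>)))"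
    unfolding char_def by (subst integral_density) (auto simp: cis_conv_exp algebra_simps)
  also have "\<dots> = (LINT x|lborel. complex_of_real (1 / sqrt (2 * pi)) *
       (cis (- (x * \<xi>)) * complex_of_real (exp (- x\<^sup>2 / 2))))"
    by (intro Bochner_Integration.integral_cong)
      (auto simp: std_normal_density_def scaleR_conv_of_real mult_ac)
  also have "\<dots> = complex_of_real (1 / sqrt (2 * pi)) *
      (LINT x|lborel. cis (- (x * \<xi>)) * complex_of_real (exp (- x\<^sup>2 / 2)))"
    by (rule integral_mult_right_zero)
  finally show ?B
    by (simp add: char_std_normal_distribution field_simps)
qed

text \<open>With the factor 1/2 in the exponent this is an eigenfunction of the Fourier transform,
  with eigenvalue \<open>sqrt (2 * pi) ^ DIM('a)\<close>.\<close>

definition gauss :: "'a::euclidean_space \<Rightarrow> real" where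
  "gauss x = exp (- (norm x)\<^sup>2 / 2)"

lemma gauss_meas [measurable]: "gauss \<in> borel_measurable borel"
  unfolding gauss_def [abs_def] by measurable

lemma gauss_pos: "0 < gauss x" and gauss_le_1: "gauss x \<le> 1"
  by (auto simp: gauss_def)

lemma gauss_prod: "gauss (x::'a::euclidean_space) = (\<Prod>b\<in>Basis. exp (- (x \<bullet> b)\<^sup>2 / 2))"
proof -
  have "(norm x)\<^sup>2 = (\<Sum>b\<in>Basis. (x \<bullet> b)\<^sup>2)"
    by (simp add: norm_eq_sqrt_inner euclidean_inner[of x x] power2_eq_square sum_nonneg)
  then show ?thesis
    by (simp add: gauss_def exp_sum[symmetric] sum_divide_distrib sum_negf)
qed

lemma cis_sum: "finite A \<Longrightarrow> cis (\<Sum>a\<in>A. f a) = (\<Prod>a\<in>A. cis (f a))"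
  by (induction rule: finite_induct) (auto simp: cis_mult[symmetric])

lemma gauss_fourier:
  fixes \<xi> :: "'a::euclidean_space"
  shows "integrable lborel (\<lambda>x. cis (- (x \<bullet> \<xi>)) * complex_of_real (gauss x))"
    and "(LINT x|lborel. cis (- (x \<bullet> \<xi>)) * complex_of_real (gauss x))
           = complex_of_real (sqrt (2 * pi) ^ DIM('a) * gauss \<xi>)"
proof -
  let ?f = "\<lambda>b y. cis (- (y * (\<xi> \<bullet> b))) * complex_of_real (exp (- y\<^sup>2 / 2))"
  have eq: "(\<lambda>x. cis (- (x \<bullet> \<xi>)) * complex_of_real (gauss x)) = (\<lambda>x. \<Prod>b\<in>Basis. ?f b (x \<bullet> b))"
    by (auto simp: euclidean_inner[of _ \<xi>] gauss_prod prod.distrib cis_sum sum_negf[symmetric])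
  show "integrable lborel (\<lambda>x. cis (- (x \<bullet> \<xi>)) * complex_of_real (gauss x))"
    unfolding eq by (intro lborel_integrable_prod_Basis gaussian_fourier_real)
  have "(LINT x|lborel. (\<Prod>b\<in>Basis. ?f b (x \<bullet> b))) = (\<Prod>b\<in>Basis. LINT y|lborel. ?f b y)"
    by (intro lborel_integral_prod_Basis gaussian_fourier_real)
  then show "(LINT x|lborel. cis (- (x \<bullet> \<xi>)) * complex_of_real (gauss x))
           = complex_of_real (sqrt (2 * pi) ^ DIM('a) * gauss \<xi>)"
    by (simp only: eq gaussian_fourier_real) (simp add: gauss_prod prod.distrib of_real_prod)
qed

lemma gauss_integrable: "integrable lborel (gauss :: 'a::euclidean_space \<Rightarrow> real)"
  using gauss_fourier(1)[of "0::'a"] by (simp add: complex_of_real_integrable_eq)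

lemma gauss_integral: "(LINT x|lborel. gauss (x::'a::euclidean_space)) = sqrt (2 * pi) ^ DIM('a)"
proof -
  have "complex_of_real (LINT x|lborel. gauss (x::'a)) = complex_of_real (sqrt (2 * pi) ^ DIM('a))"
    using gauss_fourier(2)[of "0::'a"] unfolding integral_complex_of_real[symmetric] by (simp add: gauss_def)
  then show ?thesis by (simp only: of_real_eq_iff)
qed

lemma gauss_scaled_fourier:
  fixes \<xi> :: "'a::euclidean_space"
  assumes "\<delta> > 0"
  shows "integrable lborel (\<lambda>x. cis (- (x \<bullet> \<xi>)) * complex_of_real (gauss (\<delta> *\<^sub>R x)))"
    and "(LINT x|lborel. cis (- (x \<bullet> \<xi>)) * complex_of_real (gauss (\<delta> *\<^sub>R x)))
           = complex_of_real ((sqrt (2 * pi) / \<delta>) ^ DIM('a) * gauss (\<xi> /\<^sub>R \<delta>))"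
proof -
  let ?g = "\<lambda>x. cis (- (x \<bullet> (\<xi> /\<^sub>R \<delta>))) * complex_of_real (gauss x)"
  have eq: "(\<lambda>x. cis (- (x \<bullet> \<xi>)) * complex_of_real (gauss (\<delta> *\<^sub>R x))) = (\<lambda>x. ?g (0 + \<delta> *\<^sub>R x))"
    using assms by (auto simp: mult.assoc[symmetric])
  have m: "?g \<in> borel_measurable borel"
    using borel_measurable_integrable[OF gauss_fourier(1)] by simp
  show "integrable lborel (\<lambda>x. cis (- (x \<bullet> \<xi>)) * complex_of_real (gauss (\<delta> *\<^sub>R x)))"
    unfolding eq using assms gauss_fourier(1)[of "\<xi> /\<^sub>R \<delta>"]
    by (subst lborel_integrable_affine_iff[OF _ m]) auto
  have "(LINT x|lborel. ?g x) = (\<bar>\<delta>\<bar> ^ DIM('a)) *\<^sub>R (LINT x|lborel. ?g (0 + \<delta> *\<^sub>R x))"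
    using assms m by (intro lborel_integral_affine) auto
  then show "(LINT x|lborel. cis (- (x \<bullet> \<xi>)) * complex_of_real (gauss (\<delta> *\<^sub>R x)))
           = complex_of_real ((sqrt (2 * pi) / \<delta>) ^ DIM('a) * gauss (\<xi> /\<^sub>R \<delta>))"
    unfolding eq gauss_fourier(2) using assms by (simp add: field_simps scaleR_conv_of_real)
qed

lemma gauss_scaled_integrable:
  "c \<noteq> 0 \<Longrightarrow> integrable lborel (\<lambda>x::'a::euclidean_space. gauss (c *\<^sub>R x))"
  using lborel_integrable_affine_iff[of c "gauss :: 'a \<Rightarrow> real" 0] gauss_integrable[where 'a='a] by simp

lemma cnj_borel_measurable [measurable]: "cnj \<in> borel_measurable borel"
  by (intro borel_measurable_continuous_onI continuous_intros)

section \<open>The Fourier transform on L1\<close>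

text \<open>Complex-valued arguments allow one theory for both directions: \<open>fourier\<close> is
  \<open>cfourier\<close> of a real function, and \<open>inv_fourier\<close> is a multiple of
  \<open>cfourier\<close> at the reflected point.\<close>

definition cfourier :: "('a::euclidean_space \<Rightarrow> complex) \<Rightarrow> 'a \<Rightarrow> complex" where
  "cfourier f \<xi> = (LINT x|lborel. cis (- (x \<bullet> \<xi>)) * f x)"

lemma cfourier_meas [measurable]:
  assumes [measurable]: "f \<in> borel_measurable borel"
  shows "cfourier f \<in> borel_measurable borel"
  unfolding cfourier_def [abs_def] by (intro lborel.borel_measurable_lebesgue_integral) measurable

lemma integrable_cis_mult:
  fixes f :: "'a::euclidean_space \<Rightarrow> complex"
  assumes f: "integrable lborel f" and [measurable]: "\<phi> \<in> borel_measurable borel"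
  shows "integrable lborel (\<lambda>x. cis (\<phi> x) * f x)"
proof (rule Bochner_Integration.integrable_bound[OF f])
  show "(\<lambda>x. cis (\<phi> x) * f x) \<in> borel_measurable lborel"
    using borel_measurable_integrable[OF f] by simp
qed (simp add: norm_mult)

lemma cfourier_bound: "cmod (cfourier f \<xi>) \<le> (LINT x|lborel. cmod (f x))"
  unfolding cfourier_def
  using integral_norm_bound[of lborel "\<lambda>x. cis (- (x \<bullet> \<xi>)) * f x"] by (simp add: norm_mult)

text \<open>In the non-integrable case the left side is 0, the default value of the Bochner
  integral.\<close>

lemma ennreal_norm_integral_le:
  fixes f :: "'a \<Rightarrow> 'b::{banach,second_countable_topology}"
  shows "ennreal (norm (integral\<^sup>L M f)) \<le> (\<integral>\<^sup>+x. ennreal (norm (f x)) \<partial>M)"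
  by (cases "integrable M f") (auto simp: integral_norm_bound_ennreal not_integrable_integral_eq)

text \<open>Fubini for the absolutely integrable kernel \<open>f x * h \<xi>\<close>. Moving the
  transform from one factor to the other is the engine of both Bessel's inequality and the Gaussian
  regularization.\<close>

lemma cfourier_multiplication:
  assumes f: "integrable lborel f" and h: "integrable lborel h"
  shows "(LINT \<xi>|lborel. cfourier f \<xi> * h \<xi>) = (LINT x|lborel. f x * cfourier h x)"
proof -
  have [measurable]: "f \<in> borel_measurable borel" "h \<in> borel_measurable borel"
    using borel_measurable_integrable[OF f] borel_measurable_integrable[OF h] by auto
  have i: "integrable (lborel \<Otimes>\<^sub>M lborel) (\<lambda>(x, \<xi>). cis (- (x \<bullet> \<xi>)) * f x * h \<xi>)"
  proof (rule lborel_pair.Fubini_integrable)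
    show "integrable lborel (\<lambda>x. LINT y|lborel. norm (case (x, y) of (x, \<xi>) \<Rightarrow> cis (- (x \<bullet> \<xi>)) * f x * h \<xi>))"
      using f by (auto simp: norm_mult)
    show "AE x in lborel. integrable lborel (\<lambda>y. case (x, y) of (x, \<xi>) \<Rightarrow> cis (- (x \<bullet> \<xi>)) * f x * h \<xi>)"
      using integrable_cis_mult[OF h] by (auto simp: mult.assoc mult.left_commute[of "cis _" "f _"])
  qed measurable
  have "(LINT \<xi>|lborel. cfourier f \<xi> * h \<xi>) = (LINT \<xi>|lborel. LINT x|lborel. cis (- (x \<bullet> \<xi>)) * f x * h \<xi>)"
    unfolding cfourier_def by (simp del: integral_mult_left_zero add: integral_mult_left_zero[symmetric])
  also have "\<dots> = (LINT x|lborel. LINT \<xi>|lborel. cis (- (x \<bullet> \<xi>)) * f x * h \<xi>)"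
    using i by (rule lborel_pair.Fubini_integral)
  also have "\<dots> = (LINT x|lborel. LINT \<xi>|lborel. f x * (cis (- (\<xi> \<bullet> x)) * h \<xi>))"
    by (simp add: mult_ac inner_commute)
  also have "\<dots> = (LINT x|lborel. f x * cfourier h x)"
    unfolding cfourier_def by simp
  finally show ?thesis .
qed

lemma integral_reflect:
  fixes f :: "'a::euclidean_space \<Rightarrow> 'b::{banach,second_countable_topology}"
  assumes "f \<in> borel_measurable borel"
  shows "(LINT x|lborel. f (- x)) = (LINT x|lborel. f x)"
  using lborel_integral_affine[of "-1" f 0] assms by simp

lemma integrable_reflect:
  fixes f :: "'a::euclidean_space \<Rightarrow> 'b::{banach,second_countable_topology}"
  assumes "integrable lborel f"
  shows "integrable lborel (\<lambda>x. f (- x))"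
  using lborel_integrable_affine_iff[of "-1" f 0] assms borel_measurable_integrable[OF assms] by simp

lemma nn_integral_reflect:
  fixes f :: "'a::euclidean_space \<Rightarrow> ennreal"
  assumes "f \<in> borel_measurable borel"
  shows "(\<integral>\<^sup>+x. f (- x) \<partial>lborel) = (\<integral>\<^sup>+x. f x \<partial>lborel)"
  using nn_integral_lborel_affine[of "-1" f 0] assms by simp

text \<open>Turns \<open>(cmod (cfourier f \<xi>))\<^sup>2\<close> into a product of two transforms,
  and later shows that Hermitian symbols have real inverse transforms.\<close>

lemma cfourier_cnj_reflect:
  assumes f: "integrable lborel f"
  shows "cfourier (\<lambda>x. cnj (f (- x))) \<xi> = cnj (cfourier f \<xi>)"
proof -
  have [measurable]: "f \<in> borel_measurable borel"
    using borel_measurable_integrable[OF f] by auto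
  have "cfourier (\<lambda>x. cnj (f (- x))) \<xi> = (LINT x|lborel. cnj (cis (x \<bullet> \<xi>) * f (- x)))"
    unfolding cfourier_def by (simp add: cis_cnj)
  also have "\<dots> = cnj (LINT x|lborel. cis (x \<bullet> \<xi>) * f (- x))"
    by (rule Bochner_Integration.integral_cnj)
  also have "(LINT x|lborel. cis (x \<bullet> \<xi>) * f (- x)) = cfourier f \<xi>"
    unfolding cfourier_def by (subst integral_reflect[symmetric]) auto
  finally show ?thesis .
qed

section \<open>Bessel's inequality by Gaussian regularization\<close>

text \<open>The Fourier transform of \<open>gauss (\<delta> *\<^sub>R x)\<close>; divided by
  \<open>(2 * pi) ^ DIM('a)\<close> it is an approximate identity as \<delta> tends to 0.\<close>

definition gkernel :: "real \<Rightarrow> 'a::euclidean_space \<Rightarrow> real" where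
  "gkernel \<delta> z = (sqrt (2 * pi) / \<delta>) ^ DIM('a) * gauss (z /\<^sub>R \<delta>)"

lemma gkernel_meas [measurable]: "gkernel \<delta> \<in> borel_measurable borel"
  unfolding gkernel_def [abs_def] by measurable

lemma gkernel_nonneg: "\<delta> > 0 \<Longrightarrow> 0 \<le> gkernel \<delta> z"
  by (auto simp: gkernel_def gauss_def)

lemma gkernel_eq: "\<delta> > 0 \<Longrightarrow> cfourier (\<lambda>x. complex_of_real (gauss (\<delta> *\<^sub>R x))) \<xi> = complex_of_real (gkernel \<delta> \<xi>)"
  unfolding cfourier_def gkernel_def by (rule gauss_scaled_fourier)

lemma gkernel_modulated:
  assumes "\<delta> > 0"
  shows "cfourier (\<lambda>\<xi>. cis (- (x \<bullet> \<xi>)) * complex_of_real (gauss (\<delta> *\<^sub>R \<xi>))) y = complex_of_real (gkernel \<delta> (x + y))"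
  unfolding gkernel_eq[OF assms, symmetric] cfourier_def
  by (intro Bochner_Integration.integral_cong)
    (auto simp: mult.assoc[symmetric] cis_mult inner_add_right inner_commute[of x] add.commute)

text \<open>The mass depends neither on \<delta> nor on the shift, which is why the constant in
  Bessel's inequality is uniform in the regularization.\<close>

lemma gkernel_nn_integral:
  fixes x :: "'a::euclidean_space"
  assumes "\<delta> > 0"
  shows "(\<integral>\<^sup>+z. ennreal (gkernel \<delta> (x + z)) \<partial>lborel) = ennreal ((2 * pi) ^ DIM('a))"
proof -
  have "(\<integral>\<^sup>+(z::'a). ennreal (gauss z) \<partial>lborel) = ennreal (sqrt (2 * pi) ^ DIM('a))"
    by (subst nn_integral_eq_integral) (auto simp: gauss_integrable gauss_integral gauss_pos less_imp_le)
  also have "(\<integral>\<^sup>+(z::'a). ennreal (gauss z) \<partial>lborel) =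
      ennreal (\<bar>1 / \<delta>\<bar> ^ DIM('a)) * (\<integral>\<^sup>+z. ennreal (gauss (x /\<^sub>R \<delta> + (1 / \<delta>) *\<^sub>R z)) \<partial>lborel)"
    using assms nn_integral_lborel_affine[of "1/\<delta>" "\<lambda>z::'a. ennreal (gauss z)" "x /\<^sub>R \<delta>"] by simp
  finally have e: "ennreal (\<bar>1 / \<delta>\<bar> ^ DIM('a)) * (\<integral>\<^sup>+z. ennreal (gauss ((x + z) /\<^sub>R \<delta>)) \<partial>lborel)
      = ennreal (sqrt (2 * pi) ^ DIM('a))"
    by (simp add: scaleR_add_right inverse_eq_divide)
  have "(\<integral>\<^sup>+z. ennreal (gkernel \<delta> (x + z)) \<partial>lborel)
      = ennreal (sqrt (2 * pi) ^ DIM('a)) * (ennreal (\<bar>1 / \<delta>\<bar> ^ DIM('a)) * (\<integral>\<^sup>+z. ennreal (gauss ((x + z) /\<^sub>R \<delta>)) \<partial>lborel))"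
  proof -
    have "ennreal (gkernel \<delta> (x + z))
        = ennreal (sqrt (2 * pi) ^ DIM('a)) * (ennreal (\<bar>1 / \<delta>\<bar> ^ DIM('a)) * ennreal (gauss ((x + z) /\<^sub>R \<delta>)))" for z
      using assms unfolding gkernel_def
      by (simp add: ennreal_mult[symmetric] gauss_pos less_imp_le power_divide)
    then show ?thesis by (simp add: nn_integral_cmult)
  qed
  also have "\<dots> = ennreal (sqrt (2 * pi) ^ DIM('a) * sqrt (2 * pi) ^ DIM('a))"
    unfolding e by (simp add: ennreal_mult)
  also have "sqrt (2 * pi) ^ DIM('a) * sqrt (2 * pi) ^ DIM('a) = (2 * pi) ^ DIM('a)"
    by (subst power_mult_distrib[symmetric]) simp
  finally show ?thesis .
qed

text \<open>The Gaussian weight makes the square of the bounded function \<open>cfourier f\<close>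
  integrable. The multiplication formula then applies twice, first to \<open>f\<close> and then to
  its reflected conjugate, and a translate of the dual Gaussian remains.\<close>

lemma cfourier_square_gauss:
  assumes f: "integrable lborel f" and d: "\<delta> > 0"
  shows "(LINT \<xi>|lborel. complex_of_real ((cmod (cfourier f \<xi>))\<^sup>2 * gauss (\<delta> *\<^sub>R \<xi>))) =
     (LINT x|lborel. f x * (LINT y|lborel. cnj (f (- y)) * complex_of_real (gkernel \<delta> (x + y))))"
proof -
  have [measurable]: "f \<in> borel_measurable borel"
    using borel_measurable_integrable[OF f] by auto
  define g :: "'a \<Rightarrow> complex" where "g = (\<lambda>\<xi>. complex_of_real (gauss (\<delta> *\<^sub>R \<xi>)))"
  define f' where "f' = (\<lambda>x. cnj (f (- x)))"
  have f': "integrable lborel f'"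
    unfolding f'_def using integrable_reflect[OF f] by simp
  have g: "integrable lborel g"
    unfolding g_def using gauss_scaled_integrable[of \<delta>, where 'a='a] d by (simp add: complex_of_real_integrable_eq)
  have h: "integrable lborel (\<lambda>\<xi>. cnj (cfourier f \<xi>) * g \<xi>)"
  proof (rule Bochner_Integration.integrable_bound)
    show "integrable lborel (\<lambda>\<xi>. complex_of_real (LINT x|lborel. cmod (f x)) * g \<xi>)"
      using g by simp
    show "AE \<xi> in lborel. norm (cnj (cfourier f \<xi>) * g \<xi>) \<le> norm (complex_of_real (LINT x|lborel. cmod (f x)) * g \<xi>)"
      using cfourier_bound[of f] by (auto simp: norm_mult intro!: mult_right_mono order.trans[OF _ abs_ge_self])
  qed (use g in \<open>auto simp: g_def\<close>)
  have "(LINT \<xi>|lborel. complex_of_real ((cmod (cfourier f \<xi>))\<^sup>2 * gauss (\<delta> *\<^sub>R \<xi>)))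
      = (LINT \<xi>|lborel. cfourier f \<xi> * (cnj (cfourier f \<xi>) * g \<xi>))"
    unfolding g_def by (simp add: mult.assoc[symmetric] complex_norm_square[symmetric])
  also have "\<dots> = (LINT x|lborel. f x * cfourier (\<lambda>\<xi>. cnj (cfourier f \<xi>) * g \<xi>) x)"
    by (rule cfourier_multiplication[OF f h])
  also have "\<dots> = (LINT x|lborel. f x * (LINT y|lborel. f' y * complex_of_real (gkernel \<delta> (x + y))))"
  proof (intro Bochner_Integration.integral_cong refl arg_cong2[where f="(*)"])
    fix x
    have "cfourier (\<lambda>\<xi>. cnj (cfourier f \<xi>) * g \<xi>) x = (LINT \<xi>|lborel. cfourier f' \<xi> * (cis (- (x \<bullet> \<xi>)) * g \<xi>))"
      unfolding f'_def cfourier_cnj_reflect[OF f]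
      by (subst cfourier_def) (simp add: mult_ac inner_commute)
    also have "\<dots> = (LINT y|lborel. f' y * cfourier (\<lambda>\<xi>. cis (- (x \<bullet> \<xi>)) * g \<xi>) y)"
      by (intro cfourier_multiplication f' integrable_cis_mult g) measurable
    also have "\<dots> = (LINT y|lborel. f' y * complex_of_real (gkernel \<delta> (x + y)))"
      unfolding g_def gkernel_modulated[OF d] ..
    finally show "cfourier (\<lambda>\<xi>. cnj (cfourier f \<xi>) * g \<xi>) x = (LINT y|lborel. f' y * complex_of_real (gkernel \<delta> (x + y)))" .
  qed
  finally show ?thesis unfolding f'_def .
qed

text \<open>A Schur test: the product of the two values of \<open>f\<close> is at most half the sum
  of their squares, and \<open>gkernel\<close> has the same mass in each of its two variables.
  Working in \<open>ennreal\<close> defers all questions of finiteness.\<close>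

lemma cfourier_square_gauss_le:
  fixes f :: "'a::euclidean_space \<Rightarrow> complex"
  assumes f: "integrable lborel f" and d: "\<delta> > 0"
  shows "(\<integral>\<^sup>+\<xi>. ennreal ((cmod (cfourier f \<xi>))\<^sup>2 * gauss (\<delta> *\<^sub>R \<xi>)) \<partial>lborel)
     \<le> ennreal ((2 * pi) ^ DIM('a)) * (\<integral>\<^sup>+x. ennreal ((cmod (f x))\<^sup>2) \<partial>lborel)"
proof -
  have [measurable]: "f \<in> borel_measurable borel"
    using borel_measurable_integrable[OF f] by auto
  define G where "G = (gkernel \<delta> :: 'a \<Rightarrow> real)"
  have G0: "0 \<le> G z" for z unfolding G_def using gkernel_nonneg[OF d] .
  have [measurable]: "G \<in> borel_measurable borel" unfolding G_def by simp
  define I where "I = (\<integral>\<^sup>+x. ennreal ((cmod (f x))\<^sup>2) \<partial>lborel)"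
  define c where "c = ennreal ((2 * pi) ^ DIM('a))"
  have Gi: "(\<integral>\<^sup>+z. ennreal (G (x + z)) \<partial>lborel) = c" for x
    unfolding G_def c_def by (rule gkernel_nn_integral[OF d])
  have i: "integrable lborel (\<lambda>\<xi>. (cmod (cfourier f \<xi>))\<^sup>2 * gauss (\<delta> *\<^sub>R \<xi>))"
  proof (rule Bochner_Integration.integrable_bound)
    show "integrable lborel (\<lambda>\<xi>::'a. (LINT x|lborel. cmod (f x))\<^sup>2 * gauss (\<delta> *\<^sub>R \<xi>))"
      using gauss_scaled_integrable[of \<delta>, where 'a='a] d by simp
    show "AE \<xi> in lborel. norm ((cmod (cfourier f \<xi>))\<^sup>2 * gauss (\<delta> *\<^sub>R \<xi>))
        \<le> norm ((LINT x|lborel. cmod (f x))\<^sup>2 * gauss (\<delta> *\<^sub>R \<xi>))"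
      using cfourier_bound[of f] by (auto simp: abs_mult intro!: mult_right_mono power_mono)
  qed auto
  have "(\<integral>\<^sup>+\<xi>. ennreal ((cmod (cfourier f \<xi>))\<^sup>2 * gauss (\<delta> *\<^sub>R \<xi>)) \<partial>lborel)
      = ennreal (LINT \<xi>|lborel. (cmod (cfourier f \<xi>))\<^sup>2 * gauss (\<delta> *\<^sub>R \<xi>))"
    by (rule nn_integral_eq_integral[OF i]) (auto simp: gauss_def)
  also have "\<dots> \<le> ennreal (cmod (LINT \<xi>|lborel. complex_of_real ((cmod (cfourier f \<xi>))\<^sup>2 * gauss (\<delta> *\<^sub>R \<xi>))))"
    unfolding integral_complex_of_real by (intro ennreal_leI) (simp only: norm_of_real abs_ge_self)
  also have "\<dots> \<le> (\<integral>\<^sup>+x. ennreal (cmod (f x * (LINT y|lborel. cnj (f (- y)) * complex_of_real (G (x + y))))) \<partial>lborel)"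
    unfolding cfourier_square_gauss[OF f d] G_def by (rule ennreal_norm_integral_le)
  also have "\<dots> \<le> (\<integral>\<^sup>+x. \<integral>\<^sup>+y. ennreal (cmod (f x) * cmod (f (- y)) * G (x + y)) \<partial>lborel \<partial>lborel)"
  proof (rule nn_integral_mono)
    fix x
    have "ennreal (cmod (f x * (LINT y|lborel. cnj (f (- y)) * complex_of_real (G (x + y)))))
        = ennreal (cmod (f x)) * ennreal (cmod (LINT y|lborel. cnj (f (- y)) * complex_of_real (G (x + y))))"
      by (simp add: norm_mult ennreal_mult)
    also have "\<dots> \<le> ennreal (cmod (f x)) * (\<integral>\<^sup>+y. ennreal (cmod (cnj (f (- y)) * complex_of_real (G (x + y)))) \<partial>lborel)"
      by (intro mult_left_mono ennreal_norm_integral_le) auto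
    also have "\<dots> = (\<integral>\<^sup>+y. ennreal (cmod (f x) * cmod (f (- y)) * G (x + y)) \<partial>lborel)"
      by (subst nn_integral_cmult[symmetric]) (auto simp: norm_mult G0 ennreal_mult[symmetric] mult.assoc)
    finally show "ennreal (cmod (f x * (LINT y|lborel. cnj (f (- y)) * complex_of_real (G (x + y)))))
        \<le> (\<integral>\<^sup>+y. ennreal (cmod (f x) * cmod (f (- y)) * G (x + y)) \<partial>lborel)" .
  qed
  also have "\<dots> \<le> (\<integral>\<^sup>+x. \<integral>\<^sup>+y. ennreal ((cmod (f x))\<^sup>2 / 2) * ennreal (G (x + y))
      + ennreal ((cmod (f (- y)))\<^sup>2 / 2) * ennreal (G (x + y)) \<partial>lborel \<partial>lborel)"
  proof (intro nn_integral_mono)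
    fix x y
    have "cmod (f x) * cmod (f (- y)) \<le> (cmod (f x))\<^sup>2 / 2 + (cmod (f (- y)))\<^sup>2 / 2"
      using sum_squares_bound[of "cmod (f x)" "cmod (f (- y))"] by simp
    then have "cmod (f x) * cmod (f (- y)) * G (x + y)
        \<le> (cmod (f x))\<^sup>2 / 2 * G (x + y) + (cmod (f (- y)))\<^sup>2 / 2 * G (x + y)"
      by (metis G0 distrib_right mult_right_mono)
    then show "ennreal (cmod (f x) * cmod (f (- y)) * G (x + y)) \<le>
      ennreal ((cmod (f x))\<^sup>2 / 2) * ennreal (G (x + y)) + ennreal ((cmod (f (- y)))\<^sup>2 / 2) * ennreal (G (x + y))"
      by (simp add: ennreal_mult[symmetric] ennreal_plus[symmetric] G0 ennreal_leI del: ennreal_plus)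
  qed
  also have "\<dots> = (\<integral>\<^sup>+x. \<integral>\<^sup>+y. ennreal ((cmod (f x))\<^sup>2 / 2) * ennreal (G (x + y)) \<partial>lborel \<partial>lborel)
      + (\<integral>\<^sup>+x. \<integral>\<^sup>+y. ennreal ((cmod (f (- y)))\<^sup>2 / 2) * ennreal (G (x + y)) \<partial>lborel \<partial>lborel)"
    by (subst nn_integral_add[symmetric]) (auto simp: nn_integral_add)
  also have "(\<integral>\<^sup>+x. \<integral>\<^sup>+y. ennreal ((cmod (f (- y)))\<^sup>2 / 2) * ennreal (G (x + y)) \<partial>lborel \<partial>lborel)
      = (\<integral>\<^sup>+y. \<integral>\<^sup>+x. ennreal ((cmod (f (- y)))\<^sup>2 / 2) * ennreal (G (y + x)) \<partial>lborel \<partial>lborel)"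
    by (subst lborel_pair.Fubini') (auto simp: add.commute)
  also have "(\<integral>\<^sup>+y. \<integral>\<^sup>+x. ennreal ((cmod (f (- y)))\<^sup>2 / 2) * ennreal (G (y + x)) \<partial>lborel \<partial>lborel)
      = (\<integral>\<^sup>+y. ennreal ((cmod (f (- y)))\<^sup>2 / 2) \<partial>lborel) * c"
    by (simp add: nn_integral_cmult Gi nn_integral_multc)
  also have "(\<integral>\<^sup>+y. ennreal ((cmod (f (- y)))\<^sup>2 / 2) \<partial>lborel) = (\<integral>\<^sup>+y. ennreal ((cmod (f y))\<^sup>2 / 2) \<partial>lborel)"
    by (subst nn_integral_reflect[where f="\<lambda>y. ennreal ((cmod (f y))\<^sup>2 / 2)"]) auto
  also have "(\<integral>\<^sup>+x. \<integral>\<^sup>+y. ennreal ((cmod (f x))\<^sup>2 / 2) * ennreal (G (x + y)) \<partial>lborel \<partial>lborel)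
      = (\<integral>\<^sup>+y. ennreal ((cmod (f y))\<^sup>2 / 2) \<partial>lborel) * c"
    by (simp add: nn_integral_cmult Gi nn_integral_multc)
  also have "(\<integral>\<^sup>+y. ennreal ((cmod (f y))\<^sup>2 / 2) \<partial>lborel) * c + (\<integral>\<^sup>+y. ennreal ((cmod (f y))\<^sup>2 / 2) \<partial>lborel) * c
     = c * (\<integral>\<^sup>+y. ennreal ((cmod (f y))\<^sup>2 / 2) + ennreal ((cmod (f y))\<^sup>2 / 2) \<partial>lborel)"
    by (subst nn_integral_add) (auto simp: distrib_left mult.commute)
  also have "(\<integral>\<^sup>+y. ennreal ((cmod (f y))\<^sup>2 / 2) + ennreal ((cmod (f y))\<^sup>2 / 2) \<partial>lborel) = I"
    unfolding I_def by (simp add: ennreal_plus[symmetric] del: ennreal_plus)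
  finally show ?thesis unfolding I_def c_def .
qed

text \<open>Fatou's lemma along \<delta> = 1 / (k + 1) removes the Gaussian weight from the
  preceding estimate.\<close>

lemma cfourier_bessel:
  fixes f :: "'a::euclidean_space \<Rightarrow> complex"
  assumes f: "integrable lborel f"
  shows "(\<integral>\<^sup>+\<xi>. ennreal ((cmod (cfourier f \<xi>))\<^sup>2) \<partial>lborel)
     \<le> ennreal ((2 * pi) ^ DIM('a)) * (\<integral>\<^sup>+x. ennreal ((cmod (f x))\<^sup>2) \<partial>lborel)" (is "_ \<le> ?B")
proof -
  have [measurable]: "f \<in> borel_measurable borel"
    using borel_measurable_integrable[OF f] by auto
  let ?u = "\<lambda>k \<xi>. ennreal ((cmod (cfourier f \<xi>))\<^sup>2 * gauss ((1 / Suc k) *\<^sub>R \<xi>))"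
  have "(\<lambda>k. ?u k \<xi>) \<longlonglongrightarrow> ennreal ((cmod (cfourier f \<xi>))\<^sup>2)" for \<xi>
  proof -
    have "(\<lambda>k. 1 / real (Suc k)) \<longlonglongrightarrow> 0"
      using LIMSEQ_inverse_real_of_nat by (simp add: inverse_eq_divide)
    then have "(\<lambda>k. (cmod (cfourier f \<xi>))\<^sup>2 * exp (- (norm ((1 / real (Suc k)) *\<^sub>R \<xi>))\<^sup>2 / 2)) \<longlonglongrightarrow>
        (cmod (cfourier f \<xi>))\<^sup>2 * exp (- (norm (0 *\<^sub>R \<xi>))\<^sup>2 / 2)"
      by (intro tendsto_intros) auto
    then show ?thesis by (intro tendsto_ennrealI) (simp add: gauss_def)
  qed
  then have "(\<integral>\<^sup>+\<xi>. ennreal ((cmod (cfourier f \<xi>))\<^sup>2) \<partial>lborel) = (\<integral>\<^sup>+\<xi>. liminf (\<lambda>k. ?u k \<xi>) \<partial>lborel)"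
    by (intro nn_integral_cong lim_imp_Liminf[symmetric]) auto
  also have "\<dots> \<le> liminf (\<lambda>k. \<integral>\<^sup>+\<xi>. ?u k \<xi> \<partial>lborel)"
    by (rule nn_integral_liminf) auto
  also have "\<dots> \<le> liminf (\<lambda>k. ?B)"
    by (intro Liminf_mono always_eventually allI cfourier_square_gauss_le f) auto
  finally show ?thesis by (simp add: Liminf_const)
qed

lemma cball_borel_measurable [measurable]: "cball c r \<in> sets borel"
  by (intro borel_closed) auto

section \<open>The Fourier transform on L2\<close>

lemma fourier_eq_cfourier: "fourier f = cfourier (\<lambda>x. complex_of_real (f x))"
  by (auto simp: fourier_def cfourier_def)

lemma inv_fourier_eq_cfourier:
  "inv_fourier F (x :: real^'n) = complex_of_real (1 / (2 * pi) ^ CARD('n)) * cfourier F (- x)"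
  by (simp add: inv_fourier_def cfourier_def inner_commute[of x])

lemma fourier_meas [measurable]: "f \<in> borel_measurable borel \<Longrightarrow> fourier f \<in> borel_measurable borel"
  unfolding fourier_eq_cfourier by measurable

lemma cfourier_add: "integrable lborel f \<Longrightarrow> integrable lborel g \<Longrightarrow>
    cfourier (\<lambda>x. f x + g x) \<xi> = cfourier f \<xi> + cfourier g \<xi>"
  unfolding cfourier_def distrib_left by (intro Bochner_Integration.integral_add integrable_cis_mult) measurable

lemma cfourier_cmult: "cfourier (\<lambda>x. c * f x) \<xi> = c * cfourier f \<xi>"
  unfolding cfourier_def by (subst mult.left_commute) simp

lemma cfourier_diff: "integrable lborel f \<Longrightarrow> integrable lborel g \<Longrightarrow>
    cfourier (\<lambda>x. f x - g x) \<xi> = cfourier f \<xi> - cfourier g \<xi>"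
  unfolding cfourier_def right_diff_distrib by (intro Bochner_Integration.integral_diff integrable_cis_mult) measurable

lemma square_integrableD:
  assumes "square_integrable f"
  shows "f \<in> borel_measurable borel" "integrable lborel (\<lambda>x. (norm (f x))\<^sup>2)"
  using assms by (auto simp: square_integrable_def)

text \<open>On a ball, which has finite measure, \<open>\<bar>y\<bar> \<le> 1 + y\<^sup>2\<close>
  makes a square integrable function integrable.\<close>

lemma integrable_truncation:
  fixes f :: "real^'n \<Rightarrow> real"
  assumes "square_integrable f"
  shows "integrable lborel (\<lambda>x. indicator (cball 0 R) x * f x)"
proof (rule Bochner_Integration.integrable_bound)
  note [measurable] = square_integrableD(1)[OF assms]
  have "emeasure lborel (cball (0::real^'n) R) < \<infinity>"
    by (rule emeasure_bounded_finite) auto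
  then have "integrable lborel (indicator (cball (0::real^'n) R) :: _ \<Rightarrow> real)"
    by (intro integrable_real_indicator) auto
  then show "integrable lborel (\<lambda>x. indicator (cball (0::real^'n) R) x + (norm (f x))\<^sup>2)"
    using square_integrableD(2)[OF assms] by (intro Bochner_Integration.integrable_add) auto
  have "\<bar>y\<bar> \<le> 1 + y\<^sup>2" for y :: real
    using sum_squares_bound[of 1 "\<bar>y\<bar>"] by auto
  then show "AE x in lborel. norm (indicator (cball 0 R) x * f x) \<le> norm (indicator (cball (0::real^'n) R) x + (norm (f x))\<^sup>2)"
    by (auto simp: indicator_def)
  show "(\<lambda>x. indicator (cball 0 R) x * f x) \<in> borel_measurable lborel" by simp
qed

lemma square_integrable_add:
  fixes f g :: "real^'n \<Rightarrow> 'b::euclidean_space"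
  assumes f: "square_integrable f" and g: "square_integrable g"
  shows "square_integrable (\<lambda>x. f x + g x)"
  unfolding square_integrable_def
proof
  note [measurable] = square_integrableD(1)[OF f] square_integrableD(1)[OF g]
  show "(\<lambda>x. f x + g x) \<in> borel_measurable lborel" by measurable
  show "integrable lborel (\<lambda>x. (norm (f x + g x))\<^sup>2)"
  proof (rule Bochner_Integration.integrable_bound)
    show "integrable lborel (\<lambda>x. 2 * ((norm (f x))\<^sup>2 + (norm (g x))\<^sup>2))"
      using square_integrableD(2)[OF f] square_integrableD(2)[OF g] by simp
    have "(norm (f x + g x))\<^sup>2 \<le> 2 * ((norm (f x))\<^sup>2 + (norm (g x))\<^sup>2)" for x
    proof -
      have "(norm (f x + g x))\<^sup>2 \<le> (norm (f x) + norm (g x))\<^sup>2"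
        by (intro power_mono norm_triangle_ineq) auto
      also have "\<dots> \<le> 2 * ((norm (f x))\<^sup>2 + (norm (g x))\<^sup>2)"
        using sum_squares_bound[of "norm (f x)" "norm (g x)"] by (simp add: power2_sum)
      finally show ?thesis .
    qed
    then show "AE x in lborel. norm ((norm (f x + g x))\<^sup>2) \<le> norm (2 * ((norm (f x))\<^sup>2 + (norm (g x))\<^sup>2))"
      by auto
  qed measurable
qed

lemma square_integrable_cmult:
  fixes f :: "real^'n \<Rightarrow> 'b::{euclidean_space,real_normed_field}"
  assumes f: "square_integrable f"
  shows "square_integrable (\<lambda>x. c * f x)"
  using square_integrableD[OF f] by (auto simp: square_integrable_def norm_mult power_mult_distrib)

text \<open>A substitute for Minkowski's inequality that avoids square roots in
  \<open>ennreal\<close>; its factor 2 is harmless because it is applied to quantities that tend to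
  0.\<close>

lemma nn_integral_square_add:
  assumes [measurable]: "F \<in> borel_measurable M" "G \<in> borel_measurable M"
  shows "(\<integral>\<^sup>+\<xi>. ennreal ((cmod (F \<xi> + G \<xi>))\<^sup>2) \<partial>M)
      \<le> 2 * ((\<integral>\<^sup>+\<xi>. ennreal ((cmod (F \<xi>))\<^sup>2) \<partial>M) + (\<integral>\<^sup>+\<xi>. ennreal ((cmod (G \<xi>))\<^sup>2) \<partial>M))"
proof -
  have "(cmod (a + b))\<^sup>2 \<le> 2 * ((cmod a)\<^sup>2 + (cmod b)\<^sup>2)" for a b
  proof -
    have "(cmod (a + b))\<^sup>2 \<le> (cmod a + cmod b)\<^sup>2"
      by (intro power_mono norm_triangle_ineq) auto
    then show ?thesis
      using sum_squares_bound[of "cmod a" "cmod b"] by (simp add: power2_sum)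
  qed
  then have "(\<integral>\<^sup>+\<xi>. ennreal ((cmod (F \<xi> + G \<xi>))\<^sup>2) \<partial>M)
      \<le> (\<integral>\<^sup>+\<xi>. ennreal (2 * ((cmod (F \<xi>))\<^sup>2 + (cmod (G \<xi>))\<^sup>2)) \<partial>M)"
    by (intro nn_integral_mono ennreal_leI) auto
  also have "\<dots> = (\<integral>\<^sup>+\<xi>. 2 * (ennreal ((cmod (F \<xi>))\<^sup>2) + ennreal ((cmod (G \<xi>))\<^sup>2)) \<partial>M)"
    by (intro nn_integral_cong) (simp add: ennreal_mult)
  finally show ?thesis by (simp add: nn_integral_cmult nn_integral_add)
qed

lemma has_l2_fourierD:
  assumes "has_l2_fourier f F"
  shows "square_integrable f" "square_integrable F" "f \<in> borel_measurable borel" "F \<in> borel_measurable borel"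
    "((\<lambda>R. \<integral>\<^sup>+\<xi>. ennreal ((cmod (fourier (\<lambda>x. indicator (cball 0 R) x * f x) \<xi> - F \<xi>))\<^sup>2) \<partial>lborel) \<longlongrightarrow> 0) at_top"
  using assms square_integrableD by (auto simp: has_l2_fourier_def)

lemma tendsto_zero_ennreal_le:
  fixes f g :: "'a \<Rightarrow> ennreal"
  assumes "(g \<longlongrightarrow> c) F" "c = 0" "\<And>x. f x \<le> g x"
  shows "(f \<longlongrightarrow> 0) F"
  by (rule tendsto_sandwich[OF _ _ tendsto_const assms(1)[unfolded assms(2)]]) (use assms(3) in auto)

text \<open>For every radius the distance of the two candidates is controlled by their distances to
  the same truncated transform, and both of these vanish in the limit.\<close>

lemma has_l2_fourier_unique:
  assumes F: "has_l2_fourier f F" and G: "has_l2_fourier f G"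
  shows "AE \<xi> in lborel. F \<xi> = G \<xi>"
proof -
  note [measurable] = has_l2_fourierD(3,4)[OF F] has_l2_fourierD(4)[OF G]
  let ?t = "\<lambda>R. fourier (\<lambda>x. indicator (cball 0 R) x * f x)"
  have "((\<lambda>R. 2 * ((\<integral>\<^sup>+\<xi>. ennreal ((cmod (?t R \<xi> - F \<xi>))\<^sup>2) \<partial>lborel)
      + (\<integral>\<^sup>+\<xi>. ennreal ((cmod (?t R \<xi> - G \<xi>))\<^sup>2) \<partial>lborel))) \<longlongrightarrow> 2 * (0 + 0)) at_top"
    by (intro tendsto_add ennreal_tendsto_cmult has_l2_fourierD(5)[OF F] has_l2_fourierD(5)[OF G]) auto
  moreover have "(\<integral>\<^sup>+\<xi>. ennreal ((cmod (F \<xi> - G \<xi>))\<^sup>2) \<partial>lborel) \<le> 2 * ((\<integral>\<^sup>+\<xi>. ennreal ((cmod (?t R \<xi> - F \<xi>))\<^sup>2) \<partial>lborel)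
      + (\<integral>\<^sup>+\<xi>. ennreal ((cmod (?t R \<xi> - G \<xi>))\<^sup>2) \<partial>lborel))" for R
    using nn_integral_square_add[of "\<lambda>\<xi>. F \<xi> - ?t R \<xi>" lborel "\<lambda>\<xi>. ?t R \<xi> - G \<xi>"]
    by (simp add: norm_minus_commute)
  ultimately have "(\<integral>\<^sup>+\<xi>. ennreal ((cmod (F \<xi> - G \<xi>))\<^sup>2) \<partial>lborel) \<le> 2 * (0 + 0)"
    by (intro tendsto_lowerbound[of _ _ at_top]) auto
  then have "(\<integral>\<^sup>+\<xi>. ennreal ((cmod (F \<xi> - G \<xi>))\<^sup>2) \<partial>lborel) = 0" by simp
  then show ?thesis
    by (subst (asm) nn_integral_0_iff_AE) (auto simp: ennreal_eq_0_iff)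
qed

lemma has_l2_fourier_add:
  assumes F: "has_l2_fourier f F" and G: "has_l2_fourier g G"
  shows "has_l2_fourier (\<lambda>x. f x + g x) (\<lambda>\<xi>. F \<xi> + G \<xi>)"
  unfolding has_l2_fourier_def
proof (intro conjI)
  note F' = has_l2_fourierD[OF F] and G' = has_l2_fourierD[OF G]
  note [measurable] = F'(3,4) G'(3,4)
  show "square_integrable (\<lambda>x. f x + g x)" "square_integrable (\<lambda>\<xi>. F \<xi> + G \<xi>)"
    using F' G' by (auto intro!: square_integrable_add)
  let ?t = "\<lambda>f R. fourier (\<lambda>x. indicator (cball 0 R) x * f x)"
  have "((\<lambda>R. 2 * ((\<integral>\<^sup>+\<xi>. ennreal ((cmod (?t f R \<xi> - F \<xi>))\<^sup>2) \<partial>lborel)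
      + (\<integral>\<^sup>+\<xi>. ennreal ((cmod (?t g R \<xi> - G \<xi>))\<^sup>2) \<partial>lborel))) \<longlongrightarrow> 2 * (0 + 0)) at_top"
    by (intro tendsto_add ennreal_tendsto_cmult F' G') auto
  then show "((\<lambda>R. \<integral>\<^sup>+\<xi>. ennreal ((cmod (?t (\<lambda>x. f x + g x) R \<xi> - (F \<xi> + G \<xi>)))\<^sup>2) \<partial>lborel) \<longlongrightarrow> 0) at_top"
  proof (rule tendsto_zero_ennreal_le)
    fix R
    have "?t (\<lambda>x. f x + g x) R \<xi> = ?t f R \<xi> + ?t g R \<xi>" for \<xi>
      unfolding fourier_eq_cfourier distrib_left of_real_add
      using integrable_truncation[OF F'(1), of R] integrable_truncation[OF G'(1), of R]
      by (intro cfourier_add) (auto simp: complex_of_real_integrable_eq simp del: of_real_mult)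
    then show "(\<integral>\<^sup>+\<xi>. ennreal ((cmod (?t (\<lambda>x. f x + g x) R \<xi> - (F \<xi> + G \<xi>)))\<^sup>2) \<partial>lborel)
      \<le> 2 * ((\<integral>\<^sup>+\<xi>. ennreal ((cmod (?t f R \<xi> - F \<xi>))\<^sup>2) \<partial>lborel)
      + (\<integral>\<^sup>+\<xi>. ennreal ((cmod (?t g R \<xi> - G \<xi>))\<^sup>2) \<partial>lborel))"
      using nn_integral_square_add[of "\<lambda>\<xi>. ?t f R \<xi> - F \<xi>" lborel "\<lambda>\<xi>. ?t g R \<xi> - G \<xi>"]
      by (simp add: algebra_simps)
  qed simp
qed

lemma has_l2_fourier_cmult:
  assumes F: "has_l2_fourier f F"
  shows "has_l2_fourier (\<lambda>x. c * f x) (\<lambda>\<xi>. complex_of_real c * F \<xi>)"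
  unfolding has_l2_fourier_def
proof (intro conjI)
  note F' = has_l2_fourierD[OF F]
  note [measurable] = F'(3,4)
  show "square_integrable (\<lambda>x. c * f x)" "square_integrable (\<lambda>\<xi>. complex_of_real c * F \<xi>)"
    using F' by (auto intro!: square_integrable_cmult)
  let ?t = "\<lambda>f R. fourier (\<lambda>x. indicator (cball 0 R) x * f x)"
  have "?t (\<lambda>x. c * f x) R \<xi> = complex_of_real c * ?t f R \<xi>" for R \<xi>
    unfolding fourier_eq_cfourier of_real_mult mult.left_commute[of _ "complex_of_real c"]
    by (rule cfourier_cmult)
  then have eq: "cmod (?t (\<lambda>x. c * f x) R \<xi> - complex_of_real c * F \<xi>) = \<bar>c\<bar> * cmod (?t f R \<xi> - F \<xi>)" for R \<xi>
    by (simp add: right_diff_distrib[symmetric] norm_mult)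
  have "((\<lambda>R. ennreal (c\<^sup>2) * (\<integral>\<^sup>+\<xi>. ennreal ((cmod (?t f R \<xi> - F \<xi>))\<^sup>2) \<partial>lborel)) \<longlongrightarrow> ennreal (c\<^sup>2) * 0) at_top"
    by (intro ennreal_tendsto_cmult F') auto
  then show "((\<lambda>R. \<integral>\<^sup>+\<xi>. ennreal ((cmod (?t (\<lambda>x. c * f x) R \<xi> - complex_of_real c * F \<xi>))\<^sup>2) \<partial>lborel) \<longlongrightarrow> 0) at_top"
    unfolding eq by (simp add: power_mult_distrib ennreal_mult nn_integral_cmult)
qed

lemma has_l2_fourier_diff:
  assumes F: "has_l2_fourier f F" and G: "has_l2_fourier g G"
  shows "has_l2_fourier (\<lambda>x. f x - g x) (\<lambda>\<xi>. F \<xi> - G \<xi>)"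
  using has_l2_fourier_add[OF F has_l2_fourier_cmult[OF G, of "-1"]] by simp

lemma has_l2_fourier_sum:
  assumes "finite I" "I \<noteq> {}" "\<And>i. i \<in> I \<Longrightarrow> has_l2_fourier (f i) (F i)"
  shows "has_l2_fourier (\<lambda>x. \<Sum>i\<in>I. f i x) (\<lambda>\<xi>. \<Sum>i\<in>I. F i \<xi>)"
  using assms by (induction rule: finite_ne_induct) (auto intro: has_l2_fourier_add)

text \<open>The truncated transforms converge pointwise to \<open>fourier f\<close> by dominated
  convergence and in L2 to \<open>F\<close>; Fatou's lemma identifies the limits. Through this lemma
  the Sobolev norms of the data become integrals of \<open>fourier v0\<close> and
  \<open>fourier v1\<close>.\<close>

lemma has_l2_fourier_L1:
  assumes F: "has_l2_fourier f F" and f: "integrable lborel f"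
  shows "AE \<xi> in lborel. F \<xi> = fourier f \<xi>"
proof -
  note F' = has_l2_fourierD[OF F]
  note [measurable] = F'(3,4)
  let ?t = "\<lambda>R. fourier (\<lambda>x. indicator (cball 0 R) x * f x)"
  have lim: "(\<lambda>k. ?t (real k) \<xi>) \<longlonglongrightarrow> fourier f \<xi>" for \<xi>
    unfolding fourier_def
  proof (rule integral_dominated_convergence[where w="\<lambda>x. \<bar>f x\<bar>"])
    show "AE x in lborel. (\<lambda>k. cis (- (x \<bullet> \<xi>)) * complex_of_real (indicator (cball 0 (real k)) x * f x))
        \<longlonglongrightarrow> cis (- (x \<bullet> \<xi>)) * complex_of_real (f x)"
    proof (intro AE_I2 tendsto_eventually)
      fix x :: "real^'a"
      obtain N where "norm x \<le> real N" using real_arch_simple by blast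
      then show "\<forall>\<^sub>F k in sequentially. cis (- (x \<bullet> \<xi>)) * complex_of_real (indicator (cball 0 (real k)) x * f x)
          = cis (- (x \<bullet> \<xi>)) * complex_of_real (f x)"
        by (intro eventually_sequentiallyI[of N]) auto
    qed
  qed (use f in \<open>auto simp: norm_mult indicator_def\<close>)
  have "(\<integral>\<^sup>+\<xi>. ennreal ((cmod (fourier f \<xi> - F \<xi>))\<^sup>2) \<partial>lborel)
      = (\<integral>\<^sup>+\<xi>. liminf (\<lambda>k. ennreal ((cmod (?t (real k) \<xi> - F \<xi>))\<^sup>2)) \<partial>lborel)"
    by (intro nn_integral_cong lim_imp_Liminf[symmetric] tendsto_ennrealI tendsto_intros lim) auto
  also have "\<dots> \<le> liminf (\<lambda>k. \<integral>\<^sup>+\<xi>. ennreal ((cmod (?t (real k) \<xi> - F \<xi>))\<^sup>2) \<partial>lborel)"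
    by (rule nn_integral_liminf) auto
  also have "\<dots> = 0"
    by (intro lim_imp_Liminf filterlim_compose[OF F'(5) filterlim_real_sequentially]) auto
  finally have "(\<integral>\<^sup>+\<xi>. ennreal ((cmod (fourier f \<xi> - F \<xi>))\<^sup>2) \<partial>lborel) = 0" by simp
  then show ?thesis
    by (subst (asm) nn_integral_0_iff_AE) (auto simp: ennreal_eq_0_iff)
qed

text \<open>The choice operator may pick any of the almost everywhere equal transforms; weighted
  integrals do not see which one.\<close>

lemma l2_fourier_AE:
  assumes F: "has_l2_fourier f F"
  shows "AE \<xi> in lborel. l2_fourier f \<xi> = F \<xi>" "l2_fourier f \<in> borel_measurable borel"
proof -
  have "has_l2_fourier f (l2_fourier f)"
    unfolding l2_fourier_def by (rule someI[of "has_l2_fourier f", OF F])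
  then show "AE \<xi> in lborel. l2_fourier f \<xi> = F \<xi>" "l2_fourier f \<in> borel_measurable borel"
    using has_l2_fourier_unique[OF _ F] has_l2_fourierD(4) by auto
qed

lemma hom_sobolev_norm_eq:
  assumes F: "has_l2_fourier (f :: real^'n \<Rightarrow> real) F"
  shows "hom_sobolev_norm s f = sqrt (1 / (2 * pi) ^ CARD('n) *
     (LINT \<xi>|lborel. norm \<xi> powr (2 * s) * (cmod (F \<xi>))\<^sup>2))"
proof -
  note [measurable] = has_l2_fourierD(4)[OF F] l2_fourier_AE(2)[OF F]
  have "(LINT \<xi>|lborel. norm \<xi> powr (2 * s) * (cmod (l2_fourier f \<xi>))\<^sup>2)
      = (LINT \<xi>|lborel. norm \<xi> powr (2 * s) * (cmod (F \<xi>))\<^sup>2)"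
    using l2_fourier_AE(1)[OF F] by (intro integral_cong_AE) auto
  then show ?thesis by (simp add: hom_sobolev_norm_def)
qed

lemma sobolev_norm_eq:
  assumes F: "has_l2_fourier (f :: real^'n \<Rightarrow> real) F" and G: "AE \<xi> in lborel. F \<xi> = G \<xi>"
    and [measurable]: "G \<in> borel_measurable borel"
  shows "sobolev_norm s f = sqrt (1 / (2 * pi) ^ CARD('n) *
     (LINT \<xi>|lborel. (1 + (norm \<xi>)\<^sup>2) powr s * (cmod (G \<xi>))\<^sup>2))"
proof -
  note [measurable] = l2_fourier_AE(2)[OF F]
  have "(LINT \<xi>|lborel. (1 + (norm \<xi>)\<^sup>2) powr s * (cmod (l2_fourier f \<xi>))\<^sup>2)
      = (LINT \<xi>|lborel. (1 + (norm \<xi>)\<^sup>2) powr s * (cmod (G \<xi>))\<^sup>2)"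
    using l2_fourier_AE(1)[OF F] G by (intro integral_cong_AE) auto
  then show ?thesis by (simp add: sobolev_norm_def)
qed

section \<open>Fourier inversion for symbols of Gaussian decay\<close>

text \<open>Decay faster than every Gaussian, with a constant depending on the rate. The class
  contains the damping factor \<open>exp (- k * norm \<xi> ^ 4)\<close> and is stable under
  multiplication by polynomials, so derivatives of the profiles never leave it.\<close>

definition gdecay :: "('a::euclidean_space \<Rightarrow> complex) \<Rightarrow> bool" where
  "gdecay F \<longleftrightarrow> F \<in> borel_measurable borel \<and> (\<forall>a. \<exists>C\<ge>0. \<forall>\<xi>. cmod (F \<xi>) \<le> C * exp (- a * (norm \<xi>)\<^sup>2))"

lemma gdecayD:
  assumes "gdecay F"
  obtains C where "C \<ge> 0" "\<And>\<xi>. cmod (F \<xi>) \<le> C * exp (- a * (norm \<xi>)\<^sup>2)"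
  using assms unfolding gdecay_def by blast

lemma gdecay_meas: "gdecay F \<Longrightarrow> F \<in> borel_measurable borel"
  by (simp add: gdecay_def)

lemma exp_gauss: "exp (- a * (norm \<xi>)\<^sup>2) = gauss (sqrt (2 * a) *\<^sub>R \<xi>)" if "a \<ge> 0"
  using that by (simp add: gauss_def power_mult_distrib)

lemma integrable_exp_norm2: "a > 0 \<Longrightarrow> integrable lborel (\<lambda>\<xi>::'a::euclidean_space. exp (- a * (norm \<xi>)\<^sup>2))"
  by (subst exp_gauss) (auto intro: gauss_scaled_integrable)

lemma gdecay_integrable:
  fixes F :: "'a::euclidean_space \<Rightarrow> complex"
  assumes F: "gdecay F"
  shows "integrable lborel F" "integrable lborel (\<lambda>\<xi>. (cmod (F \<xi>))\<^sup>2)"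
proof -
  note [measurable] = gdecay_meas[OF F]
  obtain C where C: "C \<ge> 0" "\<And>\<xi>. cmod (F \<xi>) \<le> C * exp (- 1 * (norm \<xi>)\<^sup>2)"
    using gdecayD[OF F] by metis
  have i: "integrable lborel (\<lambda>\<xi>::'a. C * exp (- a * (norm \<xi>)\<^sup>2))" if "a > 0" for C a
    by (intro integrable_mult_right integrable_exp_norm2 that)
  show "integrable lborel F"
    using C by (intro Bochner_Integration.integrable_bound[OF i[of 1 C]]) (auto intro: order.trans[OF _ abs_ge_self])
  have "(cmod (F \<xi>))\<^sup>2 \<le> C\<^sup>2 * exp (- 2 * (norm \<xi>)\<^sup>2)" for \<xi>
  proof -
    have "(cmod (F \<xi>))\<^sup>2 \<le> (C * exp (- 1 * (norm \<xi>)\<^sup>2))\<^sup>2"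
      by (intro power_mono C) auto
    then show ?thesis by (simp add: power_mult_distrib exp_double[symmetric])
  qed
  then show "integrable lborel (\<lambda>\<xi>. (cmod (F \<xi>))\<^sup>2)"
    by (intro Bochner_Integration.integrable_bound[OF i[of 2 "C\<^sup>2"]]) (auto intro: order.trans[OF _ abs_ge_self])
qed

text \<open>A growing factor \<open>exp (b * (norm \<xi>)\<^sup>2)\<close> is paid for by invoking
  the decay of \<open>F\<close> at the rate \<open>a + b\<close> instead of
  \<open>a\<close>.\<close>

lemma gdecay_mult_bound:
  assumes F: "gdecay F" and [measurable]: "G \<in> borel_measurable borel"
    and G: "\<And>\<xi>. cmod (G \<xi>) \<le> K * exp (b * (norm \<xi>)\<^sup>2) * cmod (F \<xi>)" and K: "K \<ge> 0"
  shows "gdecay G"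
  unfolding gdecay_def
proof (intro conjI allI)
  fix a
  obtain C where C: "C \<ge> 0" "\<And>\<xi>. cmod (F \<xi>) \<le> C * exp (- (a + b) * (norm \<xi>)\<^sup>2)"
    using gdecayD[OF F] by metis
  have "cmod (G \<xi>) \<le> K * C * exp (- a * (norm \<xi>)\<^sup>2)" for \<xi>
  proof -
    have "cmod (G \<xi>) \<le> K * exp (b * (norm \<xi>)\<^sup>2) * (C * exp (- (a + b) * (norm \<xi>)\<^sup>2))"
      by (rule order.trans[OF G]) (intro mult_left_mono C, use K in auto)
    also have "\<dots> = K * C * exp (- a * (norm \<xi>)\<^sup>2)"
      by (simp add: algebra_simps exp_add[symmetric])
    finally show ?thesis .
  qed
  then show "\<exists>C\<ge>0. \<forall>\<xi>. cmod (G \<xi>) \<le> C * exp (- a * (norm \<xi>)\<^sup>2)"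
    using C K by (intro exI[of _ "K * C"]) auto
qed fact

lemma le_exp_square: "x \<le> exp (x\<^sup>2)" for x :: real
proof -
  have "2 * x \<le> 1 + x\<^sup>2" "0 \<le> x\<^sup>2" using sum_squares_bound[of 1 x] by simp_all
  then show ?thesis using exp_ge_add_one_self[of "x\<^sup>2"] by linarith
qed

lemma gdecay_coord:
  fixes F :: "real^'n \<Rightarrow> complex"
  assumes "gdecay F"
  shows "gdecay (\<lambda>\<xi>. \<i> * complex_of_real (\<xi> $ i) * F \<xi>)"
proof (rule gdecay_mult_bound[OF assms, of _ 1 1])
  show "cmod (\<i> * complex_of_real (\<xi> $ i) * F \<xi>) \<le> 1 * exp (1 * (norm \<xi>)\<^sup>2) * cmod (F \<xi>)" for \<xi>
    using component_le_norm_cart[of \<xi> i] le_exp_square[of "norm \<xi>"]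
    by (auto simp: norm_mult intro!: mult_right_mono)
qed (use gdecay_meas[OF assms] in auto)

lemma square_integral_tail_tendsto:
  fixes \<phi> :: "'a::euclidean_space \<Rightarrow> complex"
  assumes [measurable]: "\<phi> \<in> borel_measurable borel" and fin: "(\<integral>\<^sup>+x. ennreal ((cmod (\<phi> x))\<^sup>2) \<partial>lborel) < \<infinity>"
  shows "((\<lambda>R. \<integral>\<^sup>+x. ennreal ((cmod (indicator (- cball 0 R) x * \<phi> x))\<^sup>2) \<partial>lborel) \<longlongrightarrow> 0) at_top"
proof (rule tendsto_at_topI_sequentially)
  fix X :: "nat \<Rightarrow> real" assume X: "filterlim X at_top sequentially"
  have "(\<lambda>k. \<integral>\<^sup>+x. ennreal ((cmod (indicator (- cball 0 (X k)) x * \<phi> x))\<^sup>2) \<partial>lborel) \<longlonglongrightarrow> (\<integral>\<^sup>+(x::'a). 0 \<partial>lborel)"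
  proof (rule nn_integral_dominated_convergence[where w="\<lambda>x. ennreal ((cmod (\<phi> x))\<^sup>2)"])
    show "AE x in lborel. (\<lambda>k. ennreal ((cmod (indicator (- cball 0 (X k)) x * \<phi> x))\<^sup>2)) \<longlonglongrightarrow> 0"
    proof (intro AE_I2 tendsto_eventually)
      fix x :: 'a
      have "\<forall>\<^sub>F k in sequentially. norm x \<le> X k" using X by (simp add: filterlim_at_top)
      then show "\<forall>\<^sub>F k in sequentially. ennreal ((cmod (indicator (- cball 0 (X k)) x * \<phi> x))\<^sup>2) = 0"
        by eventually_elim auto
    qed
  qed (use fin in \<open>auto simp: indicator_def\<close>)
  then show "(\<lambda>k. \<integral>\<^sup>+x. ennreal ((cmod (indicator (- cball 0 (X k)) x * \<phi> x))\<^sup>2) \<partial>lborel) \<longlonglongrightarrow> 0"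
    by simp
qed

lemma inverse_Suc_tendsto_0: "(\<lambda>j. 1 / real (Suc j)) \<longlonglongrightarrow> 0"
  using LIMSEQ_inverse_real_of_nat by (simp add: inverse_eq_divide)

text \<open>Multiplying the inverse transform by a Gaussian amounts to convolving the symbol with the
  dual Gaussian, which recovers the symbol in the limit.\<close>

lemma cfourier_regularized:
  fixes F :: "real^'n \<Rightarrow> complex"
  assumes F: "gdecay F" and d: "\<delta> > 0"
  shows "integrable lborel (\<lambda>x. inv_fourier F x * complex_of_real (gauss (\<delta> *\<^sub>R x)))"
    and "cfourier (\<lambda>x. inv_fourier F x * complex_of_real (gauss (\<delta> *\<^sub>R x))) \<xi>
      = complex_of_real (1 / sqrt (2 * pi) ^ CARD('n)) * (LINT y|lborel. F (\<xi> + \<delta> *\<^sub>R y) * complex_of_real (gauss y))"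
proof -
  note [measurable] = gdecay_meas[OF F]
  note Fi = gdecay_integrable(1)[OF F]
  define g :: "real^'n \<Rightarrow> complex" where "g = (\<lambda>\<xi>. complex_of_real (gauss (\<delta> *\<^sub>R \<xi>)))"
  define c where "c = complex_of_real (1 / (2 * pi) ^ CARD('n))"
  have [measurable]: "g \<in> borel_measurable borel" unfolding g_def by measurable
  have g: "integrable lborel g"
    unfolding g_def using gauss_scaled_integrable[of \<delta>, where 'a="real^'n"] d by (simp add: complex_of_real_integrable_eq)
  have m: "(\<lambda>x. inv_fourier F x) \<in> borel_measurable borel"
    unfolding inv_fourier_eq_cfourier by measurable
  show "integrable lborel (\<lambda>x. inv_fourier F x * complex_of_real (gauss (\<delta> *\<^sub>R x)))"
  proof (rule Bochner_Integration.integrable_bound)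
    show "integrable lborel (\<lambda>x. complex_of_real (cmod c * (LINT x|lborel. cmod (F x))) * g x)" using g by simp
    show "AE x in lborel. norm (inv_fourier F x * complex_of_real (gauss (\<delta> *\<^sub>R x)))
        \<le> norm (complex_of_real (cmod c * (LINT x|lborel. cmod (F x))) * g x)"
      unfolding inv_fourier_eq_cfourier c_def[symmetric]
      by (intro AE_I2) (auto simp: norm_mult g_def abs_mult intro!: mult_right_mono mult_left_mono cfourier_bound)
  qed (use m in \<open>auto simp: g_def\<close>)
  have "cfourier (\<lambda>x. inv_fourier F x * g x) \<xi> = (LINT x|lborel. cis (- (x \<bullet> \<xi>)) * (c * cfourier F (- x) * g (- x)))"
  proof -
    have "g (- x) = g x" for x by (simp add: g_def gauss_def)
    then show ?thesis unfolding inv_fourier_eq_cfourier c_def[symmetric] by (subst cfourier_def) simp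
  qed
  also have "\<dots> = (LINT x|lborel. cis (x \<bullet> \<xi>) * (c * cfourier F x * g x))"
    by (subst integral_reflect[symmetric]) auto
  also have "\<dots> = c * (LINT x|lborel. cfourier F x * (cis (- ((- \<xi>) \<bullet> x)) * g x))"
    by (subst integral_mult_right_zero[symmetric]) (simp add: mult_ac inner_commute)
  also have "(LINT x|lborel. cfourier F x * (cis (- ((- \<xi>) \<bullet> x)) * g x))
      = (LINT \<eta>|lborel. F \<eta> * cfourier (\<lambda>x. cis (- ((- \<xi>) \<bullet> x)) * g x) \<eta>)"
    by (intro cfourier_multiplication Fi integrable_cis_mult g) measurable
  also have "\<dots> = (LINT \<eta>|lborel. F \<eta> * complex_of_real (gkernel \<delta> (- \<xi> + \<eta>)))"
    unfolding g_def gkernel_modulated[OF d] ..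
  also have "\<dots> = (\<bar>\<delta>\<bar> ^ CARD('n)) *\<^sub>R (LINT y|lborel. F (\<xi> + \<delta> *\<^sub>R y) * complex_of_real (gkernel \<delta> (- \<xi> + (\<xi> + \<delta> *\<^sub>R y))))"
    using d lborel_integral_affine[of \<delta> "\<lambda>\<eta>. F \<eta> * complex_of_real (gkernel \<delta> (- \<xi> + \<eta>))" \<xi>] by simp
  also have "\<dots> = (\<bar>\<delta>\<bar> ^ CARD('n)) *\<^sub>R (LINT y|lborel. complex_of_real ((sqrt (2 * pi) / \<delta>) ^ CARD('n)) * (F (\<xi> + \<delta> *\<^sub>R y) * complex_of_real (gauss y)))"
    using d by (simp add: gkernel_def mult_ac del: integral_mult_right_zero)
  also have "\<dots> = complex_of_real (sqrt (2 * pi) ^ CARD('n)) * (LINT y|lborel. F (\<xi> + \<delta> *\<^sub>R y) * complex_of_real (gauss y))"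
    using d by (simp add: scaleR_conv_of_real power_divide)
  finally have "cfourier (\<lambda>x. inv_fourier F x * g x) \<xi>
    = c * complex_of_real (sqrt (2 * pi) ^ CARD('n)) * (LINT y|lborel. F (\<xi> + \<delta> *\<^sub>R y) * complex_of_real (gauss y))"
    by simp
  moreover have "c * complex_of_real (sqrt (2 * pi) ^ CARD('n)) = complex_of_real (1 / sqrt (2 * pi) ^ CARD('n))"
  proof -
    have "(2 * pi) ^ CARD('n) = sqrt (2 * pi) ^ CARD('n) * sqrt (2 * pi) ^ CARD('n)"
      by (subst power_mult_distrib[symmetric]) simp
    then show ?thesis unfolding c_def of_real_mult[symmetric] of_real_eq_iff by simp
  qed
  ultimately show "cfourier (\<lambda>x. inv_fourier F x * complex_of_real (gauss (\<delta> *\<^sub>R x))) \<xi>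
      = complex_of_real (1 / sqrt (2 * pi) ^ CARD('n)) * (LINT y|lborel. F (\<xi> + \<delta> *\<^sub>R y) * complex_of_real (gauss y))"
    unfolding g_def by simp
qed

text \<open>Dominated convergence is used twice: in \<open>y\<close> for the pointwise limit of the
  convolution, and in \<xi> for the integral, with a Gaussian majorant independent of
  \<open>j\<close>. Continuity is asked only away from the origin because the symbol of
  \<open>G1\<close> jumps there; the exceptional point is a null set.\<close>

lemma cfourier_regularized_tendsto:
  fixes F :: "real^'n \<Rightarrow> complex"
  assumes F: "gdecay F" and cont: "\<And>\<xi>. \<xi> \<noteq> 0 \<Longrightarrow> isCont F \<xi>"
  defines "F' \<equiv> \<lambda>\<delta>. cfourier (\<lambda>x. inv_fourier F x * complex_of_real (gauss (\<delta> *\<^sub>R x)))"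
  shows "(\<lambda>j. \<integral>\<^sup>+\<xi>. ennreal ((cmod (F' (1 / Suc j) \<xi> - F \<xi>))\<^sup>2) \<partial>lborel) \<longlonglongrightarrow> 0"
proof -
  note [measurable] = gdecay_meas[OF F]
  note Fi = gdecay_integrable(1)[OF F]
  define k where "k = 1 / sqrt (2 * pi) ^ CARD('n)"
  have k0: "k > 0" by (simp add: k_def)
  obtain C where C: "C \<ge> 0" "\<And>\<xi>. cmod (F \<xi>) \<le> C * exp (- (1/8) * (norm \<xi>)\<^sup>2)"
    using gdecayD[OF F] by metis
  have F'_eq: "F' (1 / Suc j) \<xi> = complex_of_real k *
      (LINT y|lborel. F (\<xi> + (1 / Suc j) *\<^sub>R y) * complex_of_real (gauss y))" for j \<xi>
    unfolding F'_def k_def by (rule cfourier_regularized[OF F]) auto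
  have [measurable]: "(\<lambda>x. inv_fourier F x) \<in> borel_measurable borel"
    unfolding inv_fourier_eq_cfourier by measurable
  have [measurable]: "F' \<delta> \<in> borel_measurable borel" for \<delta>
    unfolding F'_def by measurable
  define w :: "real^'n \<Rightarrow> real" where "w = (\<lambda>y. exp (- (3/8) * (norm y)\<^sup>2))"
  have wi: "integrable lborel w" unfolding w_def by (rule integrable_exp_norm2) auto
  define W where "W = (LINT y|lborel. w y)"
  have W0: "W \<ge> 0" unfolding W_def w_def by (intro Bochner_Integration.integral_nonneg) auto
  \<comment> \<open>The rates come from \<open>(norm \<xi>)\<^sup>2 \<le> 2 * (norm (\<xi> +
    z))\<^sup>2 + 2 * (norm z)\<^sup>2\<close> with \<open>norm z \<le> norm y\<close>: the rate 1/8
    of \<open>F\<close> gives 1/16 in \<xi> and costs 1/8 of the rate 1/2 in \<open>y\<close>,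
    leaving 3/8.\<close>
  have bnd: "cmod (F (\<xi> + (1 / Suc j) *\<^sub>R y) * complex_of_real (gauss y)) \<le> C * exp (- (1/16) * (norm \<xi>)\<^sup>2) * w y" for \<xi> y j
  proof -
    define z where "z = (1 / real (Suc j)) *\<^sub>R y"
    have z: "(norm z)\<^sup>2 \<le> (norm y)\<^sup>2"
      unfolding z_def by (intro power_mono) (auto simp: field_simps mult_left_le)
    have "(norm \<xi>)\<^sup>2 \<le> (norm (\<xi> + z) + norm z)\<^sup>2"
      using norm_triangle_ineq4[of "\<xi> + z" z] by (intro power_mono) auto
    also have "\<dots> \<le> 2 * (norm (\<xi> + z))\<^sup>2 + 2 * (norm z)\<^sup>2"
      using sum_squares_bound[of "norm (\<xi> + z)" "norm z"] by (simp add: power2_sum)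
    finally have "- (1/8) * (norm (\<xi> + z))\<^sup>2 - (norm y)\<^sup>2 / 2 \<le> - (1/16) * (norm \<xi>)\<^sup>2 + (- (3/8) * (norm y)\<^sup>2)"
      using z by linarith
    then have "exp (- (1/8) * (norm (\<xi> + z))\<^sup>2) * gauss y \<le> exp (- (1/16) * (norm \<xi>)\<^sup>2) * w y"
      unfolding w_def gauss_def exp_add[symmetric] by simp
    then have "C * (exp (- (1/8) * (norm (\<xi> + z))\<^sup>2) * gauss y) \<le> C * (exp (- (1/16) * (norm \<xi>)\<^sup>2) * w y)"
      using C(1) by (rule mult_left_mono)
    moreover have "cmod (F (\<xi> + z) * complex_of_real (gauss y)) \<le> C * exp (- (1/8) * (norm (\<xi> + z))\<^sup>2) * gauss y"
      using C(2)[of "\<xi> + z"] by (auto simp: norm_mult gauss_pos less_imp_le intro!: mult_right_mono)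
    ultimately show ?thesis unfolding z_def by (simp add: mult.assoc)
  qed
  have F'_bound: "cmod (F' (1 / Suc j) \<xi>) \<le> k * C * W * exp (- (1/16) * (norm \<xi>)\<^sup>2)" for j \<xi>
  proof -
    have "cmod (LINT y|lborel. F (\<xi> + (1 / Suc j) *\<^sub>R y) * complex_of_real (gauss y))
        \<le> (LINT y|lborel. C * exp (- (1/16) * (norm \<xi>)\<^sup>2) * w y)"
    proof (rule Bochner_Integration.integral_norm_bound_integral)
      show w: "integrable lborel (\<lambda>y. C * exp (- (1/16) * (norm \<xi>)\<^sup>2) * w y)" using wi by simp
      show "integrable lborel (\<lambda>y. F (\<xi> + (1 / Suc j) *\<^sub>R y) * complex_of_real (gauss y))"
      proof (rule Bochner_Integration.integrable_bound[OF w])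
        show "AE y in lborel. norm (F (\<xi> + (1 / Suc j) *\<^sub>R y) * complex_of_real (gauss y))
            \<le> norm (C * exp (- (1/16) * (norm \<xi>)\<^sup>2) * w y)"
          using bnd by (intro AE_I2) (metis abs_ge_self order.trans real_norm_def)
      qed measurable
    qed (rule bnd)
    then show ?thesis unfolding F'_eq W_def using k0 by (simp add: norm_mult mult_ac mult_left_mono)
  qed
  have lim: "(\<lambda>j. F' (1 / Suc j) \<xi>) \<longlonglongrightarrow> F \<xi>" if "\<xi> \<noteq> 0" for \<xi>
  proof -
    have "(\<lambda>j. LINT y|lborel. F (\<xi> + (1 / Suc j) *\<^sub>R y) * complex_of_real (gauss y))
        \<longlonglongrightarrow> (LINT y|lborel. F \<xi> * complex_of_real (gauss (y::real^'n)))"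
    proof (rule integral_dominated_convergence)
      show "integrable lborel (\<lambda>y. C * exp (- (1/16) * (norm \<xi>)\<^sup>2) * w y)" using wi by simp
      show "AE y in lborel. cmod (F (\<xi> + (1 / Suc j) *\<^sub>R y) * complex_of_real (gauss y)) \<le> C * exp (- (1/16) * (norm \<xi>)\<^sup>2) * w y" for j
        using bnd by blast
      have "(\<lambda>j. F (\<xi> + (1 / real (Suc j)) *\<^sub>R y) * complex_of_real (gauss y)) \<longlonglongrightarrow> F \<xi> * complex_of_real (gauss y)" for y
      proof -
        have "(\<lambda>j. \<xi> + (1 / real (Suc j)) *\<^sub>R y) \<longlonglongrightarrow> \<xi> + 0 *\<^sub>R y"
          by (intro tendsto_intros inverse_Suc_tendsto_0)
        then show ?thesis
          using isCont_tendsto_compose[OF cont[OF that]] by (intro tendsto_intros) auto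
      qed
      then show "AE y in lborel. (\<lambda>j. F (\<xi> + (1 / real (Suc j)) *\<^sub>R y) * complex_of_real (gauss y)) \<longlonglongrightarrow> F \<xi> * complex_of_real (gauss y)"
        by blast
    qed measurable
    also have "(LINT y|lborel. F \<xi> * complex_of_real (gauss (y::real^'n))) = F \<xi> * complex_of_real (1 / k)"
      by (subst integral_mult_right_zero) (simp add: gauss_integral k_def)
    finally have "(\<lambda>j. complex_of_real k * (LINT y|lborel. F (\<xi> + (1 / Suc j) *\<^sub>R y) * complex_of_real (gauss y)))
       \<longlonglongrightarrow> complex_of_real k * (F \<xi> * complex_of_real (1 / k))"
      by (intro tendsto_intros)
    then show ?thesis unfolding F'_eq using k0 by simp
  qed
  define D where "D = k * C * W + C"
  have D0: "D \<ge> 0" unfolding D_def using k0 C W0 by auto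
  have F_bound: "cmod (F \<xi>) \<le> C * exp (- (1/16) * (norm \<xi>)\<^sup>2)" for \<xi>
    by (rule order.trans[OF C(2)]) (use C(1) in \<open>auto intro!: mult_left_mono\<close>)
  have dom: "(cmod (F' (1 / Suc j) \<xi> - F \<xi>))\<^sup>2 \<le> D\<^sup>2 * exp (- (1/8) * (norm \<xi>)\<^sup>2)" for j \<xi>
  proof -
    have "cmod (F' (1 / Suc j) \<xi> - F \<xi>) \<le> D * exp (- (1/16) * (norm \<xi>)\<^sup>2)"
      using norm_triangle_ineq4[of "F' (1 / Suc j) \<xi>" "F \<xi>"] F'_bound[of j \<xi>] F_bound[of \<xi>]
      unfolding D_def distrib_right by linarith
    then have "(cmod (F' (1 / Suc j) \<xi> - F \<xi>))\<^sup>2 \<le> (D * exp (- (1/16) * (norm \<xi>)\<^sup>2))\<^sup>2"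
      by (intro power_mono) auto
    then show ?thesis by (simp add: power_mult_distrib exp_double[symmetric])
  qed
  have "(\<lambda>j. \<integral>\<^sup>+\<xi>. ennreal ((cmod (F' (1 / Suc j) \<xi> - F \<xi>))\<^sup>2) \<partial>lborel) \<longlonglongrightarrow> (\<integral>\<^sup>+(\<xi>::real^'n). 0 \<partial>lborel)"
  proof (rule nn_integral_dominated_convergence[where w="\<lambda>\<xi>. ennreal (D\<^sup>2 * exp (- (1/8) * (norm \<xi>)\<^sup>2))"])
    have "integrable lborel (\<lambda>\<xi>::real^'n. D\<^sup>2 * exp (- (1/8) * (norm \<xi>)\<^sup>2))"
      by (intro integrable_mult_right integrable_exp_norm2) auto
    then show "(\<integral>\<^sup>+(\<xi>::real^'n). ennreal (D\<^sup>2 * exp (- (1/8) * (norm \<xi>)\<^sup>2)) \<partial>lborel) < \<infinity>"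
      by (subst nn_integral_eq_integral) auto
    show "AE \<xi> in lborel. ennreal ((cmod (F' (1 / Suc j) \<xi> - F \<xi>))\<^sup>2) \<le> ennreal (D\<^sup>2 * exp (- (1/8) * (norm \<xi>)\<^sup>2))" for j
      using dom by (auto intro!: ennreal_leI)
    show "AE \<xi> in lborel. (\<lambda>j. ennreal ((cmod (F' (1 / Suc j) \<xi> - F \<xi>))\<^sup>2)) \<longlonglongrightarrow> 0"
      using AE_lborel_singleton[of "0::real^'n"]
    proof eventually_elim
      fix \<xi> :: "real^'n" assume "\<xi> \<noteq> 0"
      then have "(\<lambda>j. ennreal ((cmod (F' (1 / Suc j) \<xi> - F \<xi>))\<^sup>2)) \<longlonglongrightarrow> ennreal ((cmod (F \<xi> - F \<xi>))\<^sup>2)"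
        by (intro tendsto_ennrealI tendsto_intros lim)
      then show "(\<lambda>j. ennreal ((cmod (F' (1 / Suc j) \<xi> - F \<xi>))\<^sup>2)) \<longlonglongrightarrow> 0" by simp
    qed
  qed measurable
  then show ?thesis by simp
qed

lemma nn_integral_square_add3:
  assumes [measurable]: "F \<in> borel_measurable M" "G \<in> borel_measurable M" "H \<in> borel_measurable M"
  shows "(\<integral>\<^sup>+\<xi>. ennreal ((cmod (F \<xi> + G \<xi> + H \<xi>))\<^sup>2) \<partial>M)
      \<le> 4 * ((\<integral>\<^sup>+\<xi>. ennreal ((cmod (F \<xi>))\<^sup>2) \<partial>M) + (\<integral>\<^sup>+\<xi>. ennreal ((cmod (G \<xi>))\<^sup>2) \<partial>M))
        + 2 * (\<integral>\<^sup>+\<xi>. ennreal ((cmod (H \<xi>))\<^sup>2) \<partial>M)"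
proof -
  have "(\<integral>\<^sup>+\<xi>. ennreal ((cmod (F \<xi> + G \<xi> + H \<xi>))\<^sup>2) \<partial>M)
      \<le> 2 * ((\<integral>\<^sup>+\<xi>. ennreal ((cmod (F \<xi> + G \<xi>))\<^sup>2) \<partial>M) + (\<integral>\<^sup>+\<xi>. ennreal ((cmod (H \<xi>))\<^sup>2) \<partial>M))"
    by (rule nn_integral_square_add) measurable
  also have "\<dots> \<le> 2 * (2 * ((\<integral>\<^sup>+\<xi>. ennreal ((cmod (F \<xi>))\<^sup>2) \<partial>M) + (\<integral>\<^sup>+\<xi>. ennreal ((cmod (G \<xi>))\<^sup>2) \<partial>M))
        + (\<integral>\<^sup>+\<xi>. ennreal ((cmod (H \<xi>))\<^sup>2) \<partial>M))"
    by (intro mult_left_mono add_right_mono nn_integral_square_add) auto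
  finally show ?thesis by (simp add: distrib_left mult.assoc[symmetric])
qed

lemma inv_fourier_meas [measurable]:
  assumes [measurable]: "F \<in> borel_measurable borel"
  shows "(\<lambda>x. inv_fourier F x) \<in> borel_measurable borel"
  unfolding inv_fourier_eq_cfourier by measurable

lemma inv_fourier_bound:
  "cmod (inv_fourier F (x :: real^'n)) \<le> (1 / (2 * pi) ^ CARD('n)) * (LINT \<xi>|lborel. cmod (F \<xi>))"
proof -
  have "cmod (complex_of_real (1 / (2 * pi) ^ CARD('n))) = 1 / (2 * pi) ^ CARD('n)"
    unfolding norm_of_real by simp
  then show ?thesis
    unfolding inv_fourier_eq_cfourier norm_mult by (auto intro!: divide_right_mono cfourier_bound)
qed

lemma inv_fourier_square_integrable:
  assumes F: "gdecay F"
  shows "(\<integral>\<^sup>+x. ennreal ((cmod (inv_fourier F x))\<^sup>2) \<partial>lborel) < \<infinity>"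
proof -
  note [measurable] = gdecay_meas[OF F]
  define c where "c = 1 / (2 * pi) ^ CARD('a)"
  have "c \<ge> 0" by (simp add: c_def)
  have "(\<integral>\<^sup>+x. ennreal ((cmod (inv_fourier F x))\<^sup>2) \<partial>lborel)
      = ennreal (c\<^sup>2) * (\<integral>\<^sup>+x. ennreal ((cmod (cfourier F (- x)))\<^sup>2) \<partial>lborel)"
    unfolding inv_fourier_eq_cfourier c_def[symmetric] norm_mult norm_of_real
    using \<open>c \<ge> 0\<close> by (subst nn_integral_cmult[symmetric]) (auto simp: ennreal_mult power_mult_distrib)
  also have "(\<integral>\<^sup>+x. ennreal ((cmod (cfourier F (- x)))\<^sup>2) \<partial>lborel) = (\<integral>\<^sup>+x. ennreal ((cmod (cfourier F x))\<^sup>2) \<partial>lborel)"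
    by (rule nn_integral_reflect[where f="\<lambda>x. ennreal ((cmod (cfourier F x))\<^sup>2)"]) measurable
  also have "ennreal (c\<^sup>2) * \<dots> \<le> ennreal (c\<^sup>2) * (ennreal ((2 * pi) ^ DIM(real^'a)) * (\<integral>\<^sup>+x. ennreal ((cmod (F x))\<^sup>2) \<partial>lborel))"
    by (intro mult_left_mono cfourier_bessel gdecay_integrable F) auto
  also have "\<dots> < \<infinity>"
  proof -
    have "(\<integral>\<^sup>+x. ennreal ((cmod (F x))\<^sup>2) \<partial>lborel) < \<infinity>"
      using gdecay_integrable(2)[OF F] by (subst nn_integral_eq_integral) auto
    then show ?thesis by (simp add: ennreal_mult_less_top)
  qed
  finally show ?thesis .
qed

lemma integrable_bounded_support:
  fixes f :: "'a::euclidean_space \<Rightarrow> complex"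
  assumes [measurable]: "f \<in> borel_measurable borel" and B: "\<And>x. cmod (f x) \<le> B"
  shows "integrable lborel (\<lambda>x. indicator (cball 0 R) x * f x)"
proof (rule Bochner_Integration.integrable_bound)
  have "emeasure lborel (cball (0::'a) R) < \<infinity>"
    by (rule emeasure_bounded_finite) auto
  then have "integrable lborel (indicator (cball (0::'a) R) :: _ \<Rightarrow> real)"
    by (intro integrable_real_indicator) auto
  then show "integrable lborel (\<lambda>x. indicator (cball (0::'a) R) x * B)" by simp
  show "AE x in lborel. norm (indicator (cball 0 R) x * f x) \<le> norm (indicator (cball (0::'a) R) x * B)"
    by (intro AE_I2) (auto simp: indicator_def intro: order.trans[OF B abs_ge_self])
qed measurable

text \<open>\<open>has_l2_fourier\<close> speaks of truncations of the inverse transform, which is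
  known to be bounded and square integrable but perhaps not integrable. The integrable functions
  \<open>\<phi>' j\<close>, its products with wide Gaussians, mediate: Bessel's inequality controls
  their distance to it and their tails, and the regularization lemma controls their transforms. The
  hypothesis \<open>herm\<close> makes the inverse transform real, so that \<open>Re\<close> loses
  nothing.\<close>

theorem has_l2_fourier_inverse:
  fixes F :: "real^'n \<Rightarrow> complex"
  assumes F: "gdecay F" and cont: "\<And>\<xi>. \<xi> \<noteq> 0 \<Longrightarrow> isCont F \<xi>"
    and herm: "\<And>\<xi>. F (- \<xi>) = cnj (F \<xi>)"
  shows "has_l2_fourier (\<lambda>x. Re (inv_fourier F x)) F"
proof -
  note [measurable] = gdecay_meas[OF F]
  define \<phi> where "\<phi> = (\<lambda>x. inv_fourier F x)"
  have [measurable]: "\<phi> \<in> borel_measurable borel" unfolding \<phi>_def by measurable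
  have "cnj (\<phi> x) = \<phi> x" for x
  proof -
    have "cnj (cfourier F (- x)) = cfourier (\<lambda>\<xi>. cnj (F (- \<xi>))) (- x)"
      by (rule cfourier_cnj_reflect[symmetric, OF gdecay_integrable(1)[OF F]])
    then show ?thesis unfolding \<phi>_def inv_fourier_eq_cfourier herm by simp
  qed
  then have Re: "complex_of_real (Re (inv_fourier F x)) = \<phi> x" for x
    unfolding \<phi>_def by (simp add: complex_eq_iff)
  have cmod_Re: "\<bar>Re (inv_fourier F x)\<bar> = cmod (\<phi> x)" for x
    unfolding Re[symmetric] norm_of_real ..
  have fin: "(\<integral>\<^sup>+x. ennreal ((cmod (\<phi> x))\<^sup>2) \<partial>lborel) < \<infinity>"
    unfolding \<phi>_def by (rule inv_fourier_square_integrable[OF F])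
  have sqi: "integrable lborel (\<lambda>x. (cmod (\<phi> x))\<^sup>2)"
    using fin by (intro integrableI_bounded) auto
  have sq: "square_integrable (\<lambda>x. Re (inv_fourier F x))" "square_integrable F"
    using sqi gdecay_integrable(2)[OF F] unfolding square_integrable_def real_norm_def cmod_Re by auto
  obtain B where B: "\<And>x. cmod (\<phi> x) \<le> B"
    using inv_fourier_bound[of F] unfolding \<phi>_def by blast
  define K where "K = ennreal ((2 * pi) ^ DIM(real^'n))"
  have K: "K < \<infinity>" unfolding K_def by simp
  define \<phi>' where "\<phi>' = (\<lambda>j x. \<phi> x * complex_of_real (gauss ((1 / real (Suc j)) *\<^sub>R x)))"
  have [measurable]: "\<phi>' j \<in> borel_measurable borel" for j unfolding \<phi>'_def by measurable
  have \<phi>'i: "integrable lborel (\<phi>' j)" for j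
    unfolding \<phi>'_def \<phi>_def by (rule cfourier_regularized(1)[OF F]) auto
  have g1: "\<bar>1 - gauss z\<bar> \<le> 1" for z :: "real^'n"
    using gauss_pos[of z] gauss_le_1[of z] by auto
  have diff_le: "cmod (\<phi> x - \<phi>' j x) \<le> cmod (\<phi> x)" for j x
  proof -
    have "\<phi> x - \<phi>' j x = \<phi> x * complex_of_real (1 - gauss ((1 / real (Suc j)) *\<^sub>R x))"
      by (simp add: \<phi>'_def right_diff_distrib)
    then show ?thesis using g1 by (simp add: norm_mult mult_left_le del: of_real_diff)
  qed
  have \<phi>'_le: "cmod (\<phi>' j x) \<le> cmod (\<phi> x)" for j x
    by (auto simp: \<phi>'_def norm_mult gauss_pos gauss_le_1 abs_of_pos intro!: mult_left_le)
  define e1 where "e1 = (\<lambda>j. \<integral>\<^sup>+x. ennreal ((cmod (\<phi> x - \<phi>' j x))\<^sup>2) \<partial>lborel)"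
  define e2 where "e2 = (\<lambda>j. \<integral>\<^sup>+\<xi>. ennreal ((cmod (cfourier (\<phi>' j) \<xi> - F \<xi>))\<^sup>2) \<partial>lborel)"
  define e3 where "e3 = (\<lambda>R. \<integral>\<^sup>+x. ennreal ((cmod (indicator (- cball 0 R) x * \<phi> x))\<^sup>2) \<partial>lborel)"
  have e1: "e1 \<longlonglongrightarrow> 0"
  proof -
    have "e1 \<longlonglongrightarrow> (\<integral>\<^sup>+(x::real^'n). 0 \<partial>lborel)"
      unfolding e1_def
    proof (rule nn_integral_dominated_convergence[where w="\<lambda>x. ennreal ((cmod (\<phi> x))\<^sup>2)"])
      show "AE x in lborel. ennreal ((cmod (\<phi> x - \<phi>' j x))\<^sup>2) \<le> ennreal ((cmod (\<phi> x))\<^sup>2)" for j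
        using diff_le by (intro AE_I2 ennreal_leI power_mono) auto
      have "(\<lambda>j. ennreal ((cmod (\<phi> x - \<phi> x * complex_of_real (exp (- (norm ((1 / real (Suc j)) *\<^sub>R x))\<^sup>2 / 2))))\<^sup>2)) \<longlonglongrightarrow>
         ennreal ((cmod (\<phi> x - \<phi> x * complex_of_real (exp (- (norm (0 *\<^sub>R x))\<^sup>2 / 2))))\<^sup>2)" for x
        by (intro tendsto_ennrealI tendsto_intros inverse_Suc_tendsto_0) auto
      then show "AE x in lborel. (\<lambda>j. ennreal ((cmod (\<phi> x - \<phi>' j x))\<^sup>2)) \<longlonglongrightarrow> 0"
        unfolding \<phi>'_def gauss_def by simp
    qed (use fin in auto)
    then show ?thesis by simp
  qed
  have e2: "e2 \<longlonglongrightarrow> 0"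
    unfolding e2_def \<phi>'_def \<phi>_def by (rule cfourier_regularized_tendsto[OF F cont])
  have e3: "(e3 \<longlongrightarrow> 0) at_top"
    unfolding e3_def by (rule square_integral_tail_tendsto[OF _ fin]) measurable
  let ?t = "\<lambda>R. fourier (\<lambda>x. indicator (cball 0 R) x * Re (inv_fourier F x))"
  define I where "I = (\<lambda>R x. indicator (cball (0::real^'n) R) x :: complex)"
  have [measurable]: "I R \<in> borel_measurable borel" for R unfolding I_def by measurable
  \<comment> \<open>The truncation equals the truncated difference, minus the tail of
    \<open>\<phi>' j\<close>, plus \<open>\<phi>' j\<close>. Each of the three is integrable, so the
    transform may be split.\<close>
  have split: "?t R \<xi> = cfourier (\<lambda>x. I R x * (\<phi> x - \<phi>' j x)) \<xi>
      + (- cfourier (\<lambda>x. indicator (- cball 0 R) x * \<phi>' j x) \<xi>) + cfourier (\<phi>' j) \<xi>" for R \<xi> j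
  proof -
    have i1: "integrable lborel (\<lambda>x. I R x * (\<phi> x - \<phi>' j x))"
      unfolding I_def using diff_le[of _ j] B by (intro integrable_bounded_support) (auto intro: order.trans)
    have i2: "integrable lborel (\<lambda>x. indicator (- cball 0 R) x * \<phi>' j x)"
      by (rule Bochner_Integration.integrable_bound[OF \<phi>'i[of j]]) (auto simp: indicator_def)
    have "?t R \<xi> = cfourier (\<lambda>x. (I R x * (\<phi> x - \<phi>' j x) - indicator (- cball 0 R) x * \<phi>' j x) + \<phi>' j x) \<xi>"
      unfolding fourier_eq_cfourier of_real_mult Re
      by (intro arg_cong2[where f=cfourier] ext refl) (auto simp: I_def indicator_def)
    also have "\<dots> = cfourier (\<lambda>x. I R x * (\<phi> x - \<phi>' j x) - indicator (- cball 0 R) x * \<phi>' j x) \<xi> + cfourier (\<phi>' j) \<xi>"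
      by (intro cfourier_add \<phi>'i Bochner_Integration.integrable_diff i1 i2)
    also have "cfourier (\<lambda>x. I R x * (\<phi> x - \<phi>' j x) - indicator (- cball 0 R) x * \<phi>' j x) \<xi>
       = cfourier (\<lambda>x. I R x * (\<phi> x - \<phi>' j x)) \<xi> - cfourier (\<lambda>x. indicator (- cball 0 R) x * \<phi>' j x) \<xi>"
      by (intro cfourier_diff i1 i2)
    finally show ?thesis by simp
  qed
  have bd: "(\<integral>\<^sup>+\<xi>. ennreal ((cmod (?t R \<xi> - F \<xi>))\<^sup>2) \<partial>lborel) \<le> 4 * (K * e1 j + K * e3 R) + 2 * e2 j" for R j
  proof -
    have i1: "integrable lborel (\<lambda>x. I R x * (\<phi> x - \<phi>' j x))"
      unfolding I_def using diff_le[of _ j] B by (intro integrable_bounded_support) (auto intro: order.trans)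
    have i2: "integrable lborel (\<lambda>x. indicator (- cball 0 R) x * \<phi>' j x)"
      by (rule Bochner_Integration.integrable_bound[OF \<phi>'i[of j]]) (auto simp: indicator_def)
    have "(\<integral>\<^sup>+\<xi>. ennreal ((cmod (?t R \<xi> - F \<xi>))\<^sup>2) \<partial>lborel)
      = (\<integral>\<^sup>+\<xi>. ennreal ((cmod (cfourier (\<lambda>x. I R x * (\<phi> x - \<phi>' j x)) \<xi>
        + (- cfourier (\<lambda>x. indicator (- cball 0 R) x * \<phi>' j x) \<xi>) + (cfourier (\<phi>' j) \<xi> - F \<xi>)))\<^sup>2) \<partial>lborel)"
      unfolding split[of _ _ j] by (simp add: algebra_simps)
    also have "\<dots> \<le> 4 * ((\<integral>\<^sup>+\<xi>. ennreal ((cmod (cfourier (\<lambda>x. I R x * (\<phi> x - \<phi>' j x)) \<xi>))\<^sup>2) \<partial>lborel)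
        + (\<integral>\<^sup>+\<xi>. ennreal ((cmod (- cfourier (\<lambda>x. indicator (- cball 0 R) x * \<phi>' j x) \<xi>))\<^sup>2) \<partial>lborel)) + 2 * e2 j"
      unfolding e2_def by (rule nn_integral_square_add3) measurable
    also have "\<dots> \<le> 4 * (K * e1 j + K * e3 R) + 2 * e2 j"
    proof (intro add_right_mono mult_left_mono add_mono)
      have "(\<integral>\<^sup>+\<xi>. ennreal ((cmod (cfourier (\<lambda>x. I R x * (\<phi> x - \<phi>' j x)) \<xi>))\<^sup>2) \<partial>lborel)
          \<le> K * (\<integral>\<^sup>+x. ennreal ((cmod (I R x * (\<phi> x - \<phi>' j x)))\<^sup>2) \<partial>lborel)"
        unfolding K_def by (rule cfourier_bessel[OF i1])
      also have "\<dots> \<le> K * e1 j"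
        unfolding e1_def by (intro mult_left_mono nn_integral_mono ennreal_leI power_mono) (auto simp: I_def indicator_def)
      finally show "(\<integral>\<^sup>+\<xi>. ennreal ((cmod (cfourier (\<lambda>x. I R x * (\<phi> x - \<phi>' j x)) \<xi>))\<^sup>2) \<partial>lborel) \<le> K * e1 j" .
      have "(\<integral>\<^sup>+\<xi>. ennreal ((cmod (- cfourier (\<lambda>x. indicator (- cball 0 R) x * \<phi>' j x) \<xi>))\<^sup>2) \<partial>lborel)
          \<le> K * (\<integral>\<^sup>+x. ennreal ((cmod (indicator (- cball 0 R) x * \<phi>' j x))\<^sup>2) \<partial>lborel)"
        unfolding K_def norm_minus_cancel by (rule cfourier_bessel[OF i2])
      also have "\<dots> \<le> K * e3 R"
        unfolding e3_def by (intro mult_left_mono nn_integral_mono ennreal_leI power_mono) (auto simp: indicator_def \<phi>'_le)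
      finally show "(\<integral>\<^sup>+\<xi>. ennreal ((cmod (- cfourier (\<lambda>x. indicator (- cball 0 R) x * \<phi>' j x) \<xi>))\<^sup>2) \<partial>lborel) \<le> K * e3 R" .
    qed auto
    finally show ?thesis .
  qed
  \<comment> \<open>The left side does not involve \<open>j\<close>, so \<open>j\<close> goes to
    infinity at fixed radius and only the tail of the inverse transform survives.\<close>
  have bd': "(\<integral>\<^sup>+\<xi>. ennreal ((cmod (?t R \<xi> - F \<xi>))\<^sup>2) \<partial>lborel) \<le> 4 * (K * e3 R)" for R
  proof -
    have "(\<lambda>j. 4 * (K * e1 j + K * e3 R) + 2 * e2 j) \<longlonglongrightarrow> 4 * (K * 0 + K * e3 R) + 2 * 0"
      using K by (intro tendsto_add ennreal_tendsto_cmult e1 e2 tendsto_const) auto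
    then show ?thesis using bd by (intro tendsto_lowerbound[of _ _ sequentially]) auto
  qed
  have "((\<lambda>R. 4 * (K * e3 R)) \<longlongrightarrow> 4 * (K * 0)) at_top"
    using K by (intro ennreal_tendsto_cmult e3) auto
  then have "((\<lambda>R. \<integral>\<^sup>+\<xi>. ennreal ((cmod (?t R \<xi> - F \<xi>))\<^sup>2) \<partial>lborel) \<longlongrightarrow> 0) at_top"
    by (rule tendsto_zero_ennreal_le) (use bd' in auto)
  then show ?thesis unfolding has_l2_fourier_def using sq by blast
qed

section \<open>Derivatives of inverse transforms\<close>

lemma cmod_cis_minus_1: "cmod (cis a - 1) \<le> \<bar>a\<bar>"
proof -
  have "(cmod (cis a - 1))\<^sup>2 = (cos a - 1)\<^sup>2 + (sin a)\<^sup>2" by (simp add: cmod_power2)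
  also have "\<dots> = 2 - 2 * cos a" using sin_cos_squared_add[of a] by (simp add: power2_eq_square algebra_simps)
  also have "\<dots> = (2 * sin (a / 2))\<^sup>2" using cos_double_sin[of "a / 2"] by (simp add: power_mult_distrib)
  also have "\<dots> \<le> \<bar>a\<bar>\<^sup>2"
    using abs_sin_x_le_abs_x[of "a / 2"] by (intro power2_le_iff_abs_le[THEN iffD2]) (auto simp: abs_mult)
  finally show ?thesis by (rule power2_le_imp_le) auto
qed

lemma cis_difference_quotient:
  assumes "X \<longlonglongrightarrow> 0" "\<And>k. X k \<noteq> 0"
  shows "(\<lambda>k. (cis (X k * b) - 1) / complex_of_real (X k)) \<longlonglongrightarrow> \<i> * complex_of_real b"
proof -
  have "((\<lambda>z. exp (\<i> * complex_of_real b * z)) has_field_derivative \<i> * complex_of_real b) (at 0)"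
    by (auto intro!: derivative_eq_intros)
  then have "((\<lambda>z. (exp (\<i> * complex_of_real b * z) - 1) / z) \<longlongrightarrow> \<i> * complex_of_real b) (at 0)"
    by (simp add: DERIV_def)
  moreover have "filterlim (\<lambda>k. complex_of_real (X k)) (at 0) sequentially"
    using assms tendsto_of_real[OF assms(1), where 'a=complex] by (auto simp: filterlim_at)
  ultimately have "(\<lambda>k. (exp (\<i> * complex_of_real b * complex_of_real (X k)) - 1) / complex_of_real (X k)) \<longlonglongrightarrow> \<i> * complex_of_real b"
    by (rule filterlim_compose)
  then show ?thesis by (simp add: cis_conv_exp mult_ac)
qed

text \<open>Differentiation under the integral: the difference quotients of the character are
  bounded by the coordinate of \<xi>, and its product with \<open>F\<close> is integrable because
  \<open>gdecay\<close> is stable under \<open>gdecay_coord\<close>.\<close>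

theorem partial_deriv_inv_fourier:
  fixes F :: "real^'n \<Rightarrow> complex"
  assumes F: "gdecay F"
  shows "partial_deriv i (\<lambda>x. Re (inv_fourier F x)) = (\<lambda>x. Re (inv_fourier (\<lambda>\<xi>. \<i> * complex_of_real (\<xi> $ i) * F \<xi>) x))"
proof
  fix x :: "real^'n"
  note [measurable] = gdecay_meas[OF F]
  define c where "c = complex_of_real (1 / (2 * pi) ^ CARD('n))"
  let ?D = "inv_fourier (\<lambda>\<xi>. \<i> * complex_of_real (\<xi> $ i) * F \<xi>) x"
  have D: "?D = c * (LINT \<xi>|lborel. cis (x \<bullet> \<xi>) * (\<i> * complex_of_real (\<xi> $ i)) * F \<xi>)"
    unfolding inv_fourier_def c_def by (simp only: mult.assoc)
  have int: "integrable lborel (\<lambda>\<xi>. cis (y \<bullet> \<xi>) * F \<xi>)" for y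
    by (intro integrable_cis_mult gdecay_integrable(1)[OF F]) measurable
  have "integrable lborel (\<lambda>\<xi>. cmod (\<i> * complex_of_real (\<xi> $ i) * F \<xi>))"
    by (intro integrable_norm gdecay_integrable(1) gdecay_coord F)
  then have w: "integrable lborel (\<lambda>\<xi>. \<bar>\<xi> $ i\<bar> * cmod (F \<xi>))" by (simp add: norm_mult)
  \<comment> \<open>The terms with 0 keep the literal shape of \<open>DERIV_def\<close> at 0.
    Passing to sequences makes the dominated convergence theorem applicable.\<close>
  have "((\<lambda>h. (Re (inv_fourier F (x + (0 + h) *\<^sub>R axis i 1)) - Re (inv_fourier F (x + 0 *\<^sub>R axis i 1))) / h) \<longlongrightarrow> Re ?D) (at 0)"
    unfolding tendsto_at_iff_sequentially comp_def
  proof (intro allI impI)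
    fix X :: "nat \<Rightarrow> real" assume X: "\<forall>k. X k \<in> UNIV - {0}" "X \<longlonglongrightarrow> 0"
    have eq: "(Re (inv_fourier F (x + (0 + X k) *\<^sub>R axis i 1)) - Re (inv_fourier F (x + 0 *\<^sub>R axis i 1))) / X k
       = Re (c * (LINT \<xi>|lborel. cis (x \<bullet> \<xi>) * ((cis (X k * \<xi> $ i) - 1) / complex_of_real (X k)) * F \<xi>))" for k
    proof -
      have "(LINT \<xi>|lborel. cis (x \<bullet> \<xi>) * ((cis (X k * \<xi> $ i) - 1) / complex_of_real (X k)) * F \<xi>)
        = (LINT \<xi>|lborel. (cis ((x + X k *\<^sub>R axis i 1) \<bullet> \<xi>) * F \<xi> - cis (x \<bullet> \<xi>) * F \<xi>) / complex_of_real (X k))"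
        by (intro Bochner_Integration.integral_cong refl)
          (simp add: inner_add_left inner_axis' cis_mult[symmetric] field_simps diff_divide_distrib)
      also have "\<dots> = ((LINT \<xi>|lborel. cis ((x + X k *\<^sub>R axis i 1) \<bullet> \<xi>) * F \<xi>) - (LINT \<xi>|lborel. cis (x \<bullet> \<xi>) * F \<xi>)) / complex_of_real (X k)"
        using int by (simp add: Bochner_Integration.integral_diff)
      finally have eq1: "(LINT \<xi>|lborel. cis (x \<bullet> \<xi>) * ((cis (X k * \<xi> $ i) - 1) / complex_of_real (X k)) * F \<xi>) = \<dots>" .
      have "c * (LINT \<xi>|lborel. cis (x \<bullet> \<xi>) * ((cis (X k * \<xi> $ i) - 1) / complex_of_real (X k)) * F \<xi>)
          = (inv_fourier F (x + X k *\<^sub>R axis i 1) - inv_fourier F x) / complex_of_real (X k)"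
        unfolding inv_fourier_def c_def[symmetric] eq1 by (simp add: right_diff_distrib)
      from arg_cong[OF this, of Re] show ?thesis by (simp only: Re_divide_of_real minus_complex.sel add_0 scaleR_zero_left add_0_right)
    qed
    have "(\<lambda>k. LINT \<xi>|lborel. cis (x \<bullet> \<xi>) * ((cis (X k * \<xi> $ i) - 1) / complex_of_real (X k)) * F \<xi>)
        \<longlonglongrightarrow> (LINT \<xi>|lborel. cis (x \<bullet> \<xi>) * (\<i> * complex_of_real (\<xi> $ i)) * F \<xi>)"
    proof (rule integral_dominated_convergence[OF _ _ w])
      show "AE \<xi> in lborel. (\<lambda>k. cis (x \<bullet> \<xi>) * ((cis (X k * \<xi> $ i) - 1) / complex_of_real (X k)) * F \<xi>)
          \<longlonglongrightarrow> cis (x \<bullet> \<xi>) * (\<i> * complex_of_real (\<xi> $ i)) * F \<xi>"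
        using X by (intro AE_I2 tendsto_intros cis_difference_quotient) auto
      show "AE \<xi> in lborel. norm (cis (x \<bullet> \<xi>) * ((cis (X k * \<xi> $ i) - 1) / complex_of_real (X k)) * F \<xi>) \<le> \<bar>\<xi> $ i\<bar> * cmod (F \<xi>)" for k
      proof (intro AE_I2)
        fix \<xi> :: "real^'n"
        have "cmod (cis (X k * \<xi> $ i) - 1) / \<bar>X k\<bar> \<le> \<bar>\<xi> $ i\<bar>"
          using cmod_cis_minus_1[of "X k * \<xi> $ i"] X(1) by (auto simp: divide_le_eq abs_mult mult.commute)
        then show "norm (cis (x \<bullet> \<xi>) * ((cis (X k * \<xi> $ i) - 1) / complex_of_real (X k)) * F \<xi>) \<le> \<bar>\<xi> $ i\<bar> * cmod (F \<xi>)"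
          unfolding norm_mult norm_cis norm_divide norm_of_real by (intro mult_right_mono) auto
      qed
    qed measurable
    then have "(\<lambda>k. Re (c * (LINT \<xi>|lborel. cis (x \<bullet> \<xi>) * ((cis (X k * \<xi> $ i) - 1) / complex_of_real (X k)) * F \<xi>)))
        \<longlonglongrightarrow> Re (c * (LINT \<xi>|lborel. cis (x \<bullet> \<xi>) * (\<i> * complex_of_real (\<xi> $ i)) * F \<xi>))"
      by (intro tendsto_intros)
    then show "(\<lambda>k. (Re (inv_fourier F (x + (0 + X k) *\<^sub>R axis i 1)) - Re (inv_fourier F (x + 0 *\<^sub>R axis i 1))) / X k) \<longlonglongrightarrow> Re ?D"
      unfolding eq D .
  qed
  then have "DERIV (\<lambda>h. Re (inv_fourier F (x + h *\<^sub>R axis i 1))) 0 :> Re ?D"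
    by (simp add: DERIV_def)
  then show "partial_deriv i (\<lambda>x. Re (inv_fourier F x)) x = Re ?D"
    unfolding partial_deriv_def by (rule DERIV_imp_deriv)
qed

section \<open>Characteristic roots and kernels\<close>

definition sym0 :: "real \<Rightarrow> real \<Rightarrow> real \<Rightarrow> real" where
  "sym0 \<mu> t r = cos (r * t + 1/2 * r ^ 3 * t) * exp (- \<mu> * r ^ 4 * t)"

text \<open>At \<open>r = 0\<close> division by zero yields 0, whereas the limit is
  \<open>t\<close>: this is the discontinuity at the origin that the inversion theorem has to
  admit.\<close>

definition sym1 :: "real \<Rightarrow> real \<Rightarrow> real \<Rightarrow> real" where
  "sym1 \<mu> t r = 1 / r * sin (r * t + 1/2 * r ^ 3 * t) * exp (- \<mu> * r ^ 4 * t)"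

text \<open>The discriminant of the characteristic polynomial; its sign separates the oscillating,
  the double-root and the overdamped regime.\<close>

definition disc :: "real \<Rightarrow> real \<Rightarrow> real" where
  "disc \<mu> r = \<mu>\<^sup>2 * r ^ 8 - r\<^sup>2 - r ^ 4"

lemma csqrt_real_neg: "d < 0 \<Longrightarrow> csqrt (complex_of_real d) = \<i> * complex_of_real (sqrt (- d))"
  by simp

lemma csqrt_real_pos: "0 \<le> d \<Longrightarrow> csqrt (complex_of_real d) = complex_of_real (sqrt d)"
  by simp

lemma kernels_oscillating:
  fixes \<xi> :: "real^'n"
  assumes d: "disc \<mu> (norm \<xi>) < 0"
  defines "r \<equiv> norm \<xi>" and "\<omega> \<equiv> sqrt (- disc \<mu> (norm \<xi>))"
  shows "K1_hat \<mu> t \<xi> = complex_of_real (sin (\<omega> * t) / \<omega> * exp (- \<mu> * r ^ 4 * t))"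
    and "K0_hat \<mu> t \<xi> = complex_of_real ((cos (\<omega> * t) + \<mu> * r ^ 4 * (sin (\<omega> * t) / \<omega>)) * exp (- \<mu> * r ^ 4 * t))"
proof -
  have w: "\<omega> > 0" using d by (simp add: \<omega>_def)
  define a where "a = - complex_of_real (\<mu> * r ^ 4) + \<i> * complex_of_real \<omega>"
  define b where "b = - complex_of_real (\<mu> * r ^ 4) - \<i> * complex_of_real \<omega>"
  have ab: "lam_plus \<mu> (norm \<xi>) = a" "lam_minus \<mu> (norm \<xi>) = b"
    using csqrt_real_neg[OF d] unfolding lam_plus_def lam_minus_def a_def b_def r_def \<omega>_def disc_def by simp_all
  define E where "E = complex_of_real (exp (- \<mu> * r ^ 4 * t))"
  have ne: "a \<noteq> b" "a - b = 2 * \<i> * complex_of_real \<omega>" using w by (auto simp: a_def b_def)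
  have ea: "exp (a * of_real t) = E * (of_real (cos (\<omega> * t)) + \<i> * of_real (sin (\<omega> * t)))"
  proof -
    have "a * of_real t = of_real (- \<mu> * r ^ 4 * t) + \<i> * of_real (\<omega> * t)" by (simp add: a_def algebra_simps)
    then show ?thesis unfolding E_def exp_of_real[symmetric]
      by (simp only: exp_add cis_conv_exp[symmetric]) (simp add: cis.ctr complex_eq_iff)
  qed
  have eb: "exp (b * of_real t) = E * (of_real (cos (\<omega> * t)) - \<i> * of_real (sin (\<omega> * t)))"
  proof -
    have "b * of_real t = of_real (- \<mu> * r ^ 4 * t) + \<i> * of_real (- (\<omega> * t))" by (simp add: b_def algebra_simps)
    then show ?thesis unfolding E_def exp_of_real[symmetric]
      by (simp only: exp_add cis_conv_exp[symmetric]) (simp add: cis.ctr complex_eq_iff)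
  qed
  have "K1_hat \<mu> t \<xi> = (exp (a * of_real t) - exp (b * of_real t)) / (a - b)"
    using ne unfolding K1_hat_def ab Let_def by simp
  also have "\<dots> = E * (of_real (sin (\<omega> * t)) / of_real \<omega>)"
    unfolding ea eb ne(2) using w by (simp add: field_simps)
  finally show "K1_hat \<mu> t \<xi> = complex_of_real (sin (\<omega> * t) / \<omega> * exp (- \<mu> * r ^ 4 * t))"
    unfolding E_def by (simp add: mult_ac)
  have "K0_hat \<mu> t \<xi> = (a * exp (b * of_real t) - b * exp (a * of_real t)) / (a - b)"
    using ne unfolding K0_hat_def ab Let_def by simp
  also have "\<dots> = E * (of_real (cos (\<omega> * t)) + of_real (\<mu> * r ^ 4) * (of_real (sin (\<omega> * t)) / of_real \<omega>))"
    unfolding ea eb ne(2) unfolding a_def b_def using w by (simp add: field_simps)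
  finally show "K0_hat \<mu> t \<xi> = complex_of_real ((cos (\<omega> * t) + \<mu> * r ^ 4 * (sin (\<omega> * t) / \<omega>)) * exp (- \<mu> * r ^ 4 * t))"
    unfolding E_def by (simp add: mult_ac)
qed

lemma kernels_double_root:
  fixes \<xi> :: "real^'n"
  assumes d: "disc \<mu> (norm \<xi>) = 0"
  defines "r \<equiv> norm \<xi>"
  shows "K1_hat \<mu> t \<xi> = complex_of_real (t * exp (- \<mu> * r ^ 4 * t))"
    and "K0_hat \<mu> t \<xi> = complex_of_real ((1 + \<mu> * r ^ 4 * t) * exp (- \<mu> * r ^ 4 * t))"
proof -
  have ab: "lam_plus \<mu> (norm \<xi>) = complex_of_real (- \<mu> * r ^ 4)" "lam_minus \<mu> (norm \<xi>) = complex_of_real (- \<mu> * r ^ 4)"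
    using d unfolding lam_plus_def lam_minus_def r_def disc_def by simp_all
  show "K1_hat \<mu> t \<xi> = complex_of_real (t * exp (- \<mu> * r ^ 4 * t))"
    unfolding K1_hat_def ab Let_def by (simp add: exp_of_real[symmetric])
  show "K0_hat \<mu> t \<xi> = complex_of_real ((1 + \<mu> * r ^ 4 * t) * exp (- \<mu> * r ^ 4 * t))"
    unfolding K0_hat_def ab Let_def by (simp add: exp_of_real[symmetric])
qed

text \<open>Factoring out the slow exponential leaves
  \<open>(1 - exp (- (2 * \<sigma> * t))) / (2 * \<sigma>)\<close>, which is at most
  \<open>t\<close> and at most \<open>1 / \<sigma>\<close>. The first bound survives merging roots,
  the second gives decay in frequency. Writing \<open>K0_hat\<close> through \<kappa> avoids a
  quotient with small denominator.\<close>

lemma kernels_overdamped: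
  fixes \<xi> :: "real^'n" and t :: real
  assumes d: "disc \<mu> (norm \<xi>) > 0"
  defines "r \<equiv> norm \<xi>" and "\<sigma> \<equiv> sqrt (disc \<mu> (norm \<xi>))"
  defines "\<alpha> \<equiv> - \<mu> * r ^ 4 + \<sigma>"
  defines "\<kappa> \<equiv> exp (\<alpha> * t) * ((1 - exp (- (2 * \<sigma> * t))) / (2 * \<sigma>))"
  shows "K1_hat \<mu> t \<xi> = complex_of_real \<kappa>"
    and "K0_hat \<mu> t \<xi> = complex_of_real (exp (\<alpha> * t) - \<alpha> * \<kappa>)"
proof -
  have w: "\<sigma> > 0" using d by (simp add: \<sigma>_def)
  define \<beta> where "\<beta> = - \<mu> * r ^ 4 - \<sigma>"
  have ab: "lam_plus \<mu> (norm \<xi>) = complex_of_real \<alpha>" "lam_minus \<mu> (norm \<xi>) = complex_of_real \<beta>"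
    using csqrt_real_pos[OF less_imp_le[OF d]]
    unfolding lam_plus_def lam_minus_def \<alpha>_def \<beta>_def r_def \<sigma>_def disc_def by simp_all
  have k: "\<kappa> = (exp (\<alpha> * t) - exp (\<beta> * t)) / (\<alpha> - \<beta>)"
  proof -
    have "\<beta> * t = \<alpha> * t + - (2 * \<sigma> * t)" by (simp add: \<alpha>_def \<beta>_def algebra_simps)
    then show ?thesis unfolding \<kappa>_def by (simp only: exp_add) (simp add: \<alpha>_def \<beta>_def algebra_simps)
  qed
  have ne: "\<alpha> \<noteq> \<beta>" using w by (simp add: \<alpha>_def \<beta>_def)
  show "K1_hat \<mu> t \<xi> = complex_of_real \<kappa>"
    unfolding K1_hat_def ab Let_def k using ne by (simp add: exp_of_real[symmetric])
  have "exp (\<alpha> * t) - \<alpha> * \<kappa> = (\<alpha> * exp (\<beta> * t) - \<beta> * exp (\<alpha> * t)) / (\<alpha> - \<beta>)"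
    unfolding k using ne by (simp add: field_simps)
  then show "K0_hat \<mu> t \<xi> = complex_of_real (exp (\<alpha> * t) - \<alpha> * \<kappa>)"
    unfolding K0_hat_def ab Let_def using ne by (simp add: exp_of_real[symmetric])
qed

lemma abs_sin_scaled_le: "\<omega> > 0 \<Longrightarrow> 0 \<le> t \<Longrightarrow> \<bar>sin (\<omega> * t) / \<omega>\<bar> \<le> (t::real)"
  using abs_sin_x_le_abs_x[of "\<omega> * t"] by (simp add: abs_divide divide_le_eq mult.commute abs_mult)

text \<open>The bound \<open>\<bar>sin (\<omega> * t) / \<omega>\<bar> \<le> t\<close> is uniform as
  \<omega> tends to 0 and agrees with the limit at a double root, so both cases share one
  estimate.\<close>

lemma kernels_nonpositive_disc:
  fixes \<xi> :: "real^'n"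
  assumes d: "disc \<mu> (norm \<xi>) \<le> 0" and "0 < \<mu>" "0 \<le> t"
  defines "r \<equiv> norm \<xi>"
  shows "cmod (K1_hat \<mu> t \<xi>) \<le> t * exp (- \<mu> * r ^ 4 * t)"
    and "cmod (K0_hat \<mu> t \<xi>) \<le> (1 + \<mu> * r ^ 4 * t) * exp (- \<mu> * r ^ 4 * t)"
proof -
  have "cmod (K1_hat \<mu> t \<xi>) \<le> t * exp (- \<mu> * r ^ 4 * t)
    \<and> cmod (K0_hat \<mu> t \<xi>) \<le> (1 + \<mu> * r ^ 4 * t) * exp (- \<mu> * r ^ 4 * t)"
  proof (cases "disc \<mu> (norm \<xi>) = 0")
    case True
    show ?thesis unfolding kernels_double_root[OF True] norm_of_real r_def using assms by (simp add: abs_mult)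
  next
    case False
    then have d: "disc \<mu> (norm \<xi>) < 0" using d by simp
    define \<omega> where "\<omega> = sqrt (- disc \<mu> (norm \<xi>))"
    have w: "\<omega> > 0" using d by (simp add: \<omega>_def)
    have s: "\<bar>sin (\<omega> * t) / \<omega>\<bar> \<le> t" by (rule abs_sin_scaled_le) (use w assms in auto)
    have mr: "0 \<le> \<mu> * r ^ 4" using assms by (simp add: r_def)
    have "\<bar>cos (\<omega> * t) + \<mu> * r ^ 4 * (sin (\<omega> * t) / \<omega>)\<bar> \<le> \<bar>cos (\<omega> * t)\<bar> + \<mu> * r ^ 4 * \<bar>sin (\<omega> * t) / \<omega>\<bar>"
      using abs_triangle_ineq[of "cos (\<omega> * t)" "\<mu> * r ^ 4 * (sin (\<omega> * t) / \<omega>)"]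
      by (simp only: abs_mult[of "\<mu> * r ^ 4"] abs_of_nonneg[OF mr])
    also have "\<dots> \<le> 1 + \<mu> * r ^ 4 * t" using s mr by (intro add_mono mult_left_mono) auto
    finally have "\<bar>cos (\<omega> * t) + \<mu> * r ^ 4 * (sin (\<omega> * t) / \<omega>)\<bar> \<le> 1 + \<mu> * r ^ 4 * t" .
    then show ?thesis
      unfolding kernels_oscillating[OF d] norm_of_real unfolding \<omega>_def[symmetric] unfolding r_def[symmetric]
      using mult_right_mono[OF s, of "exp (- \<mu> * r ^ 4 * t)"] by (simp add: abs_mult mult_right_mono)
  qed
  then show "cmod (K1_hat \<mu> t \<xi>) \<le> t * exp (- \<mu> * r ^ 4 * t)"
    "cmod (K0_hat \<mu> t \<xi>) \<le> (1 + \<mu> * r ^ 4 * t) * exp (- \<mu> * r ^ 4 * t)" by auto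
qed

text \<open>The rate \<open>k\<close> combines two regimes: oscillating roots have real part
  \<open>- \<mu> * r ^ 4\<close>, at most \<open>- \<mu>\<close>, and the slow overdamped root stays
  below \<open>- 1 / (2 * \<mu>)\<close> however large \<open>r\<close> is. The factor
  \<open>1 / norm \<xi>\<close> gained by \<open>K1_hat\<close> is the reason why \<open>v1\<close>
  enters the upper bound with one derivative less.\<close>

lemma kernels_high_frequency:
  fixes \<xi> :: "real^'n"
  assumes \<mu>: "0 < \<mu>" and t: "0 \<le> t" and r1: "1 \<le> norm \<xi>"
  defines "C \<equiv> 1 + 2 / \<mu> + 3 / \<mu>\<^sup>2" and "k \<equiv> min \<mu> (1 / (2 * \<mu>))"
  shows "cmod (K0_hat \<mu> t \<xi>) \<le> C * (1 + t) * exp (- k * t)"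
    and "cmod (K1_hat \<mu> t \<xi>) \<le> C * (1 + t) * exp (- k * t) / norm \<xi>"
proof -
  define r where "r = norm \<xi>"
  have r: "r \<ge> 1" using r1 by (simp add: r_def)
  have r2: "r\<^sup>2 \<le> r ^ 4" "r \<le> r ^ 4" "1 \<le> r ^ 4" "1 \<le> r\<^sup>2"
    using r power_increasing[of 2 4 r] power_increasing[of 1 4 r] power_increasing[of 0 4 r] power_increasing[of 0 2 r] by auto
  have r8: "r ^ 8 = r ^ 4 * r ^ 4" by (simp add: power_add[symmetric])
  have C: "1 \<le> C" "2 / \<mu> \<le> C" "3 / \<mu>\<^sup>2 \<le> C" using \<mu> by (auto simp: C_def)
  have fin: "cmod (K0_hat \<mu> t \<xi>) \<le> C * (1 + t) * exp (- k * t) \<and> r * cmod (K1_hat \<mu> t \<xi>) \<le> C * (1 + t) * exp (- k * t)"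
  proof (cases "disc \<mu> (norm \<xi>) \<le> 0")
    case True
    \<comment> \<open>For \<open>r \<ge> 1\<close> a nonpositive discriminant confines the frequency
      to \<open>\<mu>\<^sup>2 * r ^ 4 \<le> 2\<close>, so every power of \<open>r\<close> up to the
      fourth can be absorbed into \<open>C\<close>.\<close>
    have "\<mu>\<^sup>2 * r ^ 4 * r ^ 4 \<le> 2 * r ^ 4"
      using True r2 unfolding disc_def r_def[symmetric] r8 by (simp add: mult.assoc)
    then have "\<mu>\<^sup>2 * r ^ 4 \<le> 2" using r2 r by (simp add: mult_le_cancel_right)
    then have r4: "r ^ 4 \<le> 2 / \<mu>\<^sup>2" using \<mu> by (simp add: field_simps)
    have e: "exp (- \<mu> * r ^ 4 * t) \<le> exp (- k * t)"
    proof -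
      have "k * t \<le> \<mu> * r ^ 4 * t"
        using r2 \<mu> t by (intro mult_right_mono) (auto simp: k_def min_le_iff_disj)
      then show ?thesis by simp
    qed
    have "(1 + \<mu> * r ^ 4 * t) \<le> C * (1 + t)"
    proof -
      have "\<mu> * r ^ 4 \<le> C"
      proof -
        have "\<mu> * r ^ 4 \<le> 2 / \<mu>"
          using \<open>\<mu>\<^sup>2 * r ^ 4 \<le> 2\<close> \<mu> by (simp add: pos_le_divide_eq power2_eq_square mult_ac)
        then show ?thesis using C by linarith
      qed
      then have "\<mu> * r ^ 4 * t \<le> C * t" using t by (rule mult_right_mono)
      then show ?thesis using C by (simp add: distrib_left)
    qed
    then have "(1 + \<mu> * r ^ 4 * t) * exp (- \<mu> * r ^ 4 * t) \<le> C * (1 + t) * exp (- k * t)"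
      using e C t by (intro mult_mono) auto
    moreover have "r * (t * exp (- \<mu> * r ^ 4 * t)) \<le> C * (1 + t) * exp (- k * t)"
    proof -
      have "2 / \<mu>\<^sup>2 \<le> 3 / \<mu>\<^sup>2" using \<mu> by (simp add: divide_right_mono)
      then have "r \<le> C" using r2 r4 C by linarith
      then have "r * t \<le> C * (1 + t)" using C t r by (intro mult_mono) auto
      then show ?thesis unfolding mult.assoc[symmetric] using e C t by (intro mult_mono[of "r * t"]) auto
    qed
    moreover have "r * cmod (K1_hat \<mu> t \<xi>) \<le> r * (t * exp (- \<mu> * r ^ 4 * t))"
      using kernels_nonpositive_disc(1)[OF True \<mu> t] r by (intro mult_left_mono) (auto simp: r_def)
    ultimately show ?thesis
      using kernels_nonpositive_disc(2)[OF True \<mu> t] unfolding r_def by linarith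
  next
    case False
    then have d: "disc \<mu> (norm \<xi>) > 0" by simp
    define D where "D = disc \<mu> r"
    have Dd: "D = \<mu>\<^sup>2 * r ^ 8 - r\<^sup>2 - r ^ 4" "D > 0" using d by (auto simp: D_def disc_def r_def)
    define \<sigma> where "\<sigma> = sqrt D"
    define \<alpha> where "\<alpha> = - \<mu> * r ^ 4 + \<sigma>"
    define \<kappa> where "\<kappa> = exp (\<alpha> * t) * ((1 - exp (- (2 * \<sigma> * t))) / (2 * \<sigma>))"
    have K: "K1_hat \<mu> t \<xi> = complex_of_real \<kappa>" "K0_hat \<mu> t \<xi> = complex_of_real (exp (\<alpha> * t) - \<alpha> * \<kappa>)"
      using kernels_overdamped[OF d, of t] unfolding \<kappa>_def \<alpha>_def \<sigma>_def D_def r_def by auto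
    have s0: "\<sigma> > 0" using Dd by (simp add: \<sigma>_def)
    have ss: "\<sigma>\<^sup>2 = D" using Dd by (simp add: \<sigma>_def)
    have sm: "\<sigma> \<le> \<mu> * r ^ 4"
    proof (rule power2_le_imp_le)
      show "\<sigma>\<^sup>2 \<le> (\<mu> * r ^ 4)\<^sup>2"
        unfolding ss Dd(1) using r2 by (simp add: power_mult_distrib flip: power_mult)
    qed (use \<mu> in auto)
    define S where "S = \<mu> * r ^ 4 + \<sigma>"
    have S0: "S > 0" using s0 sm by (simp add: S_def)
    \<comment> \<open>\<open>- S\<close> is the fast root and the product of the roots is
      \<open>r\<^sup>2 + r ^ 4\<close>. Dividing by \<open>S\<close>, which lies between
      \<open>\<mu> * r ^ 4\<close> and \<open>2 * \<mu> * r ^ 4\<close>, locates the slow root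
      without the cancellation in its definition.\<close>
    have aS: "\<alpha> * S = - (r\<^sup>2 + r ^ 4)"
    proof -
      have "\<alpha> * S = \<sigma>\<^sup>2 - (\<mu> * r ^ 4)\<^sup>2" unfolding \<alpha>_def S_def by (simp add: algebra_simps power2_eq_square)
      then show ?thesis unfolding ss Dd(1) by (simp add: power_mult_distrib flip: power_mult)
    qed
    have a1: "\<alpha> \<le> - (1 / (2 * \<mu>))"
    proof -
      have "(1 / (2 * \<mu>)) * S \<le> (1 / (2 * \<mu>)) * (2 * \<mu> * r ^ 4)" unfolding S_def using sm \<mu> by (intro mult_left_mono) auto
      also have "\<dots> \<le> r\<^sup>2 + r ^ 4" using \<mu> by simp
      finally have "\<alpha> * S \<le> - (1 / (2 * \<mu>)) * S" unfolding aS by simp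
      then show ?thesis using S0 by (rule mult_right_le_imp_le)
    qed
    have a2: "- \<alpha> \<le> 2 / \<mu>"
    proof -
      have "r\<^sup>2 + r ^ 4 \<le> (2 / \<mu>) * (\<mu> * r ^ 4)" using r2 \<mu> by simp
      also have "\<dots> \<le> (2 / \<mu>) * S" unfolding S_def using s0 \<mu> by (intro mult_left_mono) auto
      finally have "(- \<alpha>) * S \<le> (2 / \<mu>) * S" using aS by simp
      then show ?thesis using S0 by (rule mult_right_le_imp_le)
    qed
    have ea: "exp (\<alpha> * t) \<le> exp (- k * t)"
    proof -
      have "\<alpha> \<le> - k" using a1 by (simp add: k_def)
      then show ?thesis using mult_right_mono[of \<alpha> "- k" t] t by simp
    qed
    have k0: "0 \<le> \<kappa>" unfolding \<kappa>_def using s0 t by simp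
    have k1: "\<kappa> \<le> exp (\<alpha> * t) * t"
    proof -
      have "1 - exp (- (2 * \<sigma> * t)) \<le> 2 * \<sigma> * t" using exp_ge_add_one_self[of "- (2 * \<sigma> * t)"] by linarith
      then have "(1 - exp (- (2 * \<sigma> * t))) / (2 * \<sigma>) \<le> t" using s0 by (simp add: divide_le_eq mult_ac)
      then show ?thesis unfolding \<kappa>_def by (intro mult_left_mono) auto
    qed
    have k2: "\<kappa> \<le> exp (\<alpha> * t) * (1 / \<sigma>)"
    proof -
      have "(1 - exp (- (2 * \<sigma> * t))) / (2 * \<sigma>) \<le> 1 / \<sigma>" proof -
        have "1 - exp (- (2 * \<sigma> * t)) \<le> 2" using exp_gt_zero[of "- (2 * \<sigma> * t)"] by linarith
        then have "(1 - exp (- (2 * \<sigma> * t))) / (2 * \<sigma>) \<le> 2 / (2 * \<sigma>)" using s0 by (intro divide_right_mono) auto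
        then show ?thesis by simp
      qed
      then show ?thesis unfolding \<kappa>_def by (intro mult_left_mono) auto
    qed
    have "cmod (K0_hat \<mu> t \<xi>) \<le> exp (\<alpha> * t) + (- \<alpha>) * \<kappa>"
    proof -
      have "0 < 1 / (2 * \<mu>)" using \<mu> by simp
      then have "\<alpha> \<le> 0" using a1 by linarith
      then have "\<bar>exp (\<alpha> * t) - \<alpha> * \<kappa>\<bar> = exp (\<alpha> * t) + (- \<alpha>) * \<kappa>"
        using k0 mult_nonpos_nonneg[of \<alpha> \<kappa>] exp_gt_zero[of "\<alpha> * t"] by linarith
      then show ?thesis unfolding K norm_of_real by simp
    qed
    also have "\<dots> \<le> exp (\<alpha> * t) + C * (exp (\<alpha> * t) * t)"
    proof -
      have "- \<alpha> \<le> C" using a2 C by linarith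
      then show ?thesis using C k0 k1 t by (intro add_left_mono mult_mono) auto
    qed
    also have "\<dots> \<le> C * (1 + t) * exp (\<alpha> * t)"
      using mult_right_mono[OF C(1), of "exp (\<alpha> * t)"] by (simp add: algebra_simps)
    also have "\<dots> \<le> C * (1 + t) * exp (- k * t)" using ea C t by (intro mult_left_mono) auto
    finally have A: "cmod (K0_hat \<mu> t \<xi>) \<le> C * (1 + t) * exp (- k * t)" .
    have "r * \<kappa> \<le> C * (1 + t) * exp (\<alpha> * t)"
    \<comment> \<open>If \<open>\<sigma>\<close> is at least \<open>r\<close>, the bound
      \<open>1 / \<sigma>\<close> on \<kappa> supplies the factor \<open>1 / r\<close>. Otherwise
      the roots are close, which forces \<open>\<mu>\<^sup>2 * r ^ 4 \<le> 3\<close>; the frequency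
      is then bounded and the cruder factor \<open>t\<close> suffices. This is the origin of
      \<open>3 / \<mu>\<^sup>2\<close> in \<open>C\<close>.\<close>
    proof (cases "r \<le> \<sigma>")
      case True
      have "r * \<kappa> \<le> r * (exp (\<alpha> * t) * (1 / \<sigma>))" using k2 r by (intro mult_left_mono) auto
      also have "\<dots> = (r / \<sigma>) * exp (\<alpha> * t)" by simp
      also have "\<dots> \<le> (C * (1 + t)) * exp (\<alpha> * t)"
      proof (rule mult_right_mono)
        have "r / \<sigma> \<le> 1" using True s0 by simp
        also have "1 \<le> C * (1 + t)" using C t mult_mono[of 1 C 1 "1 + t"] by simp
        finally show "r / \<sigma> \<le> C * (1 + t)" .
      qed simp
      finally show ?thesis .
    next
      case False
      then have "\<sigma>\<^sup>2 \<le> r\<^sup>2" using s0 by (intro power_mono) auto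
      then have "\<mu>\<^sup>2 * r ^ 4 * r ^ 4 \<le> 3 * r ^ 4" unfolding ss Dd(1) r8 using r2 by (simp add: mult.assoc)
      then have "\<mu>\<^sup>2 * r ^ 4 \<le> 3" using r2 r by (simp add: mult_le_cancel_right)
      then have "r ^ 4 \<le> 3 / \<mu>\<^sup>2" using \<mu> by (simp add: field_simps)
      then have rC: "r \<le> C" using r2 C by linarith
      have "r * \<kappa> \<le> C * (exp (\<alpha> * t) * t)" using rC k0 k1 C by (intro mult_mono) auto
      also have "\<dots> \<le> C * (1 + t) * exp (\<alpha> * t)"
        using mult_nonneg_nonneg[of C "exp (\<alpha> * t)"] C by (simp add: algebra_simps)
      finally show ?thesis .
    qed
    also have "\<dots> \<le> C * (1 + t) * exp (- k * t)" using ea C t by (intro mult_left_mono) auto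
    finally show ?thesis using A k0 unfolding K(1) norm_of_real by simp
  qed
  then show "cmod (K0_hat \<mu> t \<xi>) \<le> C * (1 + t) * exp (- k * t)" by blast
  show "cmod (K1_hat \<mu> t \<xi>) \<le> C * (1 + t) * exp (- k * t) / norm \<xi>"
    using fin r unfolding r_def by (subst pos_le_divide_eq) (auto simp: mult.commute)
qed

section \<open>Low frequency expansions\<close>

lemma abs_sin_diff_le: "\<bar>sin x - sin y\<bar> \<le> \<bar>x - y :: real\<bar>"
proof -
  have "\<bar>sin x - sin y\<bar> = 2 * \<bar>sin ((x - y) / 2)\<bar> * \<bar>cos ((x + y) / 2)\<bar>"
    by (simp add: sin_diff_sin abs_mult)
  also have "\<dots> \<le> 2 * \<bar>(x - y) / 2\<bar> * 1"
    by (intro mult_mono abs_sin_x_le_abs_x) auto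
  finally show ?thesis by simp
qed

lemma abs_cos_diff_le: "\<bar>cos x - cos y\<bar> \<le> \<bar>x - y :: real\<bar>"
  using abs_sin_diff_le[of "pi / 2 - x" "pi / 2 - y"] by (simp add: cos_sin_eq abs_minus_commute)

text \<open>The mean value theorem replaces the increment by \<open>d * cos z\<close> with
  \<open>z\<close> within \<open>\<bar>d\<bar>\<close> of \<open>x\<close>, and the cosine is
  1-Lipschitz.\<close>

lemma sin_taylor1: "\<bar>sin (x + d) - sin x - d * cos x\<bar> \<le> (d::real)\<^sup>2"
proof -
  have "\<exists>z. \<bar>z - x\<bar> \<le> \<bar>d\<bar> \<and> sin (x + d) - sin x = d * cos z"
  proof (cases d "0::real" rule: linorder_cases)
    case less
    have "\<exists>z. x + d < z \<and> z < x \<and> sin x - sin (x + d) = (x - (x + d)) * cos z"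
      using less by (intro MVT2) (auto intro!: derivative_eq_intros)
    then obtain z where "x + d < z" "z < x" "sin x - sin (x + d) = (x - (x + d)) * cos z" by blast
    then show ?thesis by (intro exI[of _ z]) (auto simp: algebra_simps)
  next
    case greater
    have "\<exists>z. x < z \<and> z < x + d \<and> sin (x + d) - sin x = (x + d - x) * cos z"
      using greater by (intro MVT2) (auto intro!: derivative_eq_intros)
    then obtain z where "x < z" "z < x + d" "sin (x + d) - sin x = (x + d - x) * cos z" by blast
    then show ?thesis by (intro exI[of _ z]) (auto simp: algebra_simps)
  qed auto
  then obtain z where z: "\<bar>z - x\<bar> \<le> \<bar>d\<bar>" "sin (x + d) - sin x = d * cos z" by blast
  have "\<bar>sin (x + d) - sin x - d * cos x\<bar> = \<bar>d\<bar> * \<bar>cos z - cos x\<bar>"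
    unfolding z(2) by (simp add: abs_mult right_diff_distrib[symmetric])
  also have "\<dots> \<le> \<bar>d\<bar> * \<bar>d\<bar>"
    using z(1) abs_cos_diff_le[of z x] by (intro mult_left_mono) auto
  finally show ?thesis by (simp add: power2_eq_square)
qed

text \<open>The difference of the squares of \<omega> and \<open>r + r ^ 3 / 2\<close> is exactly
  \<open>- (r ^ 6 / 4 + \<mu>\<^sup>2 * r ^ 8)\<close>. Dividing by the sum of the two frequencies,
  which is close to \<open>2 * r\<close>, produces the term \<open>- r ^ 5 / 8\<close>; the damping
  changes the frequency only at order \<open>r ^ 7\<close>.\<close>

lemma frequency_expansion:
  assumes \<mu>: "0 < \<mu>" "\<mu> < 1" and r: "0 < r" "r \<le> 1"
  defines "\<omega> \<equiv> sqrt (- disc \<mu> r)"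
  shows "disc \<mu> r < 0" "r \<le> \<omega>" "\<omega> - r \<le> r ^ 3 / 2" "\<bar>\<omega> - (r + r ^ 3 / 2)\<bar> \<le> r ^ 5"
    "\<bar>\<omega> - (r + r ^ 3 / 2) + r ^ 5 / 8\<bar> \<le> r ^ 7"
proof -
  have m2: "0 \<le> \<mu>\<^sup>2" "\<mu>\<^sup>2 \<le> 1" using \<mu> by (auto simp: power_le_one)
  have m8: "\<mu>\<^sup>2 * r ^ 8 \<le> r ^ 8" "0 \<le> \<mu>\<^sup>2 * r ^ 8" using m2 r by (auto simp: mult_left_le_one_le)
  have p: "r ^ 8 \<le> r ^ 4" "r ^ 8 \<le> r ^ 6" using r power_decreasing[of 4 8 r] power_decreasing[of 6 8 r] by auto
  have D: "r\<^sup>2 \<le> - disc \<mu> r" unfolding disc_def using m8 p by linarith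
  have "r\<^sup>2 > 0" using r by simp
  then show "disc \<mu> r < 0" using D by linarith
  have ww: "\<omega>\<^sup>2 = r\<^sup>2 + r ^ 4 - \<mu>\<^sup>2 * r ^ 8"
  proof -
    have "0 \<le> - disc \<mu> r" using D \<open>r\<^sup>2 > 0\<close> by linarith
    then show ?thesis unfolding \<omega>_def by (simp add: disc_def)
  qed
  show w: "r \<le> \<omega>" unfolding \<omega>_def using D by (intro real_le_rsqrt)
  define \<sigma> where "\<sigma> = \<omega> + (r + r ^ 3 / 2)"
  have r3: "r ^ 3 > 0" using r by simp
  have sp: "\<sigma> \<ge> 2 * r" "\<sigma> > 0" using w r r3 unfolding \<sigma>_def by linarith+
  have prod: "(\<omega> - (r + r ^ 3 / 2)) * \<sigma> = - (r ^ 6 / 4 + \<mu>\<^sup>2 * r ^ 8)"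
  proof -
    have "(\<omega> - (r + r ^ 3 / 2)) * \<sigma> = \<omega>\<^sup>2 - (r + r ^ 3 / 2)\<^sup>2"
      unfolding \<sigma>_def by (simp add: algebra_simps power2_eq_square)
    also have "(r + r ^ 3 / 2)\<^sup>2 = r\<^sup>2 + r ^ 4 + r ^ 6 / 4"
    proof -
      have "r * r ^ 3 = r ^ 4" "(r ^ 3)\<^sup>2 = r ^ 6" by (simp_all add: power_eq_if flip: power_mult)
      then show ?thesis by (simp add: power2_sum power_divide)
    qed
    finally show ?thesis unfolding ww by simp
  qed
  have r5: "2 * r * r ^ 5 = 2 * r ^ 6" "2 * r * r ^ 7 = 2 * r ^ 8" by (simp_all add: power_eq_if)
  have wr: "(\<omega> - r) * (2 * r) \<le> r ^ 4"
  proof -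
    have "(\<omega> - r) * (2 * r) \<le> (\<omega> - r) * (\<omega> + r)" using w r by (intro mult_left_mono) auto
    also have "\<dots> = \<omega>\<^sup>2 - r\<^sup>2" by (simp add: algebra_simps power2_eq_square)
    also have "\<dots> \<le> r ^ 4" unfolding ww using m8 by simp
    finally show ?thesis .
  qed
  have "r ^ 4 = (r ^ 3 / 2) * (2 * r)" by (simp add: power_eq_if)
  then have "(\<omega> - r) * (2 * r) \<le> (r ^ 3 / 2) * (2 * r)" using wr by linarith
  then show wr3: "\<omega> - r \<le> r ^ 3 / 2" by (rule mult_right_le_imp_le) (use r in simp)
  have "\<bar>\<omega> - (r + r ^ 3 / 2)\<bar> * (2 * r) \<le> \<bar>\<omega> - (r + r ^ 3 / 2)\<bar> * \<sigma>" using sp by (intro mult_left_mono) auto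
  also have "\<dots> = \<bar>(\<omega> - (r + r ^ 3 / 2)) * \<sigma>\<bar>" using sp by (simp add: abs_mult)
  also have "\<dots> \<le> r ^ 5 * (2 * r)"
  proof -
    have "0 \<le> r ^ 6" using r by simp
    moreover have "r ^ 5 * (2 * r) = 2 * r ^ 6" using r5(1) by (simp add: mult_ac)
    ultimately show ?thesis unfolding prod using m8 p by linarith
  qed
  finally show "\<bar>\<omega> - (r + r ^ 3 / 2)\<bar> \<le> r ^ 5" by (rule mult_right_le_imp_le) (use r in simp)
  \<comment> \<open>The added term times the leading part \<open>2 * r\<close> of \<sigma> cancels
    \<open>r ^ 6 / 4\<close>. What remains is of order \<open>r ^ 8\<close>, because \<sigma>
    exceeds \<open>2 * r\<close> by at most \<open>r ^ 3\<close>.\<close>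
  have "(\<omega> - (r + r ^ 3 / 2) + r ^ 5 / 8) * \<sigma> = r ^ 5 / 8 * (\<sigma> - 2 * r) - \<mu>\<^sup>2 * r ^ 8"
    unfolding distrib_right prod using r5 by (simp add: algebra_simps)
  moreover have "\<bar>r ^ 5 / 8 * (\<sigma> - 2 * r) - \<mu>\<^sup>2 * r ^ 8\<bar> \<le> r ^ 7 * (2 * r)"
  proof -
    have "\<sigma> - 2 * r \<le> r ^ 3" unfolding \<sigma>_def using wr3 by linarith
    then have "r ^ 5 / 8 * (\<sigma> - 2 * r) \<le> r ^ 5 / 8 * r ^ 3" using r by (intro mult_left_mono) auto
    also have "\<dots> = r ^ 8 / 8" by (simp add: power_add[symmetric])
    finally have a: "r ^ 5 / 8 * (\<sigma> - 2 * r) \<le> r ^ 8 / 8" .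
    have b: "0 \<le> r ^ 5 / 8 * (\<sigma> - 2 * r)" using sp r by (intro mult_nonneg_nonneg) auto
    have c: "0 \<le> r ^ 8" using r by simp
    have d: "r ^ 7 * (2 * r) = 2 * r ^ 8" using r5 by (simp add: mult_ac)
    show ?thesis unfolding d using a b c m8 by linarith
  qed
  ultimately have "\<bar>(\<omega> - (r + r ^ 3 / 2) + r ^ 5 / 8) * \<sigma>\<bar> \<le> r ^ 7 * (2 * r)" by simp
  moreover have "\<bar>\<omega> - (r + r ^ 3 / 2) + r ^ 5 / 8\<bar> * (2 * r) \<le> \<bar>\<omega> - (r + r ^ 3 / 2) + r ^ 5 / 8\<bar> * \<sigma>"
    using sp by (intro mult_left_mono) auto
  ultimately have "\<bar>\<omega> - (r + r ^ 3 / 2) + r ^ 5 / 8\<bar> * (2 * r) \<le> r ^ 7 * (2 * r)"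
    using sp by (simp add: abs_mult)
  then show "\<bar>\<omega> - (r + r ^ 3 / 2) + r ^ 5 / 8\<bar> \<le> r ^ 7" by (rule mult_right_le_imp_le) (use r in simp)
qed

text \<open>Two errors govern the comparison with the symbols: the phase error, at most
  \<open>r ^ 5 * t\<close>, and the difference of \<open>1 / \<omega>\<close> and
  \<open>1 / r\<close>, at most \<open>r / 2\<close>. When \<open>r ^ 4 * t\<close> is bounded the
  phase error is of size \<open>r\<close>, so after division by \<open>r\<close> it leaves a term of
  order one in \<open>K1_hat\<close>; the last estimate removes exactly this term.\<close>

lemma kernels_low_frequency:
  fixes \<xi> :: "real^'n"
  assumes \<mu>: "0 < \<mu>" "\<mu> < 1" and r: "0 < norm \<xi>" "norm \<xi> \<le> 1" and t: "0 \<le> t"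
  defines "r \<equiv> norm \<xi>"
  defines "e \<equiv> exp (- \<mu> * r ^ 4 * t)"
  shows "cmod (K0_hat \<mu> t \<xi>) \<le> (1 + r ^ 4 * t) * e"
    and "cmod (K0_hat \<mu> t \<xi> - sym0 \<mu> t r) \<le> (r ^ 5 * t + r ^ 3) * e"
    and "cmod (K1_hat \<mu> t \<xi>) \<le> e / r"
    and "cmod (K1_hat \<mu> t \<xi> - sym1 \<mu> t r) \<le> (r ^ 4 * t + r) * e"
    and "cmod (K1_hat \<mu> t \<xi> - sym1 \<mu> t r + t / 8 * r ^ 4 * sym0 \<mu> t r) \<le> (r + r ^ 9 * t\<^sup>2 + r ^ 6 * t) * e"
proof -
  have r': "0 < r" "r \<le> 1" using r by (auto simp: r_def)
  define \<omega> where "\<omega> = sqrt (- disc \<mu> r)"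
  define w0 where "w0 = r + r ^ 3 / 2"
  note fe = frequency_expansion[OF \<mu> r', folded \<omega>_def w0_def]
  have e0: "0 < e" by (simp add: e_def)
  have K: "K1_hat \<mu> t \<xi> = complex_of_real (sin (\<omega> * t) / \<omega> * e)"
    "K0_hat \<mu> t \<xi> = complex_of_real ((cos (\<omega> * t) + \<mu> * r ^ 4 * (sin (\<omega> * t) / \<omega>)) * e)"
    using kernels_oscillating[OF fe(1)[unfolded r_def]] unfolding e_def \<omega>_def r_def by auto
  have S: "sym0 \<mu> t r = cos (w0 * t) * e" "sym1 \<mu> t r = sin (w0 * t) / r * e"
    unfolding sym0_def sym1_def w0_def e_def by (simp_all add: algebra_simps)
  have w: "\<omega> > 0" using fe r' by linarith
  have "cmod (K0_hat \<mu> t \<xi>) \<le> (1 + \<mu> * r ^ 4 * t) * e"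
    unfolding e_def r_def by (rule kernels_nonpositive_disc(2)) (use fe(1) \<mu> t in \<open>auto simp: r_def\<close>)
  also have "\<dots> \<le> (1 + r ^ 4 * t) * e"
    using \<mu> e0 t r' by (intro mult_right_mono add_left_mono) (auto simp: mult_left_le_one_le)
  finally show "cmod (K0_hat \<mu> t \<xi>) \<le> (1 + r ^ 4 * t) * e" .
  have sw: "\<bar>sin (\<omega> * t) / \<omega>\<bar> \<le> 1 / r"
  proof -
    have "\<bar>sin (\<omega> * t) / \<omega>\<bar> \<le> 1 / \<omega>" using w by (simp add: abs_divide divide_right_mono)
    also have "\<dots> \<le> 1 / r" using fe(2) r' by (simp add: frac_le)
    finally show ?thesis .
  qed
  have dw: "\<bar>\<omega> * t - w0 * t\<bar> \<le> r ^ 5 * t"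
    using fe(4) t by (simp add: left_diff_distrib[symmetric] abs_mult mult_right_mono)
  show "cmod (K1_hat \<mu> t \<xi>) \<le> e / r"
    unfolding K norm_of_real abs_mult using mult_right_mono[OF sw, of e] e0 by simp
  have "K0_hat \<mu> t \<xi> - sym0 \<mu> t r = complex_of_real (((cos (\<omega> * t) - cos (w0 * t)) + \<mu> * r ^ 4 * (sin (\<omega> * t) / \<omega>)) * e)"
    unfolding K S of_real_diff[symmetric] by (rule arg_cong[where f=complex_of_real]) (simp add: algebra_simps)
  moreover have "\<bar>(cos (\<omega> * t) - cos (w0 * t)) + \<mu> * r ^ 4 * (sin (\<omega> * t) / \<omega>)\<bar> \<le> r ^ 5 * t + r ^ 3"
  proof -
    have "\<mu> * r ^ 4 * \<bar>sin (\<omega> * t) / \<omega>\<bar> \<le> 1 * r ^ 4 * (1 / r)"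
      using sw \<mu> r' by (intro mult_mono) auto
    also have "\<dots> = r ^ 3" using r' by (simp add: power_eq_if)
    finally have "\<bar>\<mu> * r ^ 4 * (sin (\<omega> * t) / \<omega>)\<bar> \<le> r ^ 3" using \<mu> by (simp add: abs_mult)
    then show ?thesis using abs_cos_diff_le[of "\<omega> * t" "w0 * t"] dw by linarith
  qed
  ultimately show "cmod (K0_hat \<mu> t \<xi> - sym0 \<mu> t r) \<le> (r ^ 5 * t + r ^ 3) * e"
    using e0 by (simp only: norm_of_real abs_mult) (simp add: mult_right_mono)
  have inv: "\<bar>1 / \<omega> - 1 / r\<bar> \<le> r / 2"
  proof -
    have "\<bar>1 / \<omega> - 1 / r\<bar> = (\<omega> - r) / (\<omega> * r)"
      using w r' fe(2) by (simp add: abs_if field_simps)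
    also have "\<dots> \<le> (r ^ 3 / 2) / (r * r)"
      using w r' fe(2,3) by (intro frac_le mult_right_mono) auto
    also have "\<dots> = r / 2" using r' by (simp add: power_eq_if)
    finally show ?thesis .
  qed
  have s_inv: "\<bar>sin (\<omega> * t) * (1 / \<omega> - 1 / r)\<bar> \<le> r / 2"
    unfolding abs_mult using inv by (intro order.trans[OF mult_left_le_one_le inv]) auto
  have k1: "sin (\<omega> * t) / \<omega> - sin (w0 * t) / r = sin (\<omega> * t) * (1 / \<omega> - 1 / r) + (sin (\<omega> * t) - sin (w0 * t)) / r"
    by (simp add: algebra_simps diff_divide_distrib)
  have "K1_hat \<mu> t \<xi> - sym1 \<mu> t r = complex_of_real ((sin (\<omega> * t) / \<omega> - sin (w0 * t) / r) * e)"
    unfolding K S of_real_diff[symmetric] by (rule arg_cong[where f=complex_of_real]) (simp add: algebra_simps)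
  moreover have "\<bar>sin (\<omega> * t) / \<omega> - sin (w0 * t) / r\<bar> \<le> r ^ 4 * t + r"
  proof -
    have "\<bar>(sin (\<omega> * t) - sin (w0 * t)) / r\<bar> \<le> (r ^ 5 * t) / r"
      unfolding abs_divide using r' abs_sin_diff_le[of "\<omega> * t" "w0 * t"] dw by (intro frac_le) auto
    also have "\<dots> = r ^ 4 * t" using r' by (simp add: power_eq_if)
    finally show ?thesis unfolding k1 using s_inv r' by linarith
  qed
  ultimately show "cmod (K1_hat \<mu> t \<xi> - sym1 \<mu> t r) \<le> (r ^ 4 * t + r) * e"
    using e0 by (simp only: norm_of_real abs_mult) (simp add: mult_right_mono)
  define d where "d = \<omega> * t - w0 * t"
  \<comment> \<open>Since \<open>d\<close> is close to \<open>- r ^ 5 * t / 8\<close>, the linear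
    Taylor term \<open>d * cos (w0 * t) / r\<close> cancels the correction up to the next order of
    the frequency. The three summands are bounded by \<open>r\<close>,
    \<open>r ^ 9 * t\<^sup>2\<close> and \<open>r ^ 6 * t\<close> in this order.\<close>
  have k2: "sin (\<omega> * t) / \<omega> - sin (w0 * t) / r + t / 8 * r ^ 4 * cos (w0 * t)
     = sin (\<omega> * t) * (1 / \<omega> - 1 / r) + (sin (w0 * t + d) - sin (w0 * t) - d * cos (w0 * t)) / r
       + ((\<omega> - w0 + r ^ 5 / 8) * t / r) * cos (w0 * t)"
  proof -
    have r4: "r ^ 4 = r ^ 5 / r" using r' by (simp add: power_eq_if)
    have "w0 * t + d = \<omega> * t" by (simp add: d_def)
    then show ?thesis unfolding d_def r4 by (simp add: algebra_simps add_divide_distrib diff_divide_distrib)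
  qed
  have "K1_hat \<mu> t \<xi> - sym1 \<mu> t r + t / 8 * r ^ 4 * sym0 \<mu> t r
    = complex_of_real ((sin (\<omega> * t) / \<omega> - sin (w0 * t) / r + t / 8 * r ^ 4 * cos (w0 * t)) * e)"
    unfolding K S of_real_diff[symmetric] of_real_add[symmetric]
    by (rule arg_cong[where f=complex_of_real]) (simp add: algebra_simps)
  moreover have "\<bar>sin (\<omega> * t) / \<omega> - sin (w0 * t) / r + t / 8 * r ^ 4 * cos (w0 * t)\<bar> \<le> r + r ^ 9 * t\<^sup>2 + r ^ 6 * t"
  proof -
    have "d\<^sup>2 \<le> (r ^ 5 * t)\<^sup>2" using dw power_mono[of "\<bar>d\<bar>" "r ^ 5 * t" 2] unfolding d_def by simp
    then have "\<bar>sin (w0 * t + d) - sin (w0 * t) - d * cos (w0 * t)\<bar> \<le> (r ^ 5 * t)\<^sup>2"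
      using sin_taylor1[of "w0 * t" d] by linarith
    then have "\<bar>(sin (w0 * t + d) - sin (w0 * t) - d * cos (w0 * t)) / r\<bar> \<le> (r ^ 5 * t)\<^sup>2 / r"
      unfolding abs_divide using r' by (intro frac_le) auto
    also have "(r ^ 5 * t)\<^sup>2 = (r ^ 9 * t\<^sup>2) * r"
      by (simp add: power_mult_distrib mult_ac flip: power_mult power_Suc)
    also have "\<dots> / r = r ^ 9 * t\<^sup>2" using r' by simp
    finally have a: "\<bar>(sin (w0 * t + d) - sin (w0 * t) - d * cos (w0 * t)) / r\<bar> \<le> r ^ 9 * t\<^sup>2" .
    have "\<bar>(\<omega> - w0 + r ^ 5 / 8) * t / r\<bar> \<le> r ^ 7 * t / r"
      unfolding abs_divide abs_mult using r' t mult_right_mono[OF fe(5) t] by (intro frac_le) auto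
    also have "\<dots> = r ^ 6 * t" using r' by (simp add: power_eq_if)
    finally have "\<bar>((\<omega> - w0 + r ^ 5 / 8) * t / r) * cos (w0 * t)\<bar> \<le> r ^ 6 * t * 1"
      unfolding abs_mult using r' t by (intro mult_mono) auto
    then show ?thesis unfolding k2 using a s_inv r' by linarith
  qed
  ultimately show "cmod (K1_hat \<mu> t \<xi> - sym1 \<mu> t r + t / 8 * r ^ 4 * sym0 \<mu> t r) \<le> (r + r ^ 9 * t\<^sup>2 + r ^ 6 * t) * e"
    using e0 by (simp only: norm_of_real abs_mult) (simp add: mult_right_mono)
qed

section \<open>Fourier transforms of the profiles\<close>

text \<open>Completing the square in \<open>(norm \<xi>)\<^sup>2\<close> gives the constant
  \<open>exp (a\<^sup>2 / (4 * k))\<close>.\<close>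

lemma gdecay_exp4:
  assumes k: "0 < k"
  shows "gdecay (\<lambda>\<xi>::'a::euclidean_space. complex_of_real (exp (- k * norm \<xi> ^ 4)))"
  unfolding gdecay_def
proof (intro conjI allI)
  fix a :: real
  have "exp (- k * norm \<xi> ^ 4) \<le> exp (a\<^sup>2 / (4 * k)) * exp (- a * (norm \<xi>)\<^sup>2)" for \<xi> :: 'a
  proof -
    have "0 \<le> k * ((norm \<xi>)\<^sup>2 - a / (2 * k))\<^sup>2" using k by simp
    also have "\<dots> = k * norm \<xi> ^ 4 - a * (norm \<xi>)\<^sup>2 + a\<^sup>2 / (4 * k)"
      using k by (simp add: power2_diff field_simps power2_eq_square flip: power_mult) (simp add: power_eq_if)
    finally show ?thesis unfolding exp_add[symmetric] by simp
  qed
  then show "\<exists>C\<ge>0. \<forall>\<xi>::'a. cmod (complex_of_real (exp (- k * norm \<xi> ^ 4))) \<le> C * exp (- a * (norm \<xi>)\<^sup>2)"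
    by (intro exI[of _ "exp (a\<^sup>2 / (4 * k))"]) auto
qed measurable

lemma abs_sym0_le: "\<bar>sym0 \<mu> t r\<bar> \<le> exp (- \<mu> * r ^ 4 * t)"
  by (simp add: sym0_def abs_mult)

lemma abs_sym1_le: "0 \<le> r \<Longrightarrow> r * \<bar>sym1 \<mu> t r\<bar> \<le> exp (- \<mu> * r ^ 4 * t)"
  by (cases "r = 0") (auto simp: sym1_def abs_mult abs_divide)

text \<open>A bound without singularity at \<open>r = 0\<close>, from
  \<open>\<bar>sin p\<bar> \<le> \<bar>p\<bar>\<close>. The price is the factor
  \<open>exp (r\<^sup>2)\<close>, which \<open>gdecay_mult_bound\<close> tolerates.\<close>

lemma abs_sym1_le': "0 \<le> r \<Longrightarrow> 0 \<le> t \<Longrightarrow> \<bar>sym1 \<mu> t r\<bar> \<le> t * exp (r\<^sup>2) * exp (- \<mu> * r ^ 4 * t)"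
proof (cases "r = 0")
  case False
  assume "0 \<le> r" "0 \<le> t"
  then have r: "r > 0" using False by simp
  have p: "r * t + 1/2 * r ^ 3 * t = r * (t * (1 + r\<^sup>2 / 2))" by (simp add: algebra_simps power_eq_if)
  have "\<bar>sin (r * t + 1/2 * r ^ 3 * t)\<bar> \<le> r * (t * (1 + r\<^sup>2 / 2))"
    using abs_sin_x_le_abs_x[of "r * t + 1/2 * r ^ 3 * t"] r \<open>0 \<le> t\<close> unfolding p by simp
  then have "\<bar>1 / r * sin (r * t + 1/2 * r ^ 3 * t)\<bar> \<le> t * (1 + r\<^sup>2 / 2)"
    using r by (simp add: abs_mult divide_le_eq mult.commute)
  also have "\<dots> \<le> t * exp (r\<^sup>2)"
    using exp_ge_add_one_self[of "r\<^sup>2"] zero_le_power2[of r] \<open>0 \<le> t\<close> by (intro mult_left_mono) linarith+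
  finally have "\<bar>1 / r * sin (r * t + 1/2 * r ^ 3 * t)\<bar> \<le> t * exp (r\<^sup>2)" .
  from mult_right_mono[OF this, of "exp (- \<mu> * r ^ 4 * t)"] show ?thesis
    unfolding sym1_def abs_mult[of _ "exp _"] by simp
qed (simp add: sym1_def)

lemma sym_meas [measurable]:
  "(\<lambda>\<xi>::'a::euclidean_space. sym0 \<mu> t (norm \<xi>)) \<in> borel_measurable borel"
  "(\<lambda>\<xi>::'a::euclidean_space. sym1 \<mu> t (norm \<xi>)) \<in> borel_measurable borel"
  unfolding sym0_def sym1_def by measurable

lemma gdecay_sym0: "0 < \<mu> \<Longrightarrow> 0 < t \<Longrightarrow> gdecay (\<lambda>\<xi>::'a::euclidean_space. complex_of_real (sym0 \<mu> t (norm \<xi>)))"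
  using abs_sym0_le[of \<mu> t "norm (_::'a)"]
  by (intro gdecay_mult_bound[OF gdecay_exp4[of "\<mu> * t"], of _ 1 0]) (auto simp: mult_ac)

lemma gdecay_sym1: "0 < \<mu> \<Longrightarrow> 0 < t \<Longrightarrow> gdecay (\<lambda>\<xi>::'a::euclidean_space. complex_of_real (sym1 \<mu> t (norm \<xi>)))"
  using abs_sym1_le'[of "norm (_::'a)" t \<mu>]
  by (intro gdecay_mult_bound[OF gdecay_exp4[of "\<mu> * t"], of _ t 1]) (auto simp: mult_ac)

lemma G0_eq: "G0 \<mu> t = (\<lambda>x::real^'n. Re (inv_fourier (\<lambda>\<xi>. complex_of_real (sym0 \<mu> t (norm \<xi>))) x))"
  by (simp add: G0_def [abs_def] sym0_def)

lemma G1_eq: "G1 \<mu> t = (\<lambda>x::real^'n. Re (inv_fourier (\<lambda>\<xi>. complex_of_real (sym1 \<mu> t (norm \<xi>))) x))"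
  by (simp add: G1_def [abs_def] sym1_def)

lemma isCont_sym0: "isCont (\<lambda>\<xi>::'a::euclidean_space. complex_of_real (sym0 \<mu> t (norm \<xi>))) \<xi>"
  unfolding sym0_def by (intro continuous_intros)

lemma isCont_sym1: "\<xi> \<noteq> 0 \<Longrightarrow> isCont (\<lambda>\<xi>::'a::euclidean_space. complex_of_real (sym1 \<mu> t (norm \<xi>))) \<xi>"
  unfolding sym1_def by (intro continuous_intros) auto

lemma inv_fourier_sum:
  assumes "finite I" "\<And>i. i \<in> I \<Longrightarrow> gdecay (F i)"
  shows "inv_fourier (\<lambda>\<xi>. \<Sum>i\<in>I. F i \<xi>) x = (\<Sum>i\<in>I. inv_fourier (F i) x)"
proof -
  have "integrable lborel (\<lambda>\<xi>. cis (x \<bullet> \<xi>) * F i \<xi>)" if "i \<in> I" for i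
    by (intro integrable_cis_mult gdecay_integrable(1)[OF assms(2)[OF that]]) measurable
  then show ?thesis
    unfolding inv_fourier_def sum_distrib_left by (subst Bochner_Integration.integral_sum) (auto simp: sum_distrib_left)
qed

text \<open>The second claim puts the new symbol back into \<open>gdecay\<close>, so that the
  formula can be iterated for the bilaplacian.\<close>

lemma laplacian_inv_fourier:
  fixes F :: "real^'n \<Rightarrow> complex"
  assumes F: "gdecay F"
  shows "laplacian (\<lambda>x. Re (inv_fourier F x)) = (\<lambda>x. Re (inv_fourier (\<lambda>\<xi>. - complex_of_real ((norm \<xi>)\<^sup>2) * F \<xi>) x))"
    and "gdecay (\<lambda>\<xi>. - complex_of_real ((norm \<xi>)\<^sup>2) * F \<xi>)"
proof -
  let ?H = "\<lambda>i \<xi>. \<i> * complex_of_real (\<xi> $ i) * (\<i> * complex_of_real (\<xi> $ i) * F \<xi>)"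
  have eq: "- complex_of_real ((norm \<xi>)\<^sup>2) * F \<xi> = (\<Sum>i\<in>UNIV. ?H i \<xi>)" for \<xi>
  proof -
    have "(norm \<xi>)\<^sup>2 = (\<Sum>i\<in>UNIV. (\<xi> $ i)\<^sup>2)"
      by (simp add: norm_vec_def L2_set_def sum_nonneg)
    then have "- complex_of_real ((norm \<xi>)\<^sup>2) * F \<xi> = (\<Sum>i\<in>UNIV. - complex_of_real ((\<xi> $ i)\<^sup>2) * F \<xi>)"
      by (simp add: sum_negf sum_distrib_right)
    also have "\<dots> = (\<Sum>i\<in>UNIV. ?H i \<xi>)"
    proof (rule sum.cong[OF refl])
      fix i
      show "- complex_of_real ((\<xi> $ i)\<^sup>2) * F \<xi> = ?H i \<xi>"
        by (simp add: complex_eq_iff power2_eq_square algebra_simps)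
    qed
    finally show ?thesis .
  qed
  have H: "gdecay (?H i)" for i by (intro gdecay_coord F)
  show "laplacian (\<lambda>x. Re (inv_fourier F x)) = (\<lambda>x. Re (inv_fourier (\<lambda>\<xi>. - complex_of_real ((norm \<xi>)\<^sup>2) * F \<xi>) x))"
  proof
    fix x
    show "laplacian (\<lambda>x. Re (inv_fourier F x)) x = Re (inv_fourier (\<lambda>\<xi>. - complex_of_real ((norm \<xi>)\<^sup>2) * F \<xi>) x)"
      unfolding eq by (subst inv_fourier_sum)
        (auto simp: H laplacian_def partial_deriv_inv_fourier[OF F] partial_deriv_inv_fourier[OF gdecay_coord[OF F]])
  qed
  show "gdecay (\<lambda>\<xi>. - complex_of_real ((norm \<xi>)\<^sup>2) * F \<xi>)"
  proof (rule gdecay_mult_bound[OF F, of _ 1 1])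
    show "(\<lambda>\<xi>. - complex_of_real ((norm \<xi>)\<^sup>2) * F \<xi>) \<in> borel_measurable borel"
      using gdecay_meas[OF F] by measurable
    show "cmod (- complex_of_real ((norm \<xi>)\<^sup>2) * F \<xi>) \<le> 1 * exp (1 * (norm \<xi>)\<^sup>2) * cmod (F \<xi>)" for \<xi>
    proof -
      have "(norm \<xi>)\<^sup>2 \<le> exp ((norm \<xi>)\<^sup>2)"
        using exp_ge_add_one_self[of "(norm \<xi>)\<^sup>2"] by linarith
      then show ?thesis unfolding norm_mult norm_minus_cancel norm_of_real by (intro mult_right_mono) auto
    qed
  qed simp
qed

text \<open>The symbol of \<open>profile2\<close>, with the masses and the moment turned into free
  parameters \<open>P0\<close>, \<open>P1\<close>, \<open>M\<close>: the lower bound is then a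
  statement about numbers and one vector, independent of where they come from.\<close>

definition phat2 :: "real \<Rightarrow> real \<Rightarrow> real \<Rightarrow> real^'n \<Rightarrow> real \<Rightarrow> real^'n \<Rightarrow> complex" where
  "phat2 \<mu> P0 P1 M t \<xi> = complex_of_real (sym0 \<mu> t (norm \<xi>) * (P0 - t / 8 * norm \<xi> ^ 4 * P1))
     - \<i> * complex_of_real ((\<xi> \<bullet> M) * sym1 \<mu> t (norm \<xi>))"

lemma phat2_meas [measurable]: "phat2 \<mu> P0 P1 M t \<in> borel_measurable borel"
  unfolding phat2_def [abs_def] by measurable

lemma has_l2_fourier_profile1:
  assumes "0 < \<mu>" "0 < t"
  shows "has_l2_fourier (profile1 \<mu> v1 t :: real^'n \<Rightarrow> real) (\<lambda>\<xi>. complex_of_real (mass v1 * sym1 \<mu> t (norm \<xi>)))"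
proof -
  have "has_l2_fourier (G1 \<mu> t) (\<lambda>\<xi>::real^'n. complex_of_real (sym1 \<mu> t (norm \<xi>)))"
    unfolding G1_eq by (intro has_l2_fourier_inverse gdecay_sym1 assms isCont_sym1) auto
  from has_l2_fourier_cmult[OF this, of "mass v1"] show ?thesis
    unfolding profile1_def [abs_def] by (simp add: mult.commute)
qed

lemma has_l2_fourier_profile2:
  assumes mt: "0 < \<mu>" "0 < t"
  shows "has_l2_fourier (profile2 \<mu> v0 v1 t :: real^'n \<Rightarrow> real) (phat2 \<mu> (mass v0) (mass v1) (moment v1) t)"
proof -
  let ?s0 = "\<lambda>\<xi>::real^'n. complex_of_real (sym0 \<mu> t (norm \<xi>))"
  let ?s1 = "\<lambda>\<xi>::real^'n. complex_of_real (sym1 \<mu> t (norm \<xi>))"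
  have 0: "has_l2_fourier (G0 \<mu> t) ?s0"
    unfolding G0_eq by (intro has_l2_fourier_inverse gdecay_sym0 mt isCont_sym0) auto
  have 1: "has_l2_fourier (\<lambda>x. \<Sum>i\<in>UNIV. moment v1 $ i * partial_deriv i (G1 \<mu> t) x)
      (\<lambda>\<xi>. \<Sum>i\<in>UNIV. complex_of_real (moment v1 $ i) * (\<i> * complex_of_real (\<xi> $ i) * ?s1 \<xi>))"
  proof (intro has_l2_fourier_sum has_l2_fourier_cmult)
    fix i :: 'n
    show "has_l2_fourier (partial_deriv i (G1 \<mu> t)) (\<lambda>\<xi>. \<i> * complex_of_real (\<xi> $ i) * ?s1 \<xi>)"
      unfolding G1_eq partial_deriv_inv_fourier[OF gdecay_sym1[OF mt]]
      by (intro has_l2_fourier_inverse gdecay_coord gdecay_sym1 mt continuous_intros isCont_sym1) auto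
  qed auto
  have 2: "has_l2_fourier (laplacian (laplacian (G0 \<mu> t)))
      (\<lambda>\<xi>::real^'n. - complex_of_real ((norm \<xi>)\<^sup>2) * (- complex_of_real ((norm \<xi>)\<^sup>2) * ?s0 \<xi>))"
    unfolding G0_eq laplacian_inv_fourier(1)[OF gdecay_sym0[OF mt]]
      laplacian_inv_fourier(1)[OF laplacian_inv_fourier(2)[OF gdecay_sym0[OF mt]]]
    by (intro has_l2_fourier_inverse laplacian_inv_fourier(2) gdecay_sym0 mt continuous_intros isCont_sym0) auto
  have "has_l2_fourier (\<lambda>x. mass v0 * G0 \<mu> t x - (\<Sum>i\<in>UNIV. moment v1 $ i * partial_deriv i (G1 \<mu> t) x)
      - (t / 8 * mass v1) * laplacian (laplacian (G0 \<mu> t)) x)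
    (\<lambda>\<xi>::real^'n. complex_of_real (mass v0) * ?s0 \<xi> - (\<Sum>i\<in>UNIV. complex_of_real (moment v1 $ i) * (\<i> * complex_of_real (\<xi> $ i) * ?s1 \<xi>))
      - complex_of_real (t / 8 * mass v1) * (- complex_of_real ((norm \<xi>)\<^sup>2) * (- complex_of_real ((norm \<xi>)\<^sup>2) * ?s0 \<xi>)))"
    by (intro has_l2_fourier_diff has_l2_fourier_cmult 0 1 2)
  moreover have "mass v0 * G0 \<mu> t x - (\<Sum>i\<in>UNIV. moment v1 $ i * partial_deriv i (G1 \<mu> t) x)
      - (t / 8 * mass v1) * laplacian (laplacian (G0 \<mu> t)) x = profile2 \<mu> v0 v1 t x" for x :: "real^'n"
    unfolding profile2_def gradient_def inner_vec_def by (simp add: mult_ac)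
  moreover have "complex_of_real (mass v0) * ?s0 \<xi> - (\<Sum>i\<in>UNIV. complex_of_real (moment v1 $ i) * (\<i> * complex_of_real (\<xi> $ i) * ?s1 \<xi>))
      - complex_of_real (t / 8 * mass v1) * (- complex_of_real ((norm \<xi>)\<^sup>2) * (- complex_of_real ((norm \<xi>)\<^sup>2) * ?s0 \<xi>))
     = phat2 \<mu> (mass v0) (mass v1) (moment v1) t \<xi>" for \<xi> :: "real^'n"
  proof -
    have "(\<Sum>i\<in>UNIV. complex_of_real (moment v1 $ i) * (\<i> * complex_of_real (\<xi> $ i) * ?s1 \<xi>))
        = \<i> * complex_of_real ((\<xi> \<bullet> moment v1) * sym1 \<mu> t (norm \<xi>))"
      unfolding inner_vec_def of_real_mult of_real_sum sum_distrib_right sum_distrib_left by (simp add: mult_ac)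
    moreover have "(norm \<xi>)\<^sup>2 * (norm \<xi>)\<^sup>2 = norm \<xi> ^ 4" by (simp add: power_add[symmetric])
    then have "- complex_of_real ((norm \<xi>)\<^sup>2) * (- complex_of_real ((norm \<xi>)\<^sup>2) * ?s0 \<xi>) = complex_of_real (norm \<xi> ^ 4) * ?s0 \<xi>"
      by (simp only: mult.assoc[symmetric] minus_mult_minus of_real_mult[symmetric])
    ultimately show ?thesis unfolding phat2_def by (simp only:) (simp add: algebra_simps)
  qed
  ultimately show ?thesis by (simp only:)
qed

section \<open>Fourier transforms of the data near the origin\<close>

lemma L1D: "g \<in> L1 \<Longrightarrow> integrable lborel g"
  by (simp add: L1_def)

lemma L11D:
  assumes "g \<in> L11"
  shows "integrable lborel g" "integrable lborel (\<lambda>x. (1 + norm x) * \<bar>g x\<bar>)"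
    "integrable lborel (\<lambda>x. norm x * \<bar>g x\<bar>)" "integrable lborel (\<lambda>x. g x *\<^sub>R x)"
    "(LINT x|lborel. norm x * \<bar>g x\<bar>) \<le> L11_norm g" "\<bar>mass g\<bar> \<le> L11_norm g" "0 \<le> L11_norm g"
proof -
  show i: "integrable lborel g" "integrable lborel (\<lambda>x. (1 + norm x) * \<bar>g x\<bar>)"
    using assms by (auto simp: L11_def L1_def)
  have [measurable]: "g \<in> borel_measurable borel" using borel_measurable_integrable[OF i(1)] by simp
  have "integrable lborel (\<lambda>x. (1 + norm x) * \<bar>g x\<bar> - \<bar>g x\<bar>)"
    using i by (intro Bochner_Integration.integrable_diff) auto
  then show n: "integrable lborel (\<lambda>x. norm x * \<bar>g x\<bar>)" by (simp add: algebra_simps)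
  show "integrable lborel (\<lambda>x. g x *\<^sub>R x)"
    by (rule Bochner_Integration.integrable_bound[OF n]) (auto simp: mult.commute)
  show "(LINT x|lborel. norm x * \<bar>g x\<bar>) \<le> L11_norm g"
    unfolding L11_norm_def using n i by (intro integral_mono) (auto simp: mult_right_mono)
  have "\<bar>mass g\<bar> \<le> (LINT x|lborel. \<bar>g x\<bar>)"
    unfolding mass_def using integral_norm_bound[of lborel g] by simp
  also have "\<dots> \<le> L11_norm g"
    unfolding L11_norm_def using i by (intro integral_mono) (auto simp: mult_le_cancel_right1)
  finally show "\<bar>mass g\<bar> \<le> L11_norm g" .
  then show "0 \<le> L11_norm g" by linarith
qed

lemma fourier_bound: "cmod (fourier g \<xi>) \<le> L1_norm g"
  unfolding fourier_eq_cfourier L1_norm_def using cfourier_bound[of "\<lambda>x. complex_of_real (g x)" \<xi>] by simp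

lemma L1_norm_nonneg: "0 \<le> L1_norm g"
  unfolding L1_norm_def by (intro Bochner_Integration.integral_nonneg) auto

lemma fourier_tendsto_mass:
  fixes g :: "real^'n \<Rightarrow> real"
  assumes g: "integrable lborel g" and c: "(c \<longlongrightarrow> 0) at_top"
  shows "((\<lambda>t. fourier g (c t *\<^sub>R \<eta>)) \<longlongrightarrow> complex_of_real (mass g)) (at_top :: real filter)"
proof -
  have [measurable]: "g \<in> borel_measurable borel" using borel_measurable_integrable[OF g] by simp
  have "((\<lambda>t. LINT x|lborel. cis (- (x \<bullet> (c t *\<^sub>R \<eta>))) * complex_of_real (g x)) \<longlongrightarrow> (LINT x|lborel. complex_of_real (g x))) at_top"
  proof (rule integral_dominated_convergence_at_top[where w="\<lambda>x. \<bar>g x\<bar>"])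
    have "((\<lambda>t. cis (- (x \<bullet> (c t *\<^sub>R \<eta>))) * complex_of_real (g x)) \<longlongrightarrow> cis (- (x \<bullet> (0 *\<^sub>R \<eta>))) * complex_of_real (g x)) at_top" for x
      by (intro tendsto_intros c)
    then show "AE x in lborel. ((\<lambda>t. cis (- (x \<bullet> (c t *\<^sub>R \<eta>))) * complex_of_real (g x)) \<longlongrightarrow> complex_of_real (g x)) at_top"
      by simp
  qed (use g in \<open>auto simp: norm_mult\<close>)
  then show ?thesis unfolding fourier_def mass_def by simp
qed

lemma cis_difference_quotient_at: "((\<lambda>h. (cis (h * b) - 1) / complex_of_real h) \<longlongrightarrow> \<i> * complex_of_real b) (at 0)"
  unfolding tendsto_at_iff_sequentially comp_def using cis_difference_quotient by auto

text \<open>The first claim is quantitative and compensates the factor \<open>1 / r\<close> of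
  \<open>K1_hat\<close> in the upper bound. The second is all that a single moment yields for the
  first-order expansion: dominated convergence, hence no rate.\<close>

lemma fourier_first_order:
  fixes g :: "real^'n \<Rightarrow> real"
  assumes g: "g \<in> L11"
  shows "cmod (fourier g \<xi> - complex_of_real (mass g)) \<le> norm \<xi> * L11_norm g"
    and "(c \<longlongrightarrow> 0) at_top \<Longrightarrow> (\<And>t. t > 0 \<Longrightarrow> c t > 0) \<Longrightarrow>
      ((\<lambda>t. (fourier g (c t *\<^sub>R \<eta>) - complex_of_real (mass g) + \<i> * complex_of_real ((c t *\<^sub>R \<eta>) \<bullet> moment g)) / complex_of_real (c t))
        \<longlongrightarrow> 0) (at_top :: real filter)"
proof -
  note g' = L11D[OF g]
  have [measurable]: "g \<in> borel_measurable borel" using borel_measurable_integrable[OF g'(1)] by simp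
  have gi: "integrable lborel (\<lambda>x. complex_of_real (g x))" using g' by (simp add: complex_of_real_integrable_eq)
  have ci: "integrable lborel (\<lambda>x. cis (- (x \<bullet> \<xi>)) * complex_of_real (g x))" for \<xi>
    by (intro integrable_cis_mult gi) measurable
  have e1: "fourier g \<xi> - complex_of_real (mass g) = (LINT x|lborel. (cis (- (x \<bullet> \<xi>)) - 1) * complex_of_real (g x))" for \<xi>
    unfolding fourier_def mass_def integral_complex_of_real[symmetric] left_diff_distrib
    using ci gi by (subst Bochner_Integration.integral_diff) auto
  have b1: "cmod ((cis (- (x \<bullet> \<xi>)) - 1) * complex_of_real (g x)) \<le> norm \<xi> * (norm x * \<bar>g x\<bar>)" for x \<xi>
  proof -
    have "cmod (cis (- (x \<bullet> \<xi>)) - 1) \<le> norm x * norm \<xi>"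
      using cmod_cis_minus_1[of "- (x \<bullet> \<xi>)"] Cauchy_Schwarz_ineq2[of x \<xi>] by simp
    then have "cmod (cis (- (x \<bullet> \<xi>)) - 1) * \<bar>g x\<bar> \<le> norm x * norm \<xi> * \<bar>g x\<bar>"
      by (rule mult_right_mono) simp
    then show ?thesis by (simp add: norm_mult mult_ac)
  qed
  have i1: "integrable lborel (\<lambda>x. (cis (- (x \<bullet> \<xi>)) - 1) * complex_of_real (g x))" for \<xi>
    unfolding left_diff_distrib using ci gi by auto
  have "cmod (fourier g \<xi> - complex_of_real (mass g)) \<le> (LINT x|lborel. norm \<xi> * (norm x * \<bar>g x\<bar>))"
    unfolding e1 using g'(3) b1 i1 by (intro Bochner_Integration.integral_norm_bound_integral) auto
  also have "\<dots> \<le> norm \<xi> * L11_norm g" using g'(5) by (simp add: mult_left_mono)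
  finally show "cmod (fourier g \<xi> - complex_of_real (mass g)) \<le> norm \<xi> * L11_norm g" .
  assume c: "(c \<longlongrightarrow> 0) at_top" "\<And>t. t > 0 \<Longrightarrow> c t > 0"
  have mi: "integrable lborel (\<lambda>x. g x * (x \<bullet> \<eta>))"
    using integrable_inner_left[OF g'(4), of \<eta>] by simp
  have mom: "\<eta> \<bullet> moment g = (LINT x|lborel. g x * (x \<bullet> \<eta>))"
    unfolding moment_def using integral_inner_left[OF g'(4), of \<eta>] by (simp add: inner_commute)
  have e2: "(fourier g (c t *\<^sub>R \<eta>) - complex_of_real (mass g) + \<i> * complex_of_real ((c t *\<^sub>R \<eta>) \<bullet> moment g)) / complex_of_real (c t)
     = (LINT x|lborel. (cis (- (x \<bullet> (c t *\<^sub>R \<eta>))) - 1) * complex_of_real (g x) / complex_of_real (c t) + \<i> * complex_of_real (g x * (x \<bullet> \<eta>)))"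
    if "t > 0" for t
  proof -
    have "(LINT x|lborel. (cis (- (x \<bullet> (c t *\<^sub>R \<eta>))) - 1) * complex_of_real (g x) / complex_of_real (c t) + \<i> * complex_of_real (g x * (x \<bullet> \<eta>)))
      = (LINT x|lborel. (cis (- (x \<bullet> (c t *\<^sub>R \<eta>))) - 1) * complex_of_real (g x)) / complex_of_real (c t) + \<i> * complex_of_real (\<eta> \<bullet> moment g)"
      unfolding mom using i1[of "c t *\<^sub>R \<eta>"] mi
      by (subst Bochner_Integration.integral_add) (auto simp: complex_of_real_integrable_eq simp del: of_real_mult)
    then show ?thesis unfolding e1 using c(2)[OF that] by (simp add: add_divide_distrib)
  qed
  have "((\<lambda>t. (LINT x|lborel. (cis (- (x \<bullet> (c t *\<^sub>R \<eta>))) - 1) * complex_of_real (g x) / complex_of_real (c t) + \<i> * complex_of_real (g x * (x \<bullet> \<eta>))))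
      \<longlongrightarrow> (LINT x|(lborel :: (real^'n) measure). 0)) at_top"
  \<comment> \<open>One copy of the majorant bounds the difference quotient, the other the
    subtracted limit.\<close>
  proof (rule integral_dominated_convergence_at_top[where w="\<lambda>x. 2 * (norm \<eta> * (norm x * \<bar>g x\<bar>))"])
    have cf: "filterlim c (at 0) at_top"
    proof -
      have "\<forall>\<^sub>F t in at_top. c t \<noteq> 0"
        using eventually_gt_at_top[of "0::real"] by eventually_elim (use c(2) in force)
      then show ?thesis using c(1) by (simp add: filterlim_at)
    qed
    show "AE x in lborel. ((\<lambda>t. (cis (- (x \<bullet> (c t *\<^sub>R \<eta>))) - 1) * complex_of_real (g x) / complex_of_real (c t) + \<i> * complex_of_real (g x * (x \<bullet> \<eta>))) \<longlongrightarrow> 0) at_top"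
    proof (intro AE_I2)
      fix x :: "real^'n"
      have "((\<lambda>t. (cis (c t * (- (x \<bullet> \<eta>))) - 1) / complex_of_real (c t) * complex_of_real (g x) + \<i> * complex_of_real (g x * (x \<bullet> \<eta>)))
          \<longlongrightarrow> \<i> * complex_of_real (- (x \<bullet> \<eta>)) * complex_of_real (g x) + \<i> * complex_of_real (g x * (x \<bullet> \<eta>))) at_top"
        by (intro tendsto_intros filterlim_compose[OF cis_difference_quotient_at cf])
      then show "((\<lambda>t. (cis (- (x \<bullet> (c t *\<^sub>R \<eta>))) - 1) * complex_of_real (g x) / complex_of_real (c t) + \<i> * complex_of_real (g x * (x \<bullet> \<eta>))) \<longlongrightarrow> 0) at_top"
        by (simp add: mult_ac)
    qed
    show "\<forall>\<^sub>F t in at_top. AE x in lborel. norm ((cis (- (x \<bullet> (c t *\<^sub>R \<eta>))) - 1) * complex_of_real (g x) / complex_of_real (c t) + \<i> * complex_of_real (g x * (x \<bullet> \<eta>)))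
        \<le> 2 * (norm \<eta> * (norm x * \<bar>g x\<bar>))"
      using eventually_gt_at_top[of "0::real"]
    proof eventually_elim
      case (elim t)
      show ?case
      proof (intro AE_I2)
        fix x :: "real^'n"
        have ct: "c t > 0" using c(2) elim by simp
        have "cmod ((cis (- (x \<bullet> (c t *\<^sub>R \<eta>))) - 1) * complex_of_real (g x)) / c t \<le> norm (c t *\<^sub>R \<eta>) * (norm x * \<bar>g x\<bar>) / c t"
          by (rule divide_right_mono[OF b1 less_imp_le[OF ct]])
        also have "\<dots> = norm \<eta> * (norm x * \<bar>g x\<bar>)" using ct by simp
        finally have "cmod ((cis (- (x \<bullet> (c t *\<^sub>R \<eta>))) - 1) * complex_of_real (g x) / complex_of_real (c t)) \<le> norm \<eta> * (norm x * \<bar>g x\<bar>)"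
          using ct by (simp add: norm_divide)
        moreover have "cmod (\<i> * complex_of_real (g x * (x \<bullet> \<eta>))) \<le> norm \<eta> * (norm x * \<bar>g x\<bar>)"
          using mult_right_mono[OF Cauchy_Schwarz_ineq2[of x \<eta>], of "\<bar>g x\<bar>"] by (simp add: norm_mult abs_mult mult_ac)
        ultimately show "norm ((cis (- (x \<bullet> (c t *\<^sub>R \<eta>))) - 1) * complex_of_real (g x) / complex_of_real (c t) + \<i> * complex_of_real (g x * (x \<bullet> \<eta>)))
            \<le> 2 * (norm \<eta> * (norm x * \<bar>g x\<bar>))"
          using norm_triangle_ineq[of "(cis (- (x \<bullet> (c t *\<^sub>R \<eta>))) - 1) * complex_of_real (g x) / complex_of_real (c t)" "\<i> * complex_of_real (g x * (x \<bullet> \<eta>))"]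
          by linarith
      qed
    qed
  qed (use g'(3) in auto)
  then have "((\<lambda>t. (LINT x|lborel. (cis (- (x \<bullet> (c t *\<^sub>R \<eta>))) - 1) * complex_of_real (g x) / complex_of_real (c t) + \<i> * complex_of_real (g x * (x \<bullet> \<eta>))))
      \<longlongrightarrow> 0) at_top" by simp
  then show "((\<lambda>t. (fourier g (c t *\<^sub>R \<eta>) - complex_of_real (mass g) + \<i> * complex_of_real ((c t *\<^sub>R \<eta>) \<bullet> moment g)) / complex_of_real (c t))
        \<longlongrightarrow> 0) at_top"
    by (rule Lim_transform_eventually) (use e2 in \<open>auto intro!: eventually_mono[OF eventually_gt_at_top[of "0::real"]]\<close>)
qed

section \<open>Parabolic scaling\<close>

text \<open>The Jacobian contributes \<open>c ^ CARD('n)\<close> and the weight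
  \<open>c powr (2 * s)\<close>; together they are the rate of the squared norm, whose square root
  is the rate in the theorem.\<close>

lemma scaled_weighted_integral:
  fixes h :: "real^'n \<Rightarrow> real"
  assumes [measurable]: "h \<in> borel_measurable borel" and t: "0 < t"
  defines "c \<equiv> t powr (- 1 / 4)"
  shows "(LINT \<xi>|lborel. norm \<xi> powr (2 * s) * h \<xi>)
      = t powr (- (2 * s + real CARD('n)) / 4) * (LINT \<eta>|lborel. norm \<eta> powr (2 * s) * h (c *\<^sub>R \<eta>))"
    and "integrable lborel (\<lambda>\<xi>. norm \<xi> powr (2 * s) * h \<xi>) \<longleftrightarrow>
      integrable lborel (\<lambda>\<eta>. norm \<eta> powr (2 * s) * h (c *\<^sub>R \<eta>))"
proof -
  have c: "c > 0" using t by (simp add: c_def)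
  have eq: "norm (0 + c *\<^sub>R \<eta>) powr (2 * s) * h (0 + c *\<^sub>R \<eta>) = c powr (2 * s) * (norm \<eta> powr (2 * s) * h (c *\<^sub>R \<eta>))" for \<eta>
    using c by (simp add: powr_mult)
  have "(LINT \<xi>|lborel. norm \<xi> powr (2 * s) * h \<xi>)
      = \<bar>c\<bar> ^ DIM(real^'n) *\<^sub>R (LINT \<eta>|lborel. norm (0 + c *\<^sub>R \<eta>) powr (2 * s) * h (0 + c *\<^sub>R \<eta>))"
    using c by (intro lborel_integral_affine) auto
  also have "\<dots> = (c ^ CARD('n) * c powr (2 * s)) * (LINT \<eta>|lborel. norm \<eta> powr (2 * s) * h (c *\<^sub>R \<eta>))"
    unfolding eq using c by simp
  also have "c ^ CARD('n) * c powr (2 * s) = t powr (- (2 * s + real CARD('n)) / 4)"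
    using c t unfolding powr_realpow[OF c, symmetric] powr_add[symmetric] unfolding c_def powr_powr
    by (intro arg_cong[where f="(powr) t"]) (simp add: field_simps)
  finally show "(LINT \<xi>|lborel. norm \<xi> powr (2 * s) * h \<xi>)
      = t powr (- (2 * s + real CARD('n)) / 4) * (LINT \<eta>|lborel. norm \<eta> powr (2 * s) * h (c *\<^sub>R \<eta>))" .
  have "integrable lborel (\<lambda>\<xi>. norm \<xi> powr (2 * s) * h \<xi>) \<longleftrightarrow>
      integrable lborel (\<lambda>\<eta>. norm (0 + c *\<^sub>R \<eta>) powr (2 * s) * h (0 + c *\<^sub>R \<eta>))"
    using c by (intro lborel_integrable_affine_iff[symmetric]) auto
  also have "\<dots> \<longleftrightarrow> integrable lborel (\<lambda>\<eta>. norm \<eta> powr (2 * s) * h (c *\<^sub>R \<eta>))"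
    unfolding eq using c by simp
  finally show "integrable lborel (\<lambda>\<xi>. norm \<xi> powr (2 * s) * h \<xi>) \<longleftrightarrow>
      integrable lborel (\<lambda>\<eta>. norm \<eta> powr (2 * s) * h (c *\<^sub>R \<eta>))" .
qed

lemma scale_power4: "0 < (t::real) \<Longrightarrow> (t powr (- 1 / 4) * r) ^ 4 * t = r ^ 4"
proof -
  assume t: "0 < t"
  have "(t powr (- 1 / 4)) ^ 4 = t powr (- 1)"
    using t by (simp add: powr_realpow[symmetric] powr_powr)
  then show ?thesis using t by (simp add: power_mult_distrib powr_minus field_simps)
qed

text \<open>A common majorant in the scaling-invariant variable \<open>q = r ^ 4 * t\<close>: the
  exponential is the damping, the factor \<open>1 + q\<close> admits the secular terms
  \<open>t * r ^ 4\<close> of the expansions.\<close>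

definition psi :: "real \<Rightarrow> real \<Rightarrow> real" where
  "psi \<mu> q = (1 + q) * exp (- \<mu> * q)"

text \<open>Half of the exponential rate absorbs the linear factor.\<close>

lemma psi_le: "0 < \<mu> \<Longrightarrow> 0 \<le> q \<Longrightarrow> psi \<mu> q \<le> (1 + 2 / \<mu>) * exp (- (\<mu> / 2) * q)"
proof -
  assume \<mu>: "0 < \<mu>" and q: "0 \<le> q"
  have "\<mu> / 2 * q \<le> exp (\<mu> / 2 * q)" "1 \<le> exp (\<mu> / 2 * q)"
    using exp_ge_add_one_self[of "\<mu> / 2 * q"] \<mu> q by (linarith, simp)
  note E = this
  have "2 / \<mu> * (\<mu> / 2 * q) \<le> 2 / \<mu> * exp (\<mu> / 2 * q)"
    by (rule mult_left_mono[OF E(1)]) (use \<mu> in simp)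
  moreover have "2 / \<mu> * (\<mu> / 2 * q) = q" using \<mu> by simp
  ultimately have "1 + q \<le> (1 + 2 / \<mu>) * exp (\<mu> / 2 * q)"
    unfolding distrib_right using E(2) by linarith
  then have "psi \<mu> q \<le> (1 + 2 / \<mu>) * exp (\<mu> / 2 * q) * exp (- \<mu> * q)"
    unfolding psi_def by (rule mult_right_mono) simp
  also have "\<dots> = (1 + 2 / \<mu>) * exp (- (\<mu> / 2) * q)"
    unfolding mult.assoc exp_add[symmetric] by simp
  finally show ?thesis .
qed

lemma powr_le_exp: "0 \<le> x \<Longrightarrow> 0 \<le> p \<Longrightarrow> x powr p \<le> exp (p\<^sup>2) * exp (x\<^sup>2)" for x :: real
proof (cases "x = 0")
  case False
  assume "0 \<le> x" "0 \<le> p"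
  then have x: "x > 0" using False by simp
  have "p * ln x \<le> p * x" using ln_less_self[OF x] \<open>0 \<le> p\<close> by (intro mult_left_mono) auto
  also have "p * x \<le> p\<^sup>2 + x\<^sup>2" using sum_squares_bound[of p x] mult_nonneg_nonneg[of p x] \<open>0 \<le> p\<close> x by linarith
  finally show ?thesis using x by (simp add: powr_def exp_add[symmetric])
qed simp

lemma psi_weight_integrable:
  assumes \<mu>: "0 < \<mu>" and s: "0 \<le> s"
  shows "integrable lborel (\<lambda>\<eta>::real^'n. norm \<eta> powr (2 * s) * (psi \<mu> (norm \<eta> ^ 4))\<^sup>2)"
proof -
  \<comment> \<open>Rate 2 is chosen because \<open>powr_le_exp\<close> spends
    \<open>exp ((norm \<eta>)\<^sup>2)\<close> on the weight; a Gaussian of rate 1 is left.\<close>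
  obtain C where C: "C \<ge> 0" "\<And>\<xi>::real^'n. cmod (complex_of_real (exp (- \<mu> * norm \<xi> ^ 4))) \<le> C * exp (- 2 * (norm \<xi>)\<^sup>2)"
    using gdecayD[OF gdecay_exp4[OF \<mu>, where 'a="real^'n"]] by metis
  define K where "K = exp ((2 * s)\<^sup>2) * ((1 + 2 / \<mu>)\<^sup>2 * C)"
  have b: "norm \<eta> powr (2 * s) * (psi \<mu> (norm \<eta> ^ 4))\<^sup>2 \<le> K * exp (- 1 * (norm \<eta>)\<^sup>2)" for \<eta> :: "real^'n"
  proof -
    have "0 \<le> psi \<mu> (norm \<eta> ^ 4)" by (simp add: psi_def)
    then have "(psi \<mu> (norm \<eta> ^ 4))\<^sup>2 \<le> ((1 + 2 / \<mu>) * exp (- (\<mu> / 2) * norm \<eta> ^ 4))\<^sup>2"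
      by (intro power_mono psi_le \<mu>) auto
    also have "\<dots> = (1 + 2 / \<mu>)\<^sup>2 * exp (- \<mu> * norm \<eta> ^ 4)"
      by (simp add: power_mult_distrib exp_double[symmetric])
    also have "\<dots> \<le> (1 + 2 / \<mu>)\<^sup>2 * (C * exp (- 2 * (norm \<eta>)\<^sup>2))"
      using C(2)[of \<eta>] by (intro mult_left_mono) auto
    finally have "norm \<eta> powr (2 * s) * (psi \<mu> (norm \<eta> ^ 4))\<^sup>2
        \<le> (exp ((2 * s)\<^sup>2) * exp ((norm \<eta>)\<^sup>2)) * ((1 + 2 / \<mu>)\<^sup>2 * (C * exp (- 2 * (norm \<eta>)\<^sup>2)))"
      using s by (intro mult_mono powr_le_exp) auto
    also have "\<dots> = K * (exp ((norm \<eta>)\<^sup>2) * exp (- 2 * (norm \<eta>)\<^sup>2))" by (simp add: K_def)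
    also have "\<dots> = K * exp (- 1 * (norm \<eta>)\<^sup>2)" unfolding exp_add[symmetric] by simp
    finally show ?thesis .
  qed
  have i: "integrable lborel (\<lambda>\<eta>::real^'n. K * exp (- 1 * (norm \<eta>)\<^sup>2))"
    by (intro integrable_mult_right integrable_exp_norm2) auto
  show ?thesis
  proof (rule Bochner_Integration.integrable_bound[OF i])
    show "(\<lambda>\<eta>::real^'n. norm \<eta> powr (2 * s) * (psi \<mu> (norm \<eta> ^ 4))\<^sup>2) \<in> borel_measurable lborel"
      unfolding psi_def by measurable
    show "AE \<eta> in lborel. norm (norm \<eta> powr (2 * s) * (psi \<mu> (norm (\<eta>::real^'n) ^ 4))\<^sup>2) \<le> norm (K * exp (- 1 * (norm \<eta>)\<^sup>2))"
      using b C(1) by (intro AE_I2) (auto simp: abs_mult K_def)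
  qed
qed

lemma psi_mono_factor: "0 \<le> q \<Longrightarrow> exp (- \<mu> * q) \<le> psi \<mu> q" "0 \<le> q \<Longrightarrow> q * exp (- \<mu> * q) \<le> psi \<mu> q"
  "0 \<le> q \<Longrightarrow> 0 \<le> psi \<mu> q"
  by (auto simp: psi_def distrib_right)

section \<open>Pointwise bounds for the errors\<close>

definition vhat :: "real \<Rightarrow> (real^'n \<Rightarrow> real) \<Rightarrow> (real^'n \<Rightarrow> real) \<Rightarrow> real \<Rightarrow> real^'n \<Rightarrow> complex" where
  "vhat \<mu> v0 v1 t \<xi> = K0_hat \<mu> t \<xi> * fourier v0 \<xi> + K1_hat \<mu> t \<xi> * fourier v1 \<xi>"

definition err1 :: "real \<Rightarrow> (real^'n \<Rightarrow> real) \<Rightarrow> (real^'n \<Rightarrow> real) \<Rightarrow> real \<Rightarrow> real^'n \<Rightarrow> complex" where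
  "err1 \<mu> v0 v1 t \<xi> = vhat \<mu> v0 v1 t \<xi> - complex_of_real (mass v1 * sym1 \<mu> t (norm \<xi>))"

definition err2 :: "real \<Rightarrow> (real^'n \<Rightarrow> real) \<Rightarrow> (real^'n \<Rightarrow> real) \<Rightarrow> real \<Rightarrow> real^'n \<Rightarrow> complex" where
  "err2 \<mu> v0 v1 t \<xi> = err1 \<mu> v0 v1 t \<xi> - phat2 \<mu> (mass v0) (mass v1) (moment v1) t \<xi>"

text \<open>\<open>csqrt\<close> jumps across the negative real axis, where the discriminant lives
  at low frequency. Rewriting it by cases through real square roots makes measurability
  evident.\<close>

lemma kernels_meas [measurable]:
  "(\<lambda>\<xi>::real^'n. K0_hat \<mu> t \<xi>) \<in> borel_measurable borel"
  "(\<lambda>\<xi>::real^'n. K1_hat \<mu> t \<xi>) \<in> borel_measurable borel"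
proof -
  have c: "csqrt (complex_of_real d) = (if d < 0 then \<i> * complex_of_real (sqrt (- d)) else complex_of_real (sqrt d))" for d
    using csqrt_real_neg[of d] csqrt_real_pos[of d] by simp
  have [measurable]: "(\<lambda>\<xi>::real^'n. lam_plus \<mu> (norm \<xi>)) \<in> borel_measurable borel"
    "(\<lambda>\<xi>::real^'n. lam_minus \<mu> (norm \<xi>)) \<in> borel_measurable borel"
    unfolding lam_plus_def lam_minus_def c by measurable
  show "(\<lambda>\<xi>::real^'n. K0_hat \<mu> t \<xi>) \<in> borel_measurable borel"
    "(\<lambda>\<xi>::real^'n. K1_hat \<mu> t \<xi>) \<in> borel_measurable borel"
    unfolding K0_hat_def K1_hat_def Let_def by measurable
qed

lemma err_meas:
  assumes [measurable]: "v0 \<in> borel_measurable borel" "v1 \<in> borel_measurable borel"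
  shows "vhat \<mu> v0 v1 t \<in> borel_measurable borel"
    "err1 \<mu> v0 v1 t \<in> borel_measurable borel" "err2 \<mu> v0 v1 t \<in> borel_measurable borel"
  unfolding vhat_def [abs_def] err1_def [abs_def] err2_def [abs_def] by measurable

definition hf_rate :: "real \<Rightarrow> real \<Rightarrow> real" where
  "hf_rate \<mu> t = (1 + 2 / \<mu> + 3 / \<mu>\<^sup>2) * (1 + t) * exp (- min \<mu> (1 / (2 * \<mu>)) * t)"

text \<open>The exponent for \<open>v1\<close> is what remains of the weight of order
  \<open>s\<close> after \<open>K1_hat\<close> has contributed \<open>1 / norm \<xi>\<close>; its
  integral is controlled by the square of \<open>data_norm\<close>.\<close>

definition hf_data :: "real \<Rightarrow> (real^'n \<Rightarrow> real) \<Rightarrow> (real^'n \<Rightarrow> real) \<Rightarrow> real^'n \<Rightarrow> real" where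
  "hf_data s v0 v1 \<xi> = (1 + (norm \<xi>)\<^sup>2) powr s * (cmod (fourier v0 \<xi>))\<^sup>2
     + (1 + (norm \<xi>)\<^sup>2) powr (max (s - 1) 0) * (cmod (fourier v1 \<xi>))\<^sup>2"

lemma square_diff_le: "(cmod (x - y))\<^sup>2 \<le> 2 * (cmod x)\<^sup>2 + 2 * (cmod y)\<^sup>2"
proof -
  have "(cmod (x - y))\<^sup>2 \<le> (cmod x + cmod y)\<^sup>2" by (intro power_mono norm_triangle_ineq4) auto
  then show ?thesis using sum_squares_bound[of "cmod x" "cmod y"] by (simp add: power2_sum)
qed

lemma phat2_bound:
  fixes \<xi> :: "real^'n"
  assumes t: "0 \<le> t"
  shows "cmod (phat2 \<mu> P0 P1 M t \<xi>) \<le> (\<bar>P0\<bar> + \<bar>P1\<bar> + norm M) * psi \<mu> (norm \<xi> ^ 4 * t)"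
proof -
  define r where "r = norm \<xi>"
  define e where "e = exp (- \<mu> * r ^ 4 * t)"
  define q where "q = r ^ 4 * t"
  have q: "0 \<le> q" using t by (simp add: q_def r_def)
  have P: "psi \<mu> q = (1 + q) * e" by (simp add: psi_def e_def q_def mult.assoc)
  have e0: "0 < e" by (simp add: e_def)
  have "\<bar>sym0 \<mu> t r * (P0 - t / 8 * r ^ 4 * P1)\<bar> \<le> e * (\<bar>P0\<bar> + q * \<bar>P1\<bar>)"
  proof -
    have "\<bar>P0 - t / 8 * r ^ 4 * P1\<bar> \<le> \<bar>P0\<bar> + \<bar>t / 8 * r ^ 4 * P1\<bar>" by (rule abs_triangle_ineq4)
    also have "\<bar>t / 8 * r ^ 4 * P1\<bar> = q / 8 * \<bar>P1\<bar>" using t by (simp add: q_def abs_mult r_def)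
    also have "q / 8 * \<bar>P1\<bar> \<le> q * \<bar>P1\<bar>" using q by (intro mult_right_mono) auto
    finally show ?thesis unfolding abs_mult[of "sym0 _ _ _"] e_def
      using abs_sym0_le[of \<mu> t r] by (intro mult_mono) auto
  qed
  moreover have "\<bar>(\<xi> \<bullet> M) * sym1 \<mu> t r\<bar> \<le> norm M * e"
  proof -
    have "\<bar>(\<xi> \<bullet> M) * sym1 \<mu> t r\<bar> \<le> (r * norm M) * \<bar>sym1 \<mu> t r\<bar>"
      unfolding abs_mult r_def by (intro mult_right_mono Cauchy_Schwarz_ineq2) auto
    also have "\<dots> = norm M * (r * \<bar>sym1 \<mu> t r\<bar>)" by simp
    also have "\<dots> \<le> norm M * e" unfolding e_def by (intro mult_left_mono abs_sym1_le) (auto simp: r_def)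
    finally show ?thesis .
  qed
  ultimately have "cmod (phat2 \<mu> P0 P1 M t \<xi>) \<le> e * (\<bar>P0\<bar> + q * \<bar>P1\<bar>) + norm M * e"
    unfolding phat2_def r_def[symmetric]
    by (intro order.trans[OF norm_triangle_ineq4] add_mono) (simp_all only: norm_mult norm_of_real norm_ii mult_1_left)
  also have "\<dots> \<le> (\<bar>P0\<bar> + \<bar>P1\<bar> + norm M) * ((1 + q) * e)"
  proof -
    have "0 \<le> q * e * \<bar>P0\<bar>" "0 \<le> q * e * norm M" "0 \<le> e * \<bar>P1\<bar>" using q e0 by simp_all
    then show ?thesis by (simp add: algebra_simps)
  qed
  finally show ?thesis unfolding P[symmetric] unfolding q_def r_def .
qed

context
  fixes v0 v1 :: "real^'n \<Rightarrow> real" and \<mu> :: real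
  assumes v0: "integrable lborel v0" and v1: "v1 \<in> L11" and \<mu>: "0 < \<mu>" "\<mu> < 1"
begin

lemma err1_low:
  assumes r: "0 < norm \<xi>" "norm \<xi> \<le> 1" and t: "0 \<le> t"
  shows "cmod (err1 \<mu> v0 v1 t \<xi>) \<le> 2 * (L1_norm v0 + L11_norm v1) * psi \<mu> (norm \<xi> ^ 4 * t)"
proof -
  define r where "r = norm \<xi>"
  define e where "e = exp (- \<mu> * r ^ 4 * t)"
  define q where "q = r ^ 4 * t"
  have q: "0 \<le> q" using t by (simp add: q_def r_def)
  note k = kernels_low_frequency[OF \<mu> r t, folded r_def, folded e_def]
  have P: "psi \<mu> q = (1 + q) * e" by (simp add: psi_def e_def q_def mult.assoc)
  have e0: "0 < e" by (simp add: e_def)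
  note N = L11D(6,7)[OF v1] L1_norm_nonneg[of v0]
  \<comment> \<open>Subtracting the mass before applying \<open>K1_hat\<close> is essential: the
    kernel is of size \<open>1 / r\<close>, and only a factor of size \<open>r\<close> makes the
    product bounded.\<close>
  have split: "err1 \<mu> v0 v1 t \<xi> = K0_hat \<mu> t \<xi> * fourier v0 \<xi>
     + (K1_hat \<mu> t \<xi> - complex_of_real (sym1 \<mu> t r)) * complex_of_real (mass v1)
     + K1_hat \<mu> t \<xi> * (fourier v1 \<xi> - complex_of_real (mass v1))"
    unfolding err1_def vhat_def r_def by (simp add: algebra_simps)
  have a: "cmod (K0_hat \<mu> t \<xi> * fourier v0 \<xi>) \<le> (1 + q) * e * L1_norm v0"
    unfolding norm_mult using k(1) fourier_bound[of v0 \<xi>] q e0 by (intro mult_mono) (auto simp: q_def)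
  have b: "cmod ((K1_hat \<mu> t \<xi> - complex_of_real (sym1 \<mu> t r)) * complex_of_real (mass v1)) \<le> (q + 1) * e * L11_norm v1"
  proof -
    have "cmod (K1_hat \<mu> t \<xi> - complex_of_real (sym1 \<mu> t r)) \<le> (q + r) * e"
      using k(4) by (simp add: q_def)
    also have "\<dots> \<le> (q + 1) * e" using r e0 by (intro mult_right_mono) (auto simp: r_def)
    finally show ?thesis unfolding norm_mult norm_of_real using N q e0 by (intro mult_mono) auto
  qed
  have c: "cmod (K1_hat \<mu> t \<xi> * (fourier v1 \<xi> - complex_of_real (mass v1))) \<le> e * L11_norm v1"
  proof -
    have "cmod (K1_hat \<mu> t \<xi>) * cmod (fourier v1 \<xi> - complex_of_real (mass v1)) \<le> (e / r) * (r * L11_norm v1)"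
      using k(3) fourier_first_order(1)[OF v1, of \<xi>] e0 by (intro mult_mono) (auto simp: r_def)
    also have "\<dots> = e * L11_norm v1" using r by (simp add: r_def)
    finally show ?thesis by (simp add: norm_mult)
  qed
  have "cmod (err1 \<mu> v0 v1 t \<xi>) \<le> (1 + q) * e * L1_norm v0 + (q + 1) * e * L11_norm v1 + e * L11_norm v1"
    unfolding split using a b c by (intro norm_triangle_le add_mono)
  also have "\<dots> \<le> 2 * (L1_norm v0 + L11_norm v1) * ((1 + q) * e)"
  proof -
    have "0 \<le> q * e * L1_norm v0" "0 \<le> q * e * L11_norm v1" "0 \<le> e * L1_norm v0" using N q e0 by simp_all
    then show ?thesis by (simp add: algebra_simps)
  qed
  finally show ?thesis unfolding P[symmetric] unfolding q_def r_def .
qed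

lemma hf_data_nonneg: "0 \<le> hf_data s v0 v1 \<xi>"
  by (simp add: hf_data_def)

lemma vhat_high:
  assumes r: "1 \<le> norm \<xi>" and t: "0 \<le> t" and s: "0 \<le> s"
  shows "norm \<xi> powr (2 * s) * (cmod (vhat \<mu> v0 v1 t \<xi>))\<^sup>2 \<le> 2 * (hf_rate \<mu> t)\<^sup>2 * hf_data s v0 v1 \<xi>"
proof -
  define r where "r = norm \<xi>"
  have r1: "1 \<le> r" using assms by (simp add: r_def)
  note k = kernels_high_frequency[OF \<mu>(1) t r, folded hf_rate_def, folded r_def]
  define a where "a = cmod (fourier v0 \<xi>)"
  define b where "b = cmod (fourier v1 \<xi>) / r"
  have "cmod (vhat \<mu> v0 v1 t \<xi>) \<le> hf_rate \<mu> t * a + hf_rate \<mu> t / r * cmod (fourier v1 \<xi>)"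
    using mult_right_mono[OF k(1) norm_ge_zero[of "fourier v0 \<xi>"]] mult_right_mono[OF k(2) norm_ge_zero[of "fourier v1 \<xi>"]]
    unfolding vhat_def a_def by (intro norm_triangle_le add_mono) (simp_all only: norm_mult)
  also have "\<dots> = hf_rate \<mu> t * (a + b)" by (simp add: b_def algebra_simps)
  finally have "(cmod (vhat \<mu> v0 v1 t \<xi>))\<^sup>2 \<le> (hf_rate \<mu> t * (a + b))\<^sup>2" by (intro power_mono) auto
  also have "\<dots> \<le> (hf_rate \<mu> t)\<^sup>2 * (2 * (a\<^sup>2 + b\<^sup>2))"
    unfolding power_mult_distrib using sum_squares_bound[of a b] by (intro mult_left_mono) (auto simp: power2_sum)
  finally have 1: "(cmod (vhat \<mu> v0 v1 t \<xi>))\<^sup>2 \<le> 2 * (hf_rate \<mu> t)\<^sup>2 * (a\<^sup>2 + b\<^sup>2)" by (simp add: algebra_simps)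
  have 2: "r powr (2 * s) * (a\<^sup>2 + b\<^sup>2) \<le> hf_data s v0 v1 \<xi>"
  proof -
    have rr: "r powr (2 * u) = (r\<^sup>2) powr u" for u using r1 by (simp add: powr_powr flip: powr_numeral)
    have A: "r powr (2 * s) \<le> (1 + r\<^sup>2) powr s" unfolding rr using s by (intro powr_mono2) auto
    \<comment> \<open>For \<open>s < 1\<close> the exponent \<open>s - 1\<close> is negative;
      raising it to 0 is allowed because \<open>r \<ge> 1\<close>.\<close>
    have B: "r powr (2 * s) / r\<^sup>2 \<le> (1 + r\<^sup>2) powr (max (s - 1) 0)"
    proof -
      have "r powr (2 * s) / r\<^sup>2 = r powr (2 * (s - 1))" using r1
        by (simp add: powr_diff right_diff_distrib flip: powr_numeral)
      also have "\<dots> \<le> r powr (2 * (max (s - 1) 0))" using r1 by (intro powr_mono mult_left_mono) auto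
      also have "\<dots> \<le> (1 + r\<^sup>2) powr (max (s - 1) 0)" unfolding rr by (intro powr_mono2) auto
      finally show ?thesis .
    qed
    have "r powr (2 * s) * (a\<^sup>2 + b\<^sup>2) = r powr (2 * s) * a\<^sup>2 + (r powr (2 * s) / r\<^sup>2) * (cmod (fourier v1 \<xi>))\<^sup>2"
      by (simp add: b_def power_divide distrib_left)
    also have "\<dots> \<le> hf_data s v0 v1 \<xi>"
      unfolding hf_data_def a_def r_def[symmetric] using A B by (intro add_mono mult_right_mono) auto
    finally show ?thesis .
  qed
  have "r powr (2 * s) * (cmod (vhat \<mu> v0 v1 t \<xi>))\<^sup>2 \<le> r powr (2 * s) * (2 * (hf_rate \<mu> t)\<^sup>2 * (a\<^sup>2 + b\<^sup>2))"
    using 1 by (intro mult_left_mono) auto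
  also have "\<dots> = 2 * (hf_rate \<mu> t)\<^sup>2 * (r powr (2 * s) * (a\<^sup>2 + b\<^sup>2))" by simp
  also have "\<dots> \<le> 2 * (hf_rate \<mu> t)\<^sup>2 * hf_data s v0 v1 \<xi>" using 2 by (intro mult_left_mono) auto
  finally show ?thesis unfolding r_def .
qed

lemma err1_pointwise:
  assumes \<xi>: "\<xi> \<noteq> 0" and t: "0 \<le> t" and s: "0 \<le> s"
  shows "norm \<xi> powr (2 * s) * (cmod (err1 \<mu> v0 v1 t \<xi>))\<^sup>2
     \<le> 4 * (L1_norm v0 + L11_norm v1)\<^sup>2 * (norm \<xi> powr (2 * s) * (psi \<mu> (norm \<xi> ^ 4 * t))\<^sup>2)
       + 4 * (hf_rate \<mu> t)\<^sup>2 * hf_data s v0 v1 \<xi>"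
proof -
  define N where "N = L1_norm v0 + L11_norm v1"
  define p where "p = psi \<mu> (norm \<xi> ^ 4 * t)"
  define w where "w = norm \<xi> powr (2 * s)"
  have w: "0 \<le> w" by (simp add: w_def)
  have h: "0 \<le> 4 * (hf_rate \<mu> t)\<^sup>2 * hf_data s v0 v1 \<xi>" by (simp add: hf_data_nonneg)
  show ?thesis unfolding N_def[symmetric] p_def[symmetric] w_def[symmetric]
  proof (cases "norm \<xi> \<le> 1")
    case True
    have "(cmod (err1 \<mu> v0 v1 t \<xi>))\<^sup>2 \<le> (2 * N * p)\<^sup>2"
      using err1_low[OF _ True t] \<xi> unfolding N_def p_def by (intro power_mono) auto
    then have "w * (cmod (err1 \<mu> v0 v1 t \<xi>))\<^sup>2 \<le> w * (2 * N * p)\<^sup>2" using w by (rule mult_left_mono)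
    also have "\<dots> = 4 * N\<^sup>2 * (w * p\<^sup>2)" by (simp add: power_mult_distrib)
    finally show "w * (cmod (err1 \<mu> v0 v1 t \<xi>))\<^sup>2 \<le> 4 * N\<^sup>2 * (w * p\<^sup>2) + 4 * (hf_rate \<mu> t)\<^sup>2 * hf_data s v0 v1 \<xi>" using h by linarith
  next
    \<comment> \<open>Above frequency 1 solution and profile need not be close; each is small by
      itself, the solution through \<open>hf_rate\<close> and the profile through its own
      damping.\<close>
    case False
    then have r: "1 \<le> norm \<xi>" by simp
    have q: "0 \<le> norm \<xi> ^ 4 * t" using t by simp
    have "\<bar>sym1 \<mu> t (norm \<xi>)\<bar> \<le> norm \<xi> * \<bar>sym1 \<mu> t (norm \<xi>)\<bar>" using r by (simp add: mult_le_cancel_right1)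
    also have "\<dots> \<le> exp (- \<mu> * norm \<xi> ^ 4 * t)" by (rule abs_sym1_le) simp
    also have "\<dots> \<le> p" unfolding p_def using psi_mono_factor(1)[OF q, of \<mu>] by (simp add: mult.assoc)
    finally have "\<bar>sym1 \<mu> t (norm \<xi>)\<bar> \<le> p" .
    moreover have "\<bar>mass v1\<bar> \<le> N" unfolding N_def using L11D(6)[OF v1] L1_norm_nonneg[of v0] by linarith
    ultimately have "\<bar>mass v1\<bar> * \<bar>sym1 \<mu> t (norm \<xi>)\<bar> \<le> N * p"
      by (intro mult_mono) auto
    then have "(cmod (complex_of_real (mass v1 * sym1 \<mu> t (norm \<xi>))))\<^sup>2 \<le> (N * p)\<^sup>2"
      unfolding norm_of_real abs_mult by (intro power_mono) auto
    then have "(cmod (err1 \<mu> v0 v1 t \<xi>))\<^sup>2 \<le> 2 * (cmod (vhat \<mu> v0 v1 t \<xi>))\<^sup>2 + 2 * (N * p)\<^sup>2"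
      unfolding err1_def using square_diff_le[of "vhat \<mu> v0 v1 t \<xi>" "complex_of_real (mass v1 * sym1 \<mu> t (norm \<xi>))"] by linarith
    then have "w * (cmod (err1 \<mu> v0 v1 t \<xi>))\<^sup>2 \<le> w * (2 * (cmod (vhat \<mu> v0 v1 t \<xi>))\<^sup>2 + 2 * (N * p)\<^sup>2)"
      using w by (rule mult_left_mono)
    also have "\<dots> = 2 * (w * (cmod (vhat \<mu> v0 v1 t \<xi>))\<^sup>2) + 2 * (N\<^sup>2 * (w * p\<^sup>2))"
      by (simp add: algebra_simps)
    finally have "w * (cmod (err1 \<mu> v0 v1 t \<xi>))\<^sup>2 \<le> 2 * (w * (cmod (vhat \<mu> v0 v1 t \<xi>))\<^sup>2) + 2 * (N\<^sup>2 * (w * p\<^sup>2))" .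
    moreover have "w * (cmod (vhat \<mu> v0 v1 t \<xi>))\<^sup>2 \<le> 2 * (hf_rate \<mu> t)\<^sup>2 * hf_data s v0 v1 \<xi>"
      unfolding w_def by (rule vhat_high[OF r t s])
    moreover have "0 \<le> N\<^sup>2 * (w * p\<^sup>2)" using w by simp
    ultimately show "w * (cmod (err1 \<mu> v0 v1 t \<xi>))\<^sup>2 \<le> 4 * N\<^sup>2 * (w * p\<^sup>2) + 4 * (hf_rate \<mu> t)\<^sup>2 * hf_data s v0 v1 \<xi>"
      by linarith
  qed
qed

end

section \<open>Integral estimates\<close>

text \<open>Integrability of \<open>g\<close> replaces the chosen Plancherel transform by
  \<open>fourier g\<close>. The freedom \<open>p \<le> s\<close> serves \<open>v1\<close>, whose
  regularity is \<open>s\<close> but whose norm is taken at order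
  \<open>max (s - 1) 0\<close>.\<close>

lemma sobolev_fourier:
  fixes g :: "real^'n \<Rightarrow> real"
  assumes g: "g \<in> sobolev s" "integrable lborel g" and p: "p \<le> s"
  shows "integrable lborel (\<lambda>\<xi>. (1 + (norm \<xi>)\<^sup>2) powr p * (cmod (fourier g \<xi>))\<^sup>2)"
    and "(LINT \<xi>|lborel. (1 + (norm \<xi>)\<^sup>2) powr p * (cmod (fourier g \<xi>))\<^sup>2) = (2 * pi) ^ CARD('n) * (sobolev_norm p g)\<^sup>2"
    and "0 \<le> sobolev_norm p g"
proof -
  obtain F where F: "has_l2_fourier g F" "integrable lborel (\<lambda>\<xi>. (1 + (norm \<xi>)\<^sup>2) powr s * (cmod (F \<xi>))\<^sup>2)"
    using g(1) by (auto simp: sobolev_def)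
  have ae: "AE \<xi> in lborel. F \<xi> = fourier g \<xi>" by (rule has_l2_fourier_L1[OF F(1) g(2)])
  note [measurable] = has_l2_fourierD(3,4)[OF F(1)]
  have i: "integrable lborel (\<lambda>\<xi>. (1 + (norm \<xi>)\<^sup>2) powr s * (cmod (fourier g \<xi>))\<^sup>2)"
    using F(2) ae by (subst integrable_cong_AE[where g="\<lambda>\<xi>. (1 + (norm \<xi>)\<^sup>2) powr s * (cmod (F \<xi>))\<^sup>2"]) auto
  show "integrable lborel (\<lambda>\<xi>. (1 + (norm \<xi>)\<^sup>2) powr p * (cmod (fourier g \<xi>))\<^sup>2)"
    using p by (intro Bochner_Integration.integrable_bound[OF i]) (auto intro!: mult_right_mono powr_mono)
  have nn: "0 \<le> (LINT \<xi>|lborel. (1 + (norm \<xi>)\<^sup>2) powr p * (cmod (fourier g \<xi>))\<^sup>2)"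
    by (intro Bochner_Integration.integral_nonneg) auto
  have N: "sobolev_norm p g = sqrt (1 / (2 * pi) ^ CARD('n) * (LINT \<xi>|lborel. (1 + (norm \<xi>)\<^sup>2) powr p * (cmod (fourier g \<xi>))\<^sup>2))"
    by (rule sobolev_norm_eq[OF F(1) ae]) measurable
  have nn': "0 \<le> 1 / (2 * pi) ^ CARD('n) * (LINT \<xi>|lborel. (1 + (norm \<xi>)\<^sup>2) powr p * (cmod (fourier g \<xi>))\<^sup>2)"
    using nn by (intro mult_nonneg_nonneg) auto
  show "0 \<le> sobolev_norm p g" unfolding N using nn' by (rule real_sqrt_ge_zero)
  have "(sobolev_norm p g)\<^sup>2 = 1 / (2 * pi) ^ CARD('n) * (LINT \<xi>|lborel. (1 + (norm \<xi>)\<^sup>2) powr p * (cmod (fourier g \<xi>))\<^sup>2)"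
    unfolding N using nn' by (rule real_sqrt_pow2)
  then show "(LINT \<xi>|lborel. (1 + (norm \<xi>)\<^sup>2) powr p * (cmod (fourier g \<xi>))\<^sup>2) = (2 * pi) ^ CARD('n) * (sobolev_norm p g)\<^sup>2"
    by simp
qed

text \<open>The \<open>itself\<close> argument transmits the dimension, which no other argument
  determines.\<close>

definition psi_integral :: "'n::finite itself \<Rightarrow> real \<Rightarrow> real \<Rightarrow> real" where
  "psi_integral _ \<mu> s = (LINT \<eta>|(lborel :: (real^'n) measure). norm \<eta> powr (2 * s) * (psi \<mu> (norm \<eta> ^ 4))\<^sup>2)"

lemma psi_integral_scaled:
  assumes \<mu>: "0 < \<mu>" and s: "0 \<le> s" and t: "0 < t"
  shows "integrable lborel (\<lambda>\<xi>::real^'n. norm \<xi> powr (2 * s) * (psi \<mu> (norm \<xi> ^ 4 * t))\<^sup>2)"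
    and "(LINT \<xi>|(lborel :: (real^'n) measure). norm \<xi> powr (2 * s) * (psi \<mu> (norm \<xi> ^ 4 * t))\<^sup>2)
      = t powr (- (2 * s + real CARD('n)) / 4) * psi_integral TYPE('n) \<mu> s"
proof -
  have m: "(\<lambda>\<xi>::real^'n. (psi \<mu> (norm \<xi> ^ 4 * t))\<^sup>2) \<in> borel_measurable borel"
    unfolding psi_def by measurable
  have eq: "norm ((t powr (- 1 / 4)) *\<^sub>R \<eta>) ^ 4 * t = norm \<eta> ^ 4" for \<eta> :: "real^'n"
    using scale_power4[OF t, of "norm \<eta>"] by simp
  show "integrable lborel (\<lambda>\<xi>::real^'n. norm \<xi> powr (2 * s) * (psi \<mu> (norm \<xi> ^ 4 * t))\<^sup>2)"
    unfolding scaled_weighted_integral(2)[OF m t] eq by (rule psi_weight_integrable[OF \<mu> s])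
  show "(LINT \<xi>|(lborel :: (real^'n) measure). norm \<xi> powr (2 * s) * (psi \<mu> (norm \<xi> ^ 4 * t))\<^sup>2)
      = t powr (- (2 * s + real CARD('n)) / 4) * psi_integral TYPE('n) \<mu> s"
    unfolding scaled_weighted_integral(1)[OF m t] eq psi_integral_def ..
qed

lemma hf_rate_decay:
  assumes "0 < \<mu>"
  shows "((\<lambda>t. t powr a * (hf_rate \<mu> t)\<^sup>2) \<longlongrightarrow> 0) at_top"
proof -
  define k where "k = min \<mu> (1 / (2 * \<mu>))"
  define C where "C = 1 + 2 / \<mu> + 3 / \<mu>\<^sup>2"
  have k: "k > 0" using assms by (simp add: k_def)
  have "((\<lambda>t. t powr a * ((1 + t) * exp (- k * t))\<^sup>2) \<longlongrightarrow> 0) at_top"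
    using k by real_asymp
  then have "((\<lambda>t. C\<^sup>2 * (t powr a * ((1 + t) * exp (- k * t))\<^sup>2)) \<longlongrightarrow> C\<^sup>2 * 0) at_top"
    by (intro tendsto_intros)
  then show ?thesis unfolding hf_rate_def k_def[symmetric] C_def[symmetric] by (simp add: power_mult_distrib mult_ac)
qed

context
  fixes v0 v1 :: "real^'n \<Rightarrow> real" and \<mu> s :: real
  assumes v0: "v0 \<in> sobolev s" "integrable lborel v0" and v1: "v1 \<in> sobolev s" "v1 \<in> L11"
    and \<mu>: "0 < \<mu>" "\<mu> < 1" and s: "0 \<le> s"
begin

lemma err_measurable: "err1 \<mu> v0 v1 t \<in> borel_measurable borel" "err2 \<mu> v0 v1 t \<in> borel_measurable borel"
  using err_meas[of v0 v1] borel_measurable_integrable[OF v0(2)] borel_measurable_integrable[OF L11D(1)[OF v1(2)]] by auto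

lemma hf_data_integral:
  shows "integrable lborel (hf_data s v0 v1)"
    and "(LINT \<xi>|lborel. hf_data s v0 v1 \<xi>) \<le> (2 * pi) ^ CARD('n) * (data_norm s v0 v1)\<^sup>2"
    and "L1_norm v0 + L11_norm v1 \<le> data_norm s v0 v1" "0 \<le> data_norm s v0 v1"
proof -
  have ms: "max (s - 1) 0 \<le> s" using s by simp
  note A = sobolev_fourier[OF v0 order_refl]
  note B = sobolev_fourier[OF v1(1) L11D(1)[OF v1(2)] ms]
  show "integrable lborel (hf_data s v0 v1)"
    unfolding hf_data_def [abs_def] using A(1) B(1) by (rule Bochner_Integration.integrable_add)
  have "(LINT \<xi>|lborel. hf_data s v0 v1 \<xi>) = (2 * pi) ^ CARD('n) * ((sobolev_norm s v0)\<^sup>2 + (sobolev_norm (max (s - 1) 0) v1)\<^sup>2)"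
    unfolding hf_data_def using A B by (simp add: Bochner_Integration.integral_add distrib_left)
  also have "\<dots> \<le> (2 * pi) ^ CARD('n) * (data_norm s v0 v1)\<^sup>2"
  proof (intro mult_left_mono)
    have "(sobolev_norm s v0)\<^sup>2 + (sobolev_norm (max (s - 1) 0) v1)\<^sup>2 \<le> (sobolev_norm s v0 + sobolev_norm (max (s - 1) 0) v1)\<^sup>2"
      using A(3) B(3) by (simp add: power2_sum)
    also have "\<dots> \<le> (data_norm s v0 v1)\<^sup>2"
      unfolding data_norm_def using A(3) B(3) L1_norm_nonneg[of v0] L11D(7)[OF v1(2)] by (intro power_mono) auto
    finally show "(sobolev_norm s v0)\<^sup>2 + (sobolev_norm (max (s - 1) 0) v1)\<^sup>2 \<le> (data_norm s v0 v1)\<^sup>2" .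
  qed simp
  finally show "(LINT \<xi>|lborel. hf_data s v0 v1 \<xi>) \<le> (2 * pi) ^ CARD('n) * (data_norm s v0 v1)\<^sup>2" .
  show "L1_norm v0 + L11_norm v1 \<le> data_norm s v0 v1" "0 \<le> data_norm s v0 v1"
    unfolding data_norm_def using A(3) B(3) L1_norm_nonneg[of v0] L11D(7)[OF v1(2)] by auto
qed

text \<open>The data enter only through the final factor, so the upper bound acquires a constant and
  a starting time common to all data.\<close>

lemma err1_integral:
  assumes t: "0 < t"
  shows "integrable lborel (\<lambda>\<xi>. norm \<xi> powr (2 * s) * (cmod (err1 \<mu> v0 v1 t \<xi>))\<^sup>2)"
    and "(LINT \<xi>|lborel. norm \<xi> powr (2 * s) * (cmod (err1 \<mu> v0 v1 t \<xi>))\<^sup>2)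
      \<le> 4 * (psi_integral TYPE('n) \<mu> s * t powr (- (2 * s + real CARD('n)) / 4)
          + (2 * pi) ^ CARD('n) * (hf_rate \<mu> t)\<^sup>2) * (data_norm s v0 v1)\<^sup>2"
proof -
  note [measurable] = err_measurable
  define N where "N = L1_norm v0 + L11_norm v1"
  have N: "0 \<le> N" using L1_norm_nonneg[of v0] L11D(7)[OF v1(2)] by (simp add: N_def)
  let ?b = "\<lambda>\<xi>::real^'n. 4 * N\<^sup>2 * (norm \<xi> powr (2 * s) * (psi \<mu> (norm \<xi> ^ 4 * t))\<^sup>2) + 4 * (hf_rate \<mu> t)\<^sup>2 * hf_data s v0 v1 \<xi>"
  have b: "integrable lborel ?b"
    by (intro Bochner_Integration.integrable_add integrable_mult_right psi_integral_scaled(1) hf_data_integral(1) \<mu> s t)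
  have le: "AE \<xi> in lborel. norm \<xi> powr (2 * s) * (cmod (err1 \<mu> v0 v1 t \<xi>))\<^sup>2 \<le> ?b \<xi>"
    using AE_lborel_singleton[of "0::real^'n"]
    by eventually_elim (use err1_pointwise[OF v0(2) v1(2) \<mu> _ less_imp_le[OF t] s] in \<open>simp add: N_def\<close>)
  show i: "integrable lborel (\<lambda>\<xi>. norm \<xi> powr (2 * s) * (cmod (err1 \<mu> v0 v1 t \<xi>))\<^sup>2)"
  proof (rule Bochner_Integration.integrable_bound[OF b])
    show "AE \<xi> in lborel. norm (norm \<xi> powr (2 * s) * (cmod (err1 \<mu> v0 v1 t \<xi>))\<^sup>2) \<le> norm (?b \<xi>)"
      using le by eventually_elim (simp add: order.trans[OF _ abs_ge_self])
  qed measurable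
  have "(LINT \<xi>|lborel. norm \<xi> powr (2 * s) * (cmod (err1 \<mu> v0 v1 t \<xi>))\<^sup>2) \<le> (LINT \<xi>|lborel. ?b \<xi>)"
    using i b le by (rule integral_mono_AE)
  also have "\<dots> = 4 * N\<^sup>2 * (t powr (- (2 * s + real CARD('n)) / 4) * psi_integral TYPE('n) \<mu> s)
      + 4 * (hf_rate \<mu> t)\<^sup>2 * (LINT \<xi>|lborel. hf_data s v0 v1 \<xi>)"
    using psi_integral_scaled[OF \<mu>(1) s t, where 'n='n] hf_data_integral(1)
    by (subst Bochner_Integration.integral_add) auto
  also have "\<dots> \<le> 4 * (data_norm s v0 v1)\<^sup>2 * (t powr (- (2 * s + real CARD('n)) / 4) * psi_integral TYPE('n) \<mu> s)
      + 4 * (hf_rate \<mu> t)\<^sup>2 * ((2 * pi) ^ CARD('n) * (data_norm s v0 v1)\<^sup>2)"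
  proof (intro add_mono mult_left_mono mult_right_mono hf_data_integral(2) power_mono)
    show "N \<le> data_norm s v0 v1" unfolding N_def by (rule hf_data_integral(3))
    show "0 \<le> t powr (- (2 * s + real CARD('n)) / 4) * psi_integral TYPE('n) \<mu> s"
      unfolding psi_integral_def by (intro mult_nonneg_nonneg Bochner_Integration.integral_nonneg) auto
  qed (use N in auto)
  finally show "(LINT \<xi>|lborel. norm \<xi> powr (2 * s) * (cmod (err1 \<mu> v0 v1 t \<xi>))\<^sup>2)
      \<le> 4 * (psi_integral TYPE('n) \<mu> s * t powr (- (2 * s + real CARD('n)) / 4)
          + (2 * pi) ^ CARD('n) * (hf_rate \<mu> t)\<^sup>2) * (data_norm s v0 v1)\<^sup>2"
    by (simp add: algebra_simps)
qed

text \<open>Stated in \<open>r\<close> and \<open>q = r ^ 4 * t\<close> because \<open>q\<close> is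
  frozen under scaling while \<open>r\<close> tends to 0, so that each summand visibly vanishes. The
  damping is estimated by 1: the bound serves a pointwise limit, and decay at large argument is left
  to \<open>low2_bound\<close>.\<close>

lemma err2_low:
  assumes r: "0 < norm \<xi>" "norm \<xi> \<le> 1" and t: "0 \<le> t"
  defines "r \<equiv> norm \<xi>" and "q \<equiv> norm \<xi> ^ 4 * t"
  shows "cmod (err2 \<mu> v0 v1 t \<xi>) \<le> (r * q + r ^ 3) * L1_norm v0 + cmod (fourier v0 \<xi> - complex_of_real (mass v0))
     + cmod (fourier v1 \<xi> - complex_of_real (mass v1) + \<i> * complex_of_real (\<xi> \<bullet> moment v1)) / r
     + ((q + r) * r + (r + r * q\<^sup>2 + r\<^sup>2 * q)) * L11_norm v1"
proof -
  define e where "e = exp (- \<mu> * r ^ 4 * t)"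
  have q: "0 \<le> q" using t by (simp add: q_def)
  have r': "0 < r" using r by (simp add: r_def)
  have e: "0 < e" "e \<le> 1" using \<mu> t by (auto simp: e_def r_def)
  note N = L11D(6,7)[OF v1(2)] L1_norm_nonneg[of v0]
  have qr: "r ^ 4 * t = q" "r ^ 5 * t = r * q" "r ^ 9 * t\<^sup>2 = r * q\<^sup>2" "r ^ 6 * t = r\<^sup>2 * q"
    unfolding q_def r_def[symmetric] power_mult_distrib power_mult[symmetric] by (simp_all add: mult.assoc[symmetric] flip: power_Suc power_add)
  note k = kernels_low_frequency[OF \<mu> r t, folded r_def, folded e_def, unfolded qr]
  have drop: "x * e \<le> x" if "0 \<le> x" for x using e that by (simp add: mult_left_le)
  define S0 where "S0 = complex_of_real (sym0 \<mu> t r)"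
  define S1 where "S1 = complex_of_real (sym1 \<mu> t r)"
  define P0 where "P0 = complex_of_real (mass v0)"
  define P1 where "P1 = complex_of_real (mass v1)"
  define R where "R = fourier v1 \<xi> - P1 + \<i> * complex_of_real (\<xi> \<bullet> moment v1)"
  \<comment> \<open>The term \<open>S1 * R\<close> isolates the first-order remainder of
    \<open>fourier v1\<close>. In the cross term both factors are errors, and the last term contains
    the cancellation by the bilaplacian correction.\<close>
  have split: "err2 \<mu> v0 v1 t \<xi> = (K0_hat \<mu> t \<xi> - S0) * fourier v0 \<xi> + S0 * (fourier v0 \<xi> - P0)
     + S1 * R + (K1_hat \<mu> t \<xi> - S1) * (fourier v1 \<xi> - P1)
     + (K1_hat \<mu> t \<xi> - S1 + complex_of_real (t / 8 * r ^ 4 * sym0 \<mu> t r)) * P1"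
    unfolding err2_def err1_def vhat_def phat2_def S0_def S1_def P0_def P1_def R_def r_def
    by (simp add: algebra_simps)
  have a: "cmod ((K0_hat \<mu> t \<xi> - S0) * fourier v0 \<xi>) \<le> (r * q + r ^ 3) * L1_norm v0"
  proof -
    have "cmod (K0_hat \<mu> t \<xi> - S0) \<le> r * q + r ^ 3"
      unfolding S0_def by (rule order.trans[OF k(2) drop]) (use q r' in auto)
    then show ?thesis unfolding norm_mult using fourier_bound[of v0 \<xi>] q r' by (intro mult_mono) auto
  qed
  have b: "cmod (S0 * (fourier v0 \<xi> - P0)) \<le> cmod (fourier v0 \<xi> - P0)"
  proof -
    have "cmod S0 \<le> 1" unfolding S0_def norm_of_real using abs_sym0_le[of \<mu> t r] e unfolding e_def by linarith
    then show ?thesis unfolding norm_mult by (intro mult_left_le_one_le) auto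
  qed
  have c: "cmod (S1 * R) \<le> cmod R / r"
  proof -
    have "r * cmod S1 \<le> 1" unfolding S1_def norm_of_real using abs_sym1_le[of r \<mu> t] e r' unfolding e_def by linarith
    then have "cmod S1 \<le> 1 / r" using r' by (simp add: pos_le_divide_eq mult.commute)
    then have "cmod S1 * cmod R \<le> 1 / r * cmod R" by (rule mult_right_mono) simp
    then show ?thesis by (simp add: norm_mult)
  qed
  have d: "cmod ((K1_hat \<mu> t \<xi> - S1) * (fourier v1 \<xi> - P1)) \<le> (q + r) * (r * L11_norm v1)"
  proof -
    have "cmod (K1_hat \<mu> t \<xi> - S1) \<le> q + r" unfolding S1_def by (rule order.trans[OF k(4) drop]) (use q r' in auto)
    then show ?thesis unfolding norm_mult P1_def r_def
      using fourier_first_order(1)[OF v1(2), of \<xi>] q by (intro mult_mono) auto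
  qed
  have f: "cmod ((K1_hat \<mu> t \<xi> - S1 + complex_of_real (t / 8 * r ^ 4 * sym0 \<mu> t r)) * P1) \<le> (r + r * q\<^sup>2 + r\<^sup>2 * q) * L11_norm v1"
  proof -
    have "cmod (K1_hat \<mu> t \<xi> - S1 + complex_of_real (t / 8 * r ^ 4 * sym0 \<mu> t r)) \<le> r + r * q\<^sup>2 + r\<^sup>2 * q"
      using order.trans[OF k(5) drop] q r' unfolding S1_def by simp
    then show ?thesis unfolding norm_mult P1_def norm_of_real using N q r' by (intro mult_mono) auto
  qed
  have "cmod (err2 \<mu> v0 v1 t \<xi>) \<le> (r * q + r ^ 3) * L1_norm v0 + cmod (fourier v0 \<xi> - P0) + cmod R / r
     + (q + r) * (r * L11_norm v1) + (r + r * q\<^sup>2 + r\<^sup>2 * q) * L11_norm v1"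
    unfolding split using a b c d f by (intro norm_triangle_le add_mono)
  then show ?thesis unfolding P0_def R_def P1_def by (simp add: algebra_simps)
qed

text \<open>The part of the second error that is controlled by scaling: above frequency 1 the solution itself
  is split off and treated by its exponential decay.\<close>

definition low2 :: "real \<Rightarrow> real^'n \<Rightarrow> real" where
  "low2 t \<xi> = (if norm \<xi> \<le> 1 then (cmod (err2 \<mu> v0 v1 t \<xi>))\<^sup>2
     else 2 * (cmod (complex_of_real (mass v1 * sym1 \<mu> t (norm \<xi>)) + phat2 \<mu> (mass v0) (mass v1) (moment v1) t \<xi>))\<^sup>2)"

lemma low2_meas: "low2 t \<in> borel_measurable borel"
proof -
  note [measurable] = err_measurable
  show ?thesis unfolding low2_def [abs_def] by measurable
qed

definition low2_const :: real where
  "low2_const = 2 * (L1_norm v0 + L11_norm v1) + 2 * (\<bar>mass v0\<bar> + \<bar>mass v1\<bar> + norm (moment v1))"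

text \<open>After scaling the right side no longer depends on \<open>t\<close>; it is the integrable
  majorant for dominated convergence.\<close>

lemma low2_bound:
  assumes \<xi>: "\<xi> \<noteq> 0" and t: "0 \<le> t"
  shows "low2 t \<xi> \<le> 2 * (low2_const * psi \<mu> (norm \<xi> ^ 4 * t))\<^sup>2"
proof -
  define p where "p = psi \<mu> (norm \<xi> ^ 4 * t)"
  have q: "0 \<le> norm \<xi> ^ 4 * t" using t by simp
  have p: "0 \<le> p" unfolding p_def by (rule psi_mono_factor(3)[OF q])
  define D where "D = \<bar>mass v0\<bar> + \<bar>mass v1\<bar> + norm (moment v1)"
  define N where "N = L1_norm v0 + L11_norm v1"
  have N: "0 \<le> N" using L1_norm_nonneg[of v0] L11D(7)[OF v1(2)] by (simp add: N_def)
  have D: "0 \<le> D" by (simp add: D_def)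
  have c: "low2_const = 2 * N + 2 * D" by (simp add: low2_const_def N_def D_def)
  have ph: "cmod (phat2 \<mu> (mass v0) (mass v1) (moment v1) t \<xi>) \<le> D * p"
    unfolding D_def p_def by (rule phat2_bound[OF t])
  show ?thesis
  proof (cases "norm \<xi> \<le> 1")
    case True
    have "cmod (err2 \<mu> v0 v1 t \<xi>) \<le> 2 * N * p + D * p"
      unfolding err2_def using err1_low[OF v0(2) v1(2) \<mu> _ True t] \<xi> ph
      by (intro order.trans[OF norm_triangle_ineq4] add_mono) (auto simp: N_def p_def)
    also have "\<dots> \<le> low2_const * p" unfolding c using D p by (simp add: algebra_simps)
    finally have "(cmod (err2 \<mu> v0 v1 t \<xi>))\<^sup>2 \<le> (low2_const * p)\<^sup>2" by (intro power_mono) auto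
    then have "(cmod (err2 \<mu> v0 v1 t \<xi>))\<^sup>2 \<le> 2 * (low2_const * p)\<^sup>2"
      using zero_le_power2[of "low2_const * p"] by linarith
    then show ?thesis unfolding low2_def p_def[symmetric] using True by simp
  next
    case False
    have "\<bar>sym1 \<mu> t (norm \<xi>)\<bar> \<le> norm \<xi> * \<bar>sym1 \<mu> t (norm \<xi>)\<bar>" using False by (simp add: mult_le_cancel_right1)
    also have "\<dots> \<le> exp (- \<mu> * norm \<xi> ^ 4 * t)" by (rule abs_sym1_le) simp
    also have "\<dots> \<le> p" unfolding p_def using psi_mono_factor(1)[OF q, of \<mu>] by (simp add: mult.assoc)
    finally have s1: "\<bar>sym1 \<mu> t (norm \<xi>)\<bar> \<le> p" .
    have "cmod (complex_of_real (mass v1 * sym1 \<mu> t (norm \<xi>))) \<le> D * p"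
      unfolding norm_of_real abs_mult using s1 D by (intro mult_mono) (auto simp: D_def)
    then have "cmod (complex_of_real (mass v1 * sym1 \<mu> t (norm \<xi>)) + phat2 \<mu> (mass v0) (mass v1) (moment v1) t \<xi>) \<le> D * p + D * p"
      using ph by (intro norm_triangle_le add_mono)
    also have "\<dots> \<le> low2_const * p" unfolding c using N p by (simp add: algebra_simps)
    finally have "(cmod (complex_of_real (mass v1 * sym1 \<mu> t (norm \<xi>)) + phat2 \<mu> (mass v0) (mass v1) (moment v1) t \<xi>))\<^sup>2 \<le> (low2_const * p)\<^sup>2"
      by (intro power_mono) auto
    then show ?thesis unfolding low2_def p_def[symmetric] using False by simp
  qed
qed

text \<open>At fixed \<eta> the frequency \<open>c t *\<^sub>R \<eta>\<close> eventually has norm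
  below 1, so only the first branch of \<open>low2\<close> counts, and \<open>err2_low\<close>
  applies with constant \<open>q = norm \<eta> ^ 4\<close>.\<close>

lemma low2_tendsto:
  assumes \<eta>: "\<eta> \<noteq> 0"
  shows "((\<lambda>t. low2 t ((t powr (- 1 / 4)) *\<^sub>R \<eta>)) \<longlongrightarrow> 0) at_top"
proof -
  define c where "c = (\<lambda>t::real. t powr (- 1 / 4))"
  have c0: "(c \<longlongrightarrow> 0) at_top" unfolding c_def by real_asymp
  have cp: "c t > 0" if "t > 0" for t using that by (simp add: c_def)
  define q where "q = norm \<eta> ^ 4"
  define \<rho> where "\<rho> = (\<lambda>t. c t * norm \<eta>)"
  have \<rho>0: "(\<rho> \<longlongrightarrow> 0) at_top"
    unfolding \<rho>_def using tendsto_mult_right[OF c0, of "norm \<eta>"] by simp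
  define R where "R = (\<lambda>t. fourier v1 (c t *\<^sub>R \<eta>) - complex_of_real (mass v1) + \<i> * complex_of_real ((c t *\<^sub>R \<eta>) \<bullet> moment v1))"
  define g where "g = (\<lambda>t. (\<rho> t * q + \<rho> t ^ 3) * L1_norm v0 + cmod (fourier v0 (c t *\<^sub>R \<eta>) - complex_of_real (mass v0))
     + cmod (R t / complex_of_real (c t)) / norm \<eta>
     + ((q + \<rho> t) * \<rho> t + (\<rho> t + \<rho> t * q\<^sup>2 + (\<rho> t)\<^sup>2 * q)) * L11_norm v1)"
  have "(g \<longlongrightarrow> (0 * q + 0 ^ 3) * L1_norm v0 + cmod (complex_of_real (mass v0) - complex_of_real (mass v0))
     + cmod 0 / norm \<eta> + ((q + 0) * 0 + (0 + 0 * q\<^sup>2 + 0\<^sup>2 * q)) * L11_norm v1) at_top"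
    unfolding g_def R_def using \<eta>
    by (intro tendsto_intros \<rho>0 fourier_tendsto_mass v0 c0 fourier_first_order(2)[OF v1(2) c0 cp]) auto
  then have g: "(g \<longlongrightarrow> 0) at_top" by simp
  have "\<forall>\<^sub>F t in at_top. \<rho> t < 1" using order_tendstoD(2)[OF \<rho>0, of 1] by simp
  then have ev: "\<forall>\<^sub>F t in at_top. low2 t (c t *\<^sub>R \<eta>) \<le> (g t)\<^sup>2"
    using eventually_gt_at_top[of "0::real"]
  proof eventually_elim
    case (elim t)
    have ct: "c t > 0" using cp elim by simp
    have n: "norm (c t *\<^sub>R \<eta>) = \<rho> t" unfolding \<rho>_def using ct by simp
    have qq: "\<rho> t ^ 4 * t = q" unfolding \<rho>_def c_def q_def by (rule scale_power4) (use elim in simp)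
    have "cmod (R t / complex_of_real (c t)) / norm \<eta> = cmod (R t) / \<rho> t"
      unfolding \<rho>_def using ct by (simp add: norm_divide)
    then have "cmod (err2 \<mu> v0 v1 t (c t *\<^sub>R \<eta>)) \<le> g t"
      using err2_low[of "c t *\<^sub>R \<eta>" t] elim ct \<eta> unfolding n qq g_def R_def by (simp add: \<rho>_def)
    then show ?case unfolding low2_def n using elim by (auto intro!: power_mono)
  qed
  have "((\<lambda>t. low2 t (c t *\<^sub>R \<eta>)) \<longlongrightarrow> 0) at_top"
  proof (rule tendsto_sandwich[OF _ ev tendsto_const])
    show "\<forall>\<^sub>F t in at_top. 0 \<le> low2 t (c t *\<^sub>R \<eta>)" by (simp add: low2_def)
    show "((\<lambda>t. (g t)\<^sup>2) \<longlongrightarrow> 0) at_top" using tendsto_power[OF g, of 2] by simp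
  qed
  then show ?thesis unfolding c_def .
qed

lemma err2_pointwise:
  assumes \<xi>: "\<xi> \<noteq> 0" and t: "0 \<le> t"
  shows "norm \<xi> powr (2 * s) * (cmod (err2 \<mu> v0 v1 t \<xi>))\<^sup>2
     \<le> norm \<xi> powr (2 * s) * low2 t \<xi> + 4 * (hf_rate \<mu> t)\<^sup>2 * hf_data s v0 v1 \<xi>"
proof (cases "norm \<xi> \<le> 1")
  case True
  have "0 \<le> 4 * (hf_rate \<mu> t)\<^sup>2 * hf_data s v0 v1 \<xi>" by (simp add: hf_data_def)
  then show ?thesis using True by (simp add: low2_def)
next
  case False
  define w where "w = norm \<xi> powr (2 * s)"
  define X where "X = complex_of_real (mass v1 * sym1 \<mu> t (norm \<xi>)) + phat2 \<mu> (mass v0) (mass v1) (moment v1) t \<xi>"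
  have "err2 \<mu> v0 v1 t \<xi> = vhat \<mu> v0 v1 t \<xi> - X" by (simp add: err2_def err1_def X_def)
  then have "(cmod (err2 \<mu> v0 v1 t \<xi>))\<^sup>2 \<le> 2 * (cmod (vhat \<mu> v0 v1 t \<xi>))\<^sup>2 + low2 t \<xi>"
    using square_diff_le[of "vhat \<mu> v0 v1 t \<xi>" X] False by (simp add: low2_def X_def)
  then have "w * (cmod (err2 \<mu> v0 v1 t \<xi>))\<^sup>2 \<le> w * (2 * (cmod (vhat \<mu> v0 v1 t \<xi>))\<^sup>2 + low2 t \<xi>)"
    by (rule mult_left_mono) (simp add: w_def)
  also have "\<dots> = 2 * (w * (cmod (vhat \<mu> v0 v1 t \<xi>))\<^sup>2) + w * low2 t \<xi>" by (simp add: algebra_simps)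
  finally have "w * (cmod (err2 \<mu> v0 v1 t \<xi>))\<^sup>2 \<le> 2 * (w * (cmod (vhat \<mu> v0 v1 t \<xi>))\<^sup>2) + w * low2 t \<xi>" .
  moreover have "w * (cmod (vhat \<mu> v0 v1 t \<xi>))\<^sup>2 \<le> 2 * (hf_rate \<mu> t)\<^sup>2 * hf_data s v0 v1 \<xi>"
    unfolding w_def using False by (intro vhat_high v0 v1 \<mu> t s) auto
  ultimately show ?thesis unfolding w_def by linarith
qed

lemma err2_integral:
  shows "0 < t \<Longrightarrow> integrable lborel (\<lambda>\<xi>. norm \<xi> powr (2 * s) * (cmod (err2 \<mu> v0 v1 t \<xi>))\<^sup>2)"
    and "((\<lambda>t. t powr ((2 * s + real CARD('n)) / 4) *
      (LINT \<xi>|lborel. norm \<xi> powr (2 * s) * (cmod (err2 \<mu> v0 v1 t \<xi>))\<^sup>2)) \<longlongrightarrow> 0) at_top"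
proof -
  note [measurable] = err_measurable low2_meas
  define a where "a = (2 * s + real CARD('n)) / 4"
  define c where "c = (\<lambda>t::real. t powr (- 1 / 4))"
  have cp: "c t > 0" if "t > 0" for t using that by (simp add: c_def)
  let ?w = "\<lambda>\<eta>::real^'n. 2 * low2_const\<^sup>2 * (norm \<eta> powr (2 * s) * (psi \<mu> (norm \<eta> ^ 4))\<^sup>2)"
  have wi: "integrable lborel ?w" by (intro integrable_mult_right psi_weight_integrable \<mu> s)
  have low_le: "norm (norm \<eta> powr (2 * s) * low2 t (c t *\<^sub>R \<eta>)) \<le> ?w \<eta>" if "t > 0" "\<eta> \<noteq> 0" for t \<eta>
  proof -
    have "norm (c t *\<^sub>R \<eta>) ^ 4 * t = norm \<eta> ^ 4"
      using scale_power4[OF that(1), of "norm \<eta>"] unfolding c_def by simp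
    then have "low2 t (c t *\<^sub>R \<eta>) \<le> 2 * (low2_const * psi \<mu> (norm \<eta> ^ 4))\<^sup>2"
      using low2_bound[of "c t *\<^sub>R \<eta>" t] that cp[OF that(1)] by simp
    then have "norm \<eta> powr (2 * s) * low2 t (c t *\<^sub>R \<eta>) \<le> norm \<eta> powr (2 * s) * (2 * (low2_const * psi \<mu> (norm \<eta> ^ 4))\<^sup>2)"
      by (rule mult_left_mono) simp
    moreover have "0 \<le> low2 t (c t *\<^sub>R \<eta>)" by (simp add: low2_def)
    ultimately show ?thesis by (simp add: power_mult_distrib mult_ac)
  qed
  have low_ae: "AE \<eta> in lborel. norm (norm \<eta> powr (2 * s) * low2 t (c t *\<^sub>R \<eta>)) \<le> ?w \<eta>" if "t > 0" for t
    using AE_lborel_singleton[of "0::real^'n"] by eventually_elim (use low_le that in blast)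
  have low_i: "integrable lborel (\<lambda>\<xi>. norm \<xi> powr (2 * s) * low2 t \<xi>)" if t: "t > 0" for t
  proof -
    have "integrable lborel (\<lambda>\<eta>. norm \<eta> powr (2 * s) * low2 t (c t *\<^sub>R \<eta>))"
    proof (rule Bochner_Integration.integrable_bound[OF wi])
      show "AE \<eta> in lborel. norm (norm \<eta> powr (2 * s) * low2 t (c t *\<^sub>R \<eta>)) \<le> norm (?w \<eta>)"
        using low_ae[OF t] by eventually_elim simp
    qed measurable
    then show ?thesis unfolding c_def using scaled_weighted_integral(2)[OF low2_meas t] by simp
  qed
  let ?b = "\<lambda>t \<xi>. norm \<xi> powr (2 * s) * low2 t \<xi> + 4 * (hf_rate \<mu> t)\<^sup>2 * hf_data s v0 v1 \<xi>"
  have bi: "integrable lborel (?b t)" if "t > 0" for t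
    by (intro Bochner_Integration.integrable_add integrable_mult_right low_i hf_data_integral that)
  have le: "AE \<xi> in lborel. norm \<xi> powr (2 * s) * (cmod (err2 \<mu> v0 v1 t \<xi>))\<^sup>2 \<le> ?b t \<xi>" if "t > 0" for t
    using AE_lborel_singleton[of "0::real^'n"] by eventually_elim (use err2_pointwise that in simp)
  have ii: "integrable lborel (\<lambda>\<xi>. norm \<xi> powr (2 * s) * (cmod (err2 \<mu> v0 v1 t \<xi>))\<^sup>2)" if t: "0 < t" for t
  proof (rule Bochner_Integration.integrable_bound[OF bi[OF t]])
    show "AE \<xi> in lborel. norm (norm \<xi> powr (2 * s) * (cmod (err2 \<mu> v0 v1 t \<xi>))\<^sup>2) \<le> norm (?b t \<xi>)"
      using le[OF t] by eventually_elim (simp add: order.trans[OF _ abs_ge_self])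
  qed measurable
  then show "0 < t \<Longrightarrow> integrable lborel (\<lambda>\<xi>. norm \<xi> powr (2 * s) * (cmod (err2 \<mu> v0 v1 t \<xi>))\<^sup>2)" .
  define A where "A = (\<lambda>t. LINT \<eta>|lborel. norm \<eta> powr (2 * s) * low2 t (c t *\<^sub>R \<eta>))"
  define H where "H = (LINT \<xi>|lborel. hf_data s v0 v1 \<xi>)"
  have "(A \<longlongrightarrow> (LINT \<eta>|(lborel :: (real^'n) measure). 0)) at_top"
    unfolding A_def
  proof (rule integral_dominated_convergence_at_top[where w="?w"])
    show "AE \<eta> in lborel. ((\<lambda>t. norm \<eta> powr (2 * s) * low2 t (c t *\<^sub>R \<eta>)) \<longlongrightarrow> 0) at_top"
      using AE_lborel_singleton[of "0::real^'n"]
    proof eventually_elim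
      fix \<eta> :: "real^'n" assume "\<eta> \<noteq> 0"
      then show "((\<lambda>t. norm \<eta> powr (2 * s) * low2 t (c t *\<^sub>R \<eta>)) \<longlongrightarrow> 0) at_top"
        unfolding c_def by (intro tendsto_mult_right_zero low2_tendsto)
    qed
    show "\<forall>\<^sub>F t in at_top. AE \<eta> in lborel. norm (norm \<eta> powr (2 * s) * low2 t (c t *\<^sub>R \<eta>)) \<le> ?w \<eta>"
      using eventually_gt_at_top[of "0::real"] by eventually_elim (rule low_ae)
  qed (use wi in auto)
  then have A: "(A \<longlongrightarrow> 0) at_top" by simp
  have ub: "t powr a * (LINT \<xi>|lborel. norm \<xi> powr (2 * s) * (cmod (err2 \<mu> v0 v1 t \<xi>))\<^sup>2) \<le> A t + 4 * (t powr a * (hf_rate \<mu> t)\<^sup>2) * H" if t: "t > 0" for t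
  proof -
    have "(LINT \<xi>|lborel. norm \<xi> powr (2 * s) * (cmod (err2 \<mu> v0 v1 t \<xi>))\<^sup>2) \<le> (LINT \<xi>|lborel. ?b t \<xi>)"
      by (rule integral_mono_AE[OF ii[OF t] bi[OF t] le[OF t]])
    also have "\<dots> = (LINT \<xi>|lborel. norm \<xi> powr (2 * s) * low2 t \<xi>) + 4 * (hf_rate \<mu> t)\<^sup>2 * H"
      unfolding H_def using low_i[OF t] hf_data_integral(1) by (subst Bochner_Integration.integral_add) auto
    also have "(LINT \<xi>|lborel. norm \<xi> powr (2 * s) * low2 t \<xi>) = t powr (- a) * A t"
    proof -
      have "- (2 * s + real CARD('n)) / 4 = - a" by (simp add: a_def field_simps)
      then show ?thesis unfolding scaled_weighted_integral(1)[OF low2_meas t] A_def c_def by simp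
    qed
    finally have "t powr a * (LINT \<xi>|lborel. norm \<xi> powr (2 * s) * (cmod (err2 \<mu> v0 v1 t \<xi>))\<^sup>2)
        \<le> t powr a * (t powr (- a) * A t + 4 * (hf_rate \<mu> t)\<^sup>2 * H)"
      by (rule mult_left_mono) simp
    also have "\<dots> = (t powr a * t powr (- a)) * A t + 4 * (t powr a * (hf_rate \<mu> t)\<^sup>2) * H" by (simp add: algebra_simps)
    also have "t powr a * t powr (- a) = 1" using t by (simp add: powr_add[symmetric])
    finally show ?thesis by simp
  qed
  have "((\<lambda>t. A t + 4 * (t powr a * (hf_rate \<mu> t)\<^sup>2) * H) \<longlongrightarrow> 0 + 4 * 0 * H) at_top"
    by (intro tendsto_intros A hf_rate_decay \<mu>)
  then have up: "((\<lambda>t. A t + 4 * (t powr a * (hf_rate \<mu> t)\<^sup>2) * H) \<longlongrightarrow> 0) at_top" by simp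
  show "((\<lambda>t. t powr ((2 * s + real CARD('n)) / 4) *
      (LINT \<xi>|lborel. norm \<xi> powr (2 * s) * (cmod (err2 \<mu> v0 v1 t \<xi>))\<^sup>2)) \<longlongrightarrow> 0) at_top"
    unfolding a_def[symmetric]
  proof (rule tendsto_sandwich[OF _ _ tendsto_const up])
    show "\<forall>\<^sub>F t in at_top. 0 \<le> t powr a * (LINT \<xi>|lborel. norm \<xi> powr (2 * s) * (cmod (err2 \<mu> v0 v1 t \<xi>))\<^sup>2)"
      by (intro always_eventually allI mult_nonneg_nonneg Bochner_Integration.integral_nonneg) auto
    show "\<forall>\<^sub>F t in at_top. t powr a * (LINT \<xi>|lborel. norm \<xi> powr (2 * s) * (cmod (err2 \<mu> v0 v1 t \<xi>))\<^sup>2)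
        \<le> A t + 4 * (t powr a * (hf_rate \<mu> t)\<^sup>2) * H"
      using eventually_gt_at_top[of "0::real"] by eventually_elim (rule ub)
  qed
qed

end

section \<open>Lower bound for the second profile\<close>

text \<open>For unit \<open>u\<close> the cone has half-angle pi / 3. It keeps the direction factor
  of the moment term away from 0 and is invariant under dilations, which the phase-shift argument
  needs.\<close>

definition cone_shell :: "real^'n \<Rightarrow> real \<Rightarrow> real \<Rightarrow> (real^'n) set" where
  "cone_shell u a b = {\<eta>. norm \<eta> / 2 \<le> \<eta> \<bullet> u \<and> a \<le> norm \<eta> \<and> norm \<eta> \<le> b}"

lemma cone_shell_meas [measurable]: "cone_shell u a b \<in> sets borel"
  unfolding cone_shell_def by measurable

lemma cone_shell_finite: "emeasure lborel (cone_shell u a b) < \<infinity>"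
proof -
  have "bounded (cone_shell u a b)" by (rule boundedI[of _ b]) (auto simp: cone_shell_def)
  then show ?thesis by (rule emeasure_bounded_finite)
qed

text \<open>The shell contains the ball of radius \<open>\<rho> / 8\<close> about
  \<open>(9 / 8 * \<rho>) *\<^sub>R u\<close>, midway between the two radii;
  \<open>\<rho> \<ge> 1\<close> then frees the bound from \<rho>.\<close>

lemma cone_shell_volume:
  fixes u :: "real^'n"
  assumes u: "norm u = 1" and \<rho>: "1 \<le> \<rho>"
  shows "unit_ball_vol (real CARD('n)) * (1 / 8) ^ CARD('n) \<le> measure lborel (cone_shell u \<rho> (5 / 4 * \<rho>))"
proof -
  let ?B = "cball ((9 / 8 * \<rho>) *\<^sub>R u) (\<rho> / 8)"
  have sub: "?B \<subseteq> cone_shell u \<rho> (5 / 4 * \<rho>)"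
  proof
    fix \<eta> assume "\<eta> \<in> ?B"
    then have d: "norm (\<eta> - (9 / 8 * \<rho>) *\<^sub>R u) \<le> \<rho> / 8" by (simp add: dist_norm norm_minus_commute)
    have n: "norm ((9 / 8 * \<rho>) *\<^sub>R u) = 9 / 8 * \<rho>" using u \<rho> by simp
    have up: "norm \<eta> \<le> 5 / 4 * \<rho>"
      using norm_triangle_ineq2[of \<eta> "(9 / 8 * \<rho>) *\<^sub>R u"] d n by linarith
    have lo: "\<rho> \<le> norm \<eta>"
      using norm_triangle_ineq3[of "(9 / 8 * \<rho>) *\<^sub>R u" \<eta>] d n norm_minus_commute[of \<eta> "(9 / 8 * \<rho>) *\<^sub>R u"] by linarith
    have "\<bar>(\<eta> - (9 / 8 * \<rho>) *\<^sub>R u) \<bullet> u\<bar> \<le> \<rho> / 8"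
      using Cauchy_Schwarz_ineq2[of "\<eta> - (9 / 8 * \<rho>) *\<^sub>R u" u] d u by simp
    moreover have "(\<eta> - (9 / 8 * \<rho>) *\<^sub>R u) \<bullet> u = \<eta> \<bullet> u - 9 / 8 * \<rho>"
      using u by (simp add: inner_diff_left dot_square_norm)
    ultimately have "\<rho> \<le> \<eta> \<bullet> u" by linarith
    then show "\<eta> \<in> cone_shell u \<rho> (5 / 4 * \<rho>)" using up lo \<rho> by (simp add: cone_shell_def)
  qed
  have "(1 / 8 :: real) ^ CARD('n) \<le> (\<rho> / 8) ^ CARD('n)" using \<rho> by (intro power_mono) auto
  then have "unit_ball_vol (real CARD('n)) * (1 / 8) ^ CARD('n) \<le> unit_ball_vol (real CARD('n)) * (\<rho> / 8) ^ CARD('n)"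
    by (intro mult_left_mono) auto
  also have "\<dots> = measure lborel ?B" using \<rho> by (simp add: content_cball)
  also have "\<dots> \<le> measure lborel (cone_shell u \<rho> (5 / 4 * \<rho>))"
    using cone_shell_finite[of u \<rho> "5 / 4 * \<rho>"] by (intro measure_mono_fmeasurable[OF sub]) (auto simp: fmeasurable_def)
  finally show ?thesis .
qed

text \<open>The sum of squares equals \<open>1 + cos (2 * x + d) * cos d\<close>, and on this range
  \<open>\<bar>cos d\<bar>\<close> is at most \<open>sqrt 2 / 2\<close>, hence at most 4/5.\<close>

lemma cos_square_pair:
  assumes "pi / 4 \<le> d" "d \<le> 3 * pi / 4"
  shows "1 / 5 \<le> (cos x)\<^sup>2 + (cos (x + d))\<^sup>2"
proof -
  have "cos d \<le> cos (pi / 4)" using assms by (intro cos_monotone_0_pi_le) auto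
  moreover have "cos (pi - d) \<le> cos (pi / 4)" using assms by (intro cos_monotone_0_pi_le) auto
  ultimately have "\<bar>cos d\<bar> \<le> sqrt 2 / 2" by (simp add: cos_45)
  also have "\<dots> \<le> 4 / 5"
  proof -
    have "sqrt 2 \<le> sqrt ((8 / 5)\<^sup>2)" by (intro real_sqrt_le_mono) (simp add: power2_eq_square)
    then show ?thesis by simp
  qed
  finally have d: "\<bar>cos d\<bar> \<le> 4 / 5" .
  have "(cos x)\<^sup>2 + (cos (x + d))\<^sup>2 = 1 + cos (2 * x + d) * cos d"
  proof -
    have "(cos y)\<^sup>2 = (1 + cos (2 * y)) / 2" for y :: real
      by (simp add: cos_double_cos)
    from this[of x] this[of "x + d"]
    have "(cos x)\<^sup>2 = (1 + cos (2 * x)) / 2" "(cos (x + d))\<^sup>2 = (1 + cos (2 * (x + d))) / 2" .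
    moreover have "cos (2 * x) + cos (2 * (x + d)) = 2 * cos (2 * x + d) * cos d"
    proof -
      have "(2 * (x + d) + 2 * x) / 2 = 2 * x + d" "(2 * (x + d) - 2 * x) / 2 = d" by (simp_all add: field_simps)
      then show ?thesis using cos_plus_cos[of "2 * (x + d)" "2 * x"] by (simp only: add.commute)
    qed
    ultimately show ?thesis by simp
  qed
  moreover have "\<bar>cos (2 * x + d) * cos d\<bar> \<le> 1 * (4 / 5)"
    unfolding abs_mult using d by (intro mult_mono) auto
  ultimately show ?thesis by linarith
qed

text \<open>Dilating the shell by a factor \<open>1 + h\<close> with \<open>h\<close> of order \<open>1 / a\<close> shifts the phase by about
  \<open>pi / 2\<close>, so the cosine cannot be small on both copies.\<close>

lemma oscillation_lower_bound:
  fixes u :: "real^'n"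
  assumes u: "norm u = 1" and \<rho>: "1 \<le> \<rho>" "\<rho> \<le> 2" and a: "10 \<le> a" and b: "0 \<le> b" "448 * b \<le> a"
  shows "integrable lborel (\<lambda>\<eta>. indicator (cone_shell u \<rho> (3 / 2 * \<rho>)) \<eta> * (cos (a * norm \<eta> + b * norm \<eta> ^ 3 + \<phi>))\<^sup>2)"
    and "unit_ball_vol (real CARD('n)) * (1 / 8) ^ CARD('n) / 10
      \<le> (LINT \<eta>|lborel. indicator (cone_shell u \<rho> (3 / 2 * \<rho>)) \<eta> * (cos (a * norm \<eta> + b * norm \<eta> ^ 3 + \<phi>))\<^sup>2)"
proof -
  define \<theta> where "\<theta> = (\<lambda>r. a * r + b * r ^ 3 + \<phi>)"
  \<comment> \<open>\<open>S\<close> has to hold both \<open>S'\<close> and its dilate by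
    \<open>1 + h\<close>. With \<open>h \<le> 1 / 5\<close>, which \<open>a \<ge> 10\<close>
    secures, the outer radius is at most 6/5 times 5/4, that is 3/2.\<close>
  define S where "S = cone_shell u \<rho> (3 / 2 * \<rho>)"
  define S' where "S' = cone_shell u \<rho> (5 / 4 * \<rho>)"
  have [measurable]: "S \<in> sets borel" "S' \<in> sets borel" unfolding S_def S'_def by measurable
  have Si: "integrable lborel (indicator S :: _ \<Rightarrow> real)" "integrable lborel (indicator S' :: _ \<Rightarrow> real)"
    unfolding S_def S'_def by (auto intro!: integrable_real_indicator cone_shell_finite)
  have cos1: "(cos x)\<^sup>2 \<le> 1" for x :: real by (simp add: abs_square_le_1)
  have int: "integrable lborel (\<lambda>\<eta>::real^'n. indicator T \<eta> * (cos (f \<eta>))\<^sup>2)"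
    if "integrable lborel (indicator T :: _ \<Rightarrow> real)" "T \<in> sets borel" "f \<in> borel_measurable borel"
    for T and f :: "real^'n \<Rightarrow> real"
  proof (rule Bochner_Integration.integrable_bound[OF that(1)])
    note [measurable] = that(2,3)
    show "(\<lambda>\<eta>::real^'n. indicator T \<eta> * (cos (f \<eta>))\<^sup>2) \<in> borel_measurable lborel" by measurable
    show "AE \<eta> in lborel. norm (indicator T \<eta> * (cos (f \<eta>))\<^sup>2) \<le> norm (indicator T \<eta> :: real)"
      using cos1 by (intro AE_I2) (auto simp: indicator_def)
  qed
  have tm [measurable]: "(\<lambda>\<eta>::real^'n. \<theta> (norm \<eta>)) \<in> borel_measurable borel" unfolding \<theta>_def by measurable
  define f where "f = (\<lambda>\<eta>::real^'n. indicator S \<eta> * (cos (\<theta> (norm \<eta>)))\<^sup>2)"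
  have fi: "integrable lborel f" unfolding f_def by (rule int[OF Si(1)]) measurable
  then show "integrable lborel (\<lambda>\<eta>. indicator (cone_shell u \<rho> (3 / 2 * \<rho>)) \<eta> * (cos (a * norm \<eta> + b * norm \<eta> ^ 3 + \<phi>))\<^sup>2)"
    unfolding f_def S_def \<theta>_def .
  have [measurable]: "f \<in> borel_measurable borel" unfolding f_def by measurable
  \<comment> \<open>With this choice the linear part of the phase moves by \<open>h * a * r\<close>,
    which lies between pi / 2 and 5 * pi / 8 on \<open>S'\<close>.\<close>
  define h where "h = pi / (2 * \<rho> * a)"
  have h0: "0 < h" using \<rho> a by (simp add: h_def)
  have h1: "h \<le> 1 / 5"
  proof -
    have "h \<le> pi / (2 * 1 * 10)" unfolding h_def using \<rho> a by (intro divide_left_mono mult_mono) auto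
    also have "\<dots> \<le> 1 / 5" using pi_less_4 by simp
    finally show ?thesis .
  qed
  have shift: "\<exists>d. pi / 4 \<le> d \<and> d \<le> 3 * pi / 4 \<and> \<theta> ((1 + h) * r) = \<theta> r + d" if r: "\<rho> \<le> r" "r \<le> 5 / 4 * \<rho>" for r
  proof (intro exI conjI)
    \<comment> \<open>The cubic part may add at most pi / 8, since 5 * pi / 8 + pi / 8 is the upper
      end 3 * pi / 4. It is at most \<open>b * (h * 7) * 16\<close>, and comparing this with
      \<open>a * h / 4\<close> gives the factor 448 = 7 * 16 * 4.\<close>
    define d where "d = h * a * r + b * ((1 + h) ^ 3 - 1) * r ^ 3"
    have r0: "0 < r" using r \<rho> by linarith
    have c3: "(1 + h) ^ 3 - 1 = h * (3 + 3 * h + h\<^sup>2)" by (simp add: power3_eq_cube power2_eq_square algebra_simps)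
    have h2: "h\<^sup>2 \<le> 1" using h0 h1 by (simp add: power_le_one)
    have "(1 + h) ^ 3 - 1 \<le> h * 7" unfolding c3 using h0 h1 h2 by (intro mult_left_mono) auto
    moreover have "r ^ 3 \<le> 16"
    proof -
      have "r ^ 3 \<le> (5 / 2) ^ 3" using r r0 \<rho> by (intro power_mono) auto
      then show ?thesis by (simp add: power3_eq_cube)
    qed
    moreover have p3: "0 \<le> (1 + h) ^ 3 - 1" unfolding c3 using h0 by simp
    ultimately have "b * ((1 + h) ^ 3 - 1) * r ^ 3 \<le> b * (h * 7) * 16"
      using b r0 by (intro mult_mono) auto
    also have "\<dots> = (448 * b) * h / 4" by simp
    also have "\<dots> \<le> a * h / 4" using b h0 by (intro divide_right_mono mult_right_mono) auto
    also have "a * h = pi / (2 * \<rho>)" using a by (simp add: h_def)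
    also have "pi / (2 * \<rho>) / 4 \<le> pi / 8" using \<rho> by (simp add: field_simps)
    finally have t2: "b * ((1 + h) ^ 3 - 1) * r ^ 3 \<le> pi / 8" .
    have t2': "0 \<le> b * ((1 + h) ^ 3 - 1) * r ^ 3" using b p3 r0 by simp
    have ha: "h * a * r = pi / 2 * (r / \<rho>)" using a \<rho> by (simp add: h_def)
    have "1 \<le> r / \<rho>" "r / \<rho> \<le> 5 / 4" using r \<rho> by (simp_all add: field_simps)
    then have "pi / 2 * 1 \<le> h * a * r" "h * a * r \<le> pi / 2 * (5 / 4)"
      unfolding ha by (intro mult_left_mono; simp)+
    then show "pi / 4 \<le> d" "d \<le> 3 * pi / 4" unfolding d_def using t2 t2' pi_gt_zero by linarith+
    show "\<theta> ((1 + h) * r) = \<theta> r + d" unfolding \<theta>_def d_def power_mult_distrib by (simp add: algebra_simps)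
  qed
  have g1: "(LINT \<eta>|lborel. indicator S' \<eta> * (cos (\<theta> (norm \<eta>)))\<^sup>2) \<le> (LINT \<eta>|lborel. f \<eta>)"
  proof (rule integral_mono[OF _ fi])
    show "integrable lborel (\<lambda>\<eta>. indicator S' \<eta> * (cos (\<theta> (norm \<eta>)))\<^sup>2)" by (rule int[OF Si(2)]) measurable
    show "indicator S' \<eta> * (cos (\<theta> (norm \<eta>)))\<^sup>2 \<le> f \<eta>" for \<eta>
      using \<rho> by (auto simp: f_def S_def S'_def cone_shell_def indicator_def)
  qed
  have i2: "integrable lborel (\<lambda>\<eta>::real^'n. indicator S' \<eta> * (cos (\<theta> ((1 + h) * norm \<eta>)))\<^sup>2)"
    unfolding \<theta>_def by (rule int[OF Si(2)]) measurable
  have g2: "(LINT \<eta>|lborel. indicator S' \<eta> * (cos (\<theta> ((1 + h) * norm \<eta>)))\<^sup>2) \<le> (LINT \<eta>|lborel. f \<eta>)"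
  proof -
    have fi': "integrable lborel (\<lambda>\<eta>. f (0 + (1 + h) *\<^sub>R \<eta>))"
      using fi h0 by (subst lborel_integrable_affine_iff) auto
    have nn: "0 \<le> f x" for x by (simp add: f_def)
    have "(LINT \<eta>|lborel. indicator S' \<eta> * (cos (\<theta> ((1 + h) * norm \<eta>)))\<^sup>2) \<le> (LINT \<eta>|lborel. f (0 + (1 + h) *\<^sub>R \<eta>))"
    proof (rule integral_mono[OF i2 fi'])
      fix \<eta> :: "real^'n"
      have n: "norm ((1 + h) *\<^sub>R \<eta>) = (1 + h) * norm \<eta>" using h0 by simp
      have "(1 + h) *\<^sub>R \<eta> \<in> S" if "\<eta> \<in> S'"
      proof -
        have e: "norm \<eta> / 2 \<le> \<eta> \<bullet> u" "\<rho> \<le> norm \<eta>" "norm \<eta> \<le> 5 / 4 * \<rho>" using that by (auto simp: S'_def cone_shell_def)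
        have "(1 + h) * (norm \<eta> / 2) \<le> (1 + h) * (\<eta> \<bullet> u)" using e h0 by (intro mult_left_mono) auto
        moreover have "1 * norm \<eta> \<le> (1 + h) * norm \<eta>" using h0 by (intro mult_right_mono) auto
        moreover have "(1 + h) * norm \<eta> \<le> (6 / 5) * (5 / 4 * \<rho>)" using h0 h1 e by (intro mult_mono) auto
        ultimately show ?thesis unfolding S_def cone_shell_def mem_Collect_eq n using e by simp
      qed
      then show "indicator S' \<eta> * (cos (\<theta> ((1 + h) * norm \<eta>)))\<^sup>2 \<le> f (0 + (1 + h) *\<^sub>R \<eta>)"
        unfolding f_def add_0 n by (auto simp: indicator_def)
    qed
    \<comment> \<open>The Jacobian of the dilation is at least 1, so inserting it only enlarges a
      nonnegative integral.\<close>
    also have "\<dots> \<le> \<bar>1 + h\<bar> ^ DIM(real^'n) * (LINT \<eta>|lborel. f (0 + (1 + h) *\<^sub>R \<eta>))"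
    proof -
      have "1 \<le> \<bar>1 + h\<bar> ^ DIM(real^'n)" using h0 by (intro one_le_power) auto
      moreover have "0 \<le> (LINT \<eta>|lborel. f (0 + (1 + h) *\<^sub>R \<eta>))" by (intro Bochner_Integration.integral_nonneg nn)
      ultimately show ?thesis by (simp add: mult_le_cancel_right1)
    qed
    also have "\<dots> = (LINT \<eta>|lborel. f \<eta>)"
      using lborel_integral_affine[of "1 + h" f 0] h0 by simp
    finally show ?thesis .
  qed
  have "measure lborel S' / 5 = (LINT \<eta>|lborel. indicator S' \<eta> * (1 / 5))"
    by simp
  also have "\<dots> \<le> (LINT \<eta>|lborel. indicator S' \<eta> * (cos (\<theta> (norm \<eta>)))\<^sup>2 + indicator S' \<eta> * (cos (\<theta> ((1 + h) * norm \<eta>)))\<^sup>2)"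
  proof (rule integral_mono)
    show "integrable lborel (\<lambda>\<eta>::real^'n. indicator S' \<eta> * (1 / 5 :: real))" using Si(2) by simp
    show "integrable lborel (\<lambda>\<eta>. indicator S' \<eta> * (cos (\<theta> (norm \<eta>)))\<^sup>2 + indicator S' \<eta> * (cos (\<theta> ((1 + h) * norm \<eta>)))\<^sup>2)"
      by (intro Bochner_Integration.integrable_add i2 int[OF Si(2)]) measurable
    fix \<eta> :: "real^'n"
    show "indicator S' \<eta> * (1 / 5) \<le> indicator S' \<eta> * (cos (\<theta> (norm \<eta>)))\<^sup>2 + indicator S' \<eta> * (cos (\<theta> ((1 + h) * norm \<eta>)))\<^sup>2"
    proof (cases "\<eta> \<in> S'")
      case True
      then obtain d where "pi / 4 \<le> d" "d \<le> 3 * pi / 4" "\<theta> ((1 + h) * norm \<eta>) = \<theta> (norm \<eta>) + d"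
        using shift[of "norm \<eta>"] by (auto simp: S'_def cone_shell_def)
      then show ?thesis using cos_square_pair[of d "\<theta> (norm \<eta>)"] True by simp
    qed simp
  qed
  also have "\<dots> = (LINT \<eta>|lborel. indicator S' \<eta> * (cos (\<theta> (norm \<eta>)))\<^sup>2) + (LINT \<eta>|lborel. indicator S' \<eta> * (cos (\<theta> ((1 + h) * norm \<eta>)))\<^sup>2)"
    by (intro Bochner_Integration.integral_add i2 int[OF Si(2)]) measurable
  also have "\<dots> \<le> 2 * (LINT \<eta>|lborel. f \<eta>)" using g1 g2 by linarith
  finally have "measure lborel S' / 5 \<le> 2 * (LINT \<eta>|lborel. f \<eta>)" .
  moreover have "unit_ball_vol (real CARD('n)) * (1 / 8) ^ CARD('n) \<le> measure lborel S'"
    unfolding S'_def by (rule cone_shell_volume[OF u \<rho>(1)])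
  ultimately have "unit_ball_vol (real CARD('n)) * (1 / 8) ^ CARD('n) / 10 \<le> (LINT \<eta>|lborel. f \<eta>)" by linarith
  then show "unit_ball_vol (real CARD('n)) * (1 / 8) ^ CARD('n) / 10
      \<le> (LINT \<eta>|lborel. indicator (cone_shell u \<rho> (3 / 2 * \<rho>)) \<eta> * (cos (a * norm \<eta> + b * norm \<eta> ^ 3 + \<phi>))\<^sup>2)"
    unfolding f_def S_def \<theta>_def .
qed

lemma phat2_square:
  "(cmod (phat2 \<mu> P0 P1 M t \<xi>))\<^sup>2 = (sym0 \<mu> t (norm \<xi>) * (P0 - t / 8 * norm \<xi> ^ 4 * P1))\<^sup>2 + ((\<xi> \<bullet> M) * sym1 \<mu> t (norm \<xi>))\<^sup>2"
  unfolding phat2_def cmod_power2 by simp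

text \<open>In scaled variables the amplitudes and the damping no longer depend on \<open>t\<close>;
  time survives only in the phase. Its linear coefficient \<open>t powr (3 / 4)\<close> eventually
  dominates the cubic one, as the oscillation estimate requires.\<close>

lemma phat2_scaled:
  fixes \<eta> :: "real^'n"
  assumes t: "0 < t" and \<eta>: "\<eta> \<noteq> 0"
  defines "c \<equiv> t powr (- 1 / 4)"
  defines "\<theta> \<equiv> t powr (3 / 4) * norm \<eta> + (t powr (1 / 4) / 2) * norm \<eta> ^ 3"
  shows "(cmod (phat2 \<mu> P0 P1 M t (c *\<^sub>R \<eta>)))\<^sup>2 = (exp (- \<mu> * norm \<eta> ^ 4))\<^sup>2 *
     ((P0 - norm \<eta> ^ 4 / 8 * P1)\<^sup>2 * (cos \<theta>)\<^sup>2 + ((\<eta> \<bullet> M) / norm \<eta>)\<^sup>2 * (sin \<theta>)\<^sup>2)"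
proof -
  have c: "c > 0" using t by (simp add: c_def)
  have n: "norm (c *\<^sub>R \<eta>) = c * norm \<eta>" using c by simp
  have q: "(c * norm \<eta>) ^ 4 * t = norm \<eta> ^ 4" unfolding c_def by (rule scale_power4[OF t])
  have c1: "c * t = t powr (3 / 4)"
  proof -
    have "c * t = t powr (- 1 / 4) * t powr 1" using t by (simp add: c_def)
    then show ?thesis unfolding powr_add[symmetric] by simp
  qed
  have c3: "c ^ 3 * t = t powr (1 / 4)"
  proof -
    have "c ^ 3 * t = t powr (- 1 / 4 * 3) * t powr 1"
      using t by (simp add: c_def powr_realpow[symmetric] powr_powr)
    then show ?thesis unfolding powr_add[symmetric] by simp
  qed
  have th: "c * norm \<eta> * t + 1 / 2 * (c * norm \<eta>) ^ 3 * t = \<theta>"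
    unfolding \<theta>_def c1[symmetric] c3[symmetric] by (simp add: power_mult_distrib)
  have e: "- \<mu> * (c * norm \<eta>) ^ 4 * t = - \<mu> * norm \<eta> ^ 4" using q by (simp add: mult.assoc)
  have s0: "sym0 \<mu> t (c * norm \<eta>) = cos \<theta> * exp (- \<mu> * norm \<eta> ^ 4)"
    unfolding sym0_def th e ..
  have s1: "sym1 \<mu> t (c * norm \<eta>) = 1 / (c * norm \<eta>) * sin \<theta> * exp (- \<mu> * norm \<eta> ^ 4)"
    unfolding sym1_def th e ..
  have tq: "t / 8 * (c * norm \<eta>) ^ 4 * P1 = norm \<eta> ^ 4 / 8 * P1"
    unfolding q[symmetric] by simp
  have "((c *\<^sub>R \<eta>) \<bullet> M) * (1 / (c * norm \<eta>) * sin \<theta> * exp (- \<mu> * norm \<eta> ^ 4))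
      = (\<eta> \<bullet> M) / norm \<eta> * sin \<theta> * exp (- \<mu> * norm \<eta> ^ 4)"
    using c by simp
  then show ?thesis
    unfolding phat2_square n s0 s1 tq by (simp only: power_mult_distrib) (simp only: distrib_left mult_ac)
qed

text \<open>In \<open>x = r ^ 4 / 8\<close> the expression is affine, so it cannot be small in two
  separated places. The radii from 1 to 3/2 give \<open>x \<le> 7 / 10\<close> and those from 2 to 3
  give \<open>x \<ge> 2\<close>. Values below \<delta> at one point of each would force
  \<open>\<bar>P1\<bar> < 2 * \<delta>\<close> and
  \<open>\<bar>P0\<bar> < 12 / 5 * \<delta>\<close>, contradicting the sum
  \<open>5 * \<delta>\<close>.\<close>

lemma separated_affine_lower_bound:
  fixes P0 P1 :: real
  assumes "0 < \<bar>P0\<bar> + \<bar>P1\<bar>"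
  obtains \<rho> where "\<rho> = 1 \<or> \<rho> = 2"
    "\<And>r. \<rho> \<le> r \<Longrightarrow> r \<le> 3 / 2 * \<rho> \<Longrightarrow> (\<bar>P0\<bar> + \<bar>P1\<bar>) / 5 \<le> \<bar>P0 - r ^ 4 / 8 * P1\<bar>"
proof -
  define \<delta> where "\<delta> = (\<bar>P0\<bar> + \<bar>P1\<bar>) / 5"
  have "(\<forall>r. 1 \<le> r \<and> r \<le> 3 / 2 * 1 \<longrightarrow> \<delta> \<le> \<bar>P0 - r ^ 4 / 8 * P1\<bar>) \<or> (\<forall>r. 2 \<le> r \<and> r \<le> 3 / 2 * 2 \<longrightarrow> \<delta> \<le> \<bar>P0 - r ^ 4 / 8 * P1\<bar>)"
  proof (rule ccontr)
    assume "\<not> ?thesis"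
    then obtain r s where "1 \<le> r \<and> r \<le> 3 / 2 * 1 \<and> \<not> \<delta> \<le> \<bar>P0 - r ^ 4 / 8 * P1\<bar>"
      and "2 \<le> s \<and> s \<le> 3 / 2 * 2 \<and> \<not> \<delta> \<le> \<bar>P0 - s ^ 4 / 8 * P1\<bar>" by blast
    then have r: "1 \<le> r" "r \<le> 3 / 2" "\<bar>P0 - r ^ 4 / 8 * P1\<bar> < \<delta>"
      and s: "2 \<le> s" "s \<le> 3" "\<bar>P0 - s ^ 4 / 8 * P1\<bar> < \<delta>" by simp_all
    define x y where "x = r ^ 4 / 8" and "y = s ^ 4 / 8"
    have "r ^ 4 \<le> (3 / 2) ^ 4" using r by (intro power_mono) auto
    then have x: "0 \<le> x" "x \<le> 7 / 10" using r by (simp_all add: x_def power_divide)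
    have "2 ^ 4 \<le> s ^ 4" using s by (intro power_mono) auto
    then have y: "2 \<le> y" by (simp add: y_def)
    have "\<bar>(y - x) * P1\<bar> \<le> \<bar>P0 - x * P1\<bar> + \<bar>P0 - y * P1\<bar>" unfolding left_diff_distrib by linarith
    then have "(y - x) * \<bar>P1\<bar> < 2 * \<delta>" using r(3) s(3) x y unfolding x_def[symmetric] y_def[symmetric] by (simp add: abs_mult)
    moreover have "1 * \<bar>P1\<bar> \<le> (y - x) * \<bar>P1\<bar>" using x y by (intro mult_right_mono) auto
    ultimately have p1: "\<bar>P1\<bar> < 2 * \<delta>" by linarith
    have "\<bar>P0\<bar> \<le> \<bar>P0 - x * P1\<bar> + \<bar>x * P1\<bar>" by linarith
    moreover have "\<bar>x * P1\<bar> \<le> 7 / 10 * \<bar>P1\<bar>" unfolding abs_mult using x by (intro mult_right_mono) auto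
    ultimately have "\<bar>P0\<bar> < \<delta> + 7 / 10 * (2 * \<delta>)" using r(3) p1 unfolding x_def[symmetric] by linarith
    then have "\<bar>P0\<bar> + \<bar>P1\<bar> < 5 * \<delta>" using p1 assms unfolding \<delta>_def by linarith
    then show False by (simp add: \<delta>_def)
  qed
  then show thesis
  proof
    assume "\<forall>r. 1 \<le> r \<and> r \<le> 3 / 2 * 1 \<longrightarrow> \<delta> \<le> \<bar>P0 - r ^ 4 / 8 * P1\<bar>"
    then show thesis by (intro that[of 1]) (auto simp: \<delta>_def)
  next
    assume "\<forall>r. 2 \<le> r \<and> r \<le> 3 / 2 * 2 \<longrightarrow> \<delta> \<le> \<bar>P0 - r ^ 4 / 8 * P1\<bar>"
    then show thesis by (intro that[of 2]) (auto simp: \<delta>_def)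
  qed
qed

text \<open>\<open>exp (- 162)\<close> is a lower bound for \<open>(exp (- \<mu> * r ^ 4))\<^sup>2\<close> on \<open>r \<le> 3\<close>.\<close>

definition lower_const :: "'n::finite itself \<Rightarrow> real" where
  "lower_const _ = exp (- 162) * (unit_ball_vol (real CARD('n)) * (1 / 8) ^ CARD('n) / 10) / 100"

lemma lower_const_pos: "0 < lower_const TYPE('n::finite)"
  unfolding lower_const_def by simp

lemma phat2_integrable:
  fixes M :: "real^'n"
  assumes \<mu>: "0 < \<mu>" and s: "0 \<le> s" and t: "0 < t"
  shows "integrable lborel (\<lambda>\<xi>. norm \<xi> powr (2 * s) * (cmod (phat2 \<mu> P0 P1 M t \<xi>))\<^sup>2)"
proof -
  define D where "D = \<bar>P0\<bar> + \<bar>P1\<bar> + norm M"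
  have le: "(cmod (phat2 \<mu> P0 P1 M t \<xi>))\<^sup>2 \<le> D\<^sup>2 * (psi \<mu> (norm \<xi> ^ 4 * t))\<^sup>2" for \<xi>
    unfolding power_mult_distrib[symmetric] D_def using t by (intro power_mono phat2_bound) auto
  show ?thesis
  proof (rule Bochner_Integration.integrable_bound)
    show "integrable lborel (\<lambda>\<xi>::real^'n. D\<^sup>2 * (norm \<xi> powr (2 * s) * (psi \<mu> (norm \<xi> ^ 4 * t))\<^sup>2))"
      by (intro integrable_mult_right psi_integral_scaled(1) \<mu> s t)
    show "AE \<xi> in lborel. norm (norm \<xi> powr (2 * s) * (cmod (phat2 \<mu> P0 P1 M t \<xi>))\<^sup>2) \<le> norm (D\<^sup>2 * (norm \<xi> powr (2 * s) * (psi \<mu> (norm \<xi> ^ 4 * t))\<^sup>2))"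
      using le by (intro AE_I2) (simp add: abs_mult mult.left_commute[of "D\<^sup>2"] mult_left_mono)
  qed measurable
qed

text \<open>The dichotomy is whether the moment carries at least half of the total size
  \<open>A\<close>. If it does, the sine term is used on a cone around \<open>M\<close>; otherwise
  the cosine term on a shell where its amplitude does not vanish. Either amplitude is at least
  \<open>A / 10\<close>, whence the 100 in \<open>lower_const\<close>.\<close>

lemma phat2_lower_bound:
  fixes M :: "real^'n"
  assumes \<mu>: "0 < \<mu>" "\<mu> < 1" and s: "0 \<le> s" and t: "0 < t"
    and a: "10 \<le> t powr (3 / 4)" and b: "448 * (t powr (1 / 4) / 2) \<le> t powr (3 / 4)"
  shows "lower_const TYPE('n) * (\<bar>P0\<bar> + \<bar>P1\<bar> + norm M)\<^sup>2
    \<le> t powr ((2 * s + real CARD('n)) / 4) * (LINT \<xi>|lborel. norm \<xi> powr (2 * s) * (cmod (phat2 \<mu> P0 P1 M t \<xi>))\<^sup>2)"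
proof (cases "\<bar>P0\<bar> + \<bar>P1\<bar> + norm M = 0")
  case True
  have "0 \<le> t powr ((2 * s + real CARD('n)) / 4) * (LINT \<xi>|lborel. norm \<xi> powr (2 * s) * (cmod (phat2 \<mu> P0 P1 M t \<xi>))\<^sup>2)"
    by (intro mult_nonneg_nonneg Bochner_Integration.integral_nonneg) auto
  then show ?thesis unfolding True by simp
next
  case False
  define A where "A = \<bar>P0\<bar> + \<bar>P1\<bar> + norm M"
  have "0 \<le> A" "A \<noteq> 0" using False unfolding A_def by auto
  then have A0: "0 < A" by linarith
  define V where "V = unit_ball_vol (real CARD('n)) * (1 / 8) ^ CARD('n) / 10"
  define c where "c = t powr (- 1 / 4)"
  define \<alpha> where "\<alpha> = t powr (3 / 4)"
  define \<beta> where "\<beta> = t powr (1 / 4) / 2"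
  define \<theta> where "\<theta> = (\<lambda>\<eta>::real^'n. \<alpha> * norm \<eta> + \<beta> * norm \<eta> ^ 3)"
  define g where "g = (\<lambda>\<eta>. norm \<eta> powr (2 * s) * (cmod (phat2 \<mu> P0 P1 M t (c *\<^sub>R \<eta>)))\<^sup>2)"
  define E where "E = (2 * s + real CARD('n)) / 4"
  have m: "(\<lambda>\<xi>. (cmod (phat2 \<mu> P0 P1 M t \<xi>))\<^sup>2) \<in> borel_measurable borel" by measurable
  have gi: "integrable lborel g"
    using phat2_integrable[OF \<mu>(1) s t, of P0 P1 M] unfolding scaled_weighted_integral(2)[OF m t] g_def c_def .
  have I: "t powr E * (LINT \<xi>|lborel. norm \<xi> powr (2 * s) * (cmod (phat2 \<mu> P0 P1 M t \<xi>))\<^sup>2) = (LINT \<eta>|lborel. g \<eta>)"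
  proof -
    have "- (2 * s + real CARD('n)) / 4 = - E" by (simp add: E_def field_simps)
    then have "(LINT \<xi>|lborel. norm \<xi> powr (2 * s) * (cmod (phat2 \<mu> P0 P1 M t \<xi>))\<^sup>2) = t powr (- E) * (LINT \<eta>|lborel. g \<eta>)"
      unfolding scaled_weighted_integral(1)[OF m t] g_def c_def by simp
    moreover have "t powr E * t powr (- E) = 1" using t by (simp add: powr_add[symmetric])
    ultimately show ?thesis by (simp only: mult.assoc[symmetric] mult_1_left)
  qed
  have \<beta>0: "0 \<le> \<beta>" by (simp add: \<beta>_def)
  \<comment> \<open>The part common to both cases: \<open>K\<close> is the squared amplitude, and
    the phase \<open>\<phi>\<close> is 0 for the cosine and \<open>- (pi / 2)\<close> for the
    sine.\<close>
  have main: "exp (- 162) * K * V \<le> (LINT \<eta>|lborel. g \<eta>)"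
    if u: "norm u = 1" and \<rho>: "1 \<le> \<rho>" "\<rho> \<le> 2" and K: "0 \<le> K"
      and low: "\<And>\<eta>. \<eta> \<in> cone_shell u \<rho> (3 / 2 * \<rho>) \<Longrightarrow>
        K * (cos (\<theta> \<eta> + \<phi>))\<^sup>2 \<le> (P0 - norm \<eta> ^ 4 / 8 * P1)\<^sup>2 * (cos (\<theta> \<eta>))\<^sup>2 + ((\<eta> \<bullet> M) / norm \<eta>)\<^sup>2 * (sin (\<theta> \<eta>))\<^sup>2"
    for u :: "real^'n" and \<rho> K \<phi>
  proof -
    note osc = oscillation_lower_bound[OF u \<rho> a[folded \<alpha>_def] \<beta>0 b[folded \<alpha>_def \<beta>_def], of \<phi>, folded V_def]
    let ?S = "cone_shell u \<rho> (3 / 2 * \<rho>)"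
    have "exp (- 162) * K * V \<le> exp (- 162) * K * (LINT \<eta>|lborel. indicator ?S \<eta> * (cos (\<alpha> * norm \<eta> + \<beta> * norm \<eta> ^ 3 + \<phi>))\<^sup>2)"
      using osc(2) K by (intro mult_left_mono) auto
    also have "\<dots> = (LINT \<eta>|lborel. exp (- 162) * K * (indicator ?S \<eta> * (cos (\<theta> \<eta> + \<phi>))\<^sup>2))"
      unfolding \<theta>_def by (rule integral_mult_right_zero[symmetric])
    also have "\<dots> \<le> (LINT \<eta>|lborel. g \<eta>)"
    proof (rule integral_mono[OF _ gi])
      show "integrable lborel (\<lambda>\<eta>. exp (- 162) * K * (indicator ?S \<eta> * (cos (\<theta> \<eta> + \<phi>))\<^sup>2))"
        unfolding \<theta>_def using osc(1) by (intro integrable_mult_right)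
      fix \<eta>
      show "exp (- 162) * K * (indicator ?S \<eta> * (cos (\<theta> \<eta> + \<phi>))\<^sup>2) \<le> g \<eta>"
      proof (cases "\<eta> \<in> ?S")
        case False
        then show ?thesis by (simp add: g_def)
      next
        case True
        then have r: "1 \<le> norm \<eta>" "norm \<eta> \<le> 3" using \<rho> by (auto simp: cone_shell_def)
        then have \<eta>: "\<eta> \<noteq> 0" by auto
        have r4: "norm \<eta> ^ 4 \<le> 81"
        proof -
          have "norm \<eta> ^ 4 \<le> 3 ^ 4" using r by (intro power_mono) auto
          then show ?thesis by simp
        qed
        have e: "exp (- 162) \<le> (exp (- \<mu> * norm \<eta> ^ 4))\<^sup>2"
        proof -
          have "\<mu> * norm \<eta> ^ 4 \<le> 1 * 81" using \<mu> r4 by (intro mult_mono) auto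
          then show ?thesis unfolding exp_double[symmetric] by simp
        qed
        have w: "1 \<le> norm \<eta> powr (2 * s)" using r s by (intro ge_one_powr_ge_zero) auto
        define X where "X = (P0 - norm \<eta> ^ 4 / 8 * P1)\<^sup>2 * (cos (\<theta> \<eta>))\<^sup>2 + ((\<eta> \<bullet> M) / norm \<eta>)\<^sup>2 * (sin (\<theta> \<eta>))\<^sup>2"
        have X: "0 \<le> X" by (simp add: X_def)
        have geq: "g \<eta> = norm \<eta> powr (2 * s) * ((exp (- \<mu> * norm \<eta> ^ 4))\<^sup>2 * X)"
          unfolding g_def c_def X_def \<theta>_def \<alpha>_def \<beta>_def phat2_scaled[OF t \<eta>] ..
        have "exp (- 162) * (K * (cos (\<theta> \<eta> + \<phi>))\<^sup>2) \<le> (exp (- \<mu> * norm \<eta> ^ 4))\<^sup>2 * X"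
          unfolding X_def using low[OF True] e K by (intro mult_mono) auto
        also have "\<dots> \<le> g \<eta>"
          unfolding geq using mult_right_mono[OF w, of "(exp (- \<mu> * norm \<eta> ^ 4))\<^sup>2 * X"] X by simp
        finally show ?thesis using True by (simp add: mult.assoc)
      qed
    qed
    finally show ?thesis .
  qed
  have "exp (- 162) * (A\<^sup>2 / 100) * V \<le> (LINT \<eta>|lborel. g \<eta>)"
  proof (cases "A / 2 \<le> norm M")
    case True
    then have M: "0 < norm M" using A0 by linarith
    define u where "u = M /\<^sub>R norm M"
    have u: "norm u = 1" using M by (simp add: u_def)
    show ?thesis
    proof (rule main[OF u, of 1 _ "- (pi / 2)"])
      fix \<eta> assume \<eta>: "\<eta> \<in> cone_shell u 1 (3 / 2 * 1)"
      have "norm \<eta> > 0" using \<eta> by (auto simp: cone_shell_def)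
      have "\<eta> \<bullet> u = (\<eta> \<bullet> M) / norm M" unfolding u_def inner_scaleR_right by (simp add: divide_inverse)
      then have "norm \<eta> / 2 \<le> (\<eta> \<bullet> M) / norm M" using \<eta> by (simp add: cone_shell_def)
      then have "norm \<eta> / 2 * norm M \<le> \<eta> \<bullet> M" using M by (simp only: pos_le_divide_eq)
      then have "norm M / 2 * norm \<eta> \<le> \<eta> \<bullet> M" by (simp add: mult.commute)
      then have "norm M / 2 \<le> (\<eta> \<bullet> M) / norm \<eta>" using \<open>norm \<eta> > 0\<close> by (simp only: pos_le_divide_eq)
      then have "A / 10 \<le> (\<eta> \<bullet> M) / norm \<eta>" using True A0 by linarith
      then have "(A / 10)\<^sup>2 \<le> ((\<eta> \<bullet> M) / norm \<eta>)\<^sup>2" using A0 by (intro power_mono) auto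
      then have "(A / 10)\<^sup>2 * (sin (\<theta> \<eta>))\<^sup>2 \<le> ((\<eta> \<bullet> M) / norm \<eta>)\<^sup>2 * (sin (\<theta> \<eta>))\<^sup>2"
        by (rule mult_right_mono) simp
      moreover have "cos (\<theta> \<eta> + - (pi / 2)) = sin (\<theta> \<eta>)" by (simp add: cos_diff)
      ultimately show "A\<^sup>2 / 100 * (cos (\<theta> \<eta> + - (pi / 2)))\<^sup>2 \<le> (P0 - norm \<eta> ^ 4 / 8 * P1)\<^sup>2 * (cos (\<theta> \<eta>))\<^sup>2 + ((\<eta> \<bullet> M) / norm \<eta>)\<^sup>2 * (sin (\<theta> \<eta>))\<^sup>2"
        by (simp add: power_divide add_increasing)
    qed auto
  next
    case False
    define B where "B = \<bar>P0\<bar> + \<bar>P1\<bar>"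
    have "A = B + norm M" by (simp add: A_def B_def)
    then have "A / 2 \<le> B" using False by simp
    then have B: "A / 2 \<le> \<bar>P0\<bar> + \<bar>P1\<bar>" unfolding B_def .
    then have P: "0 < \<bar>P0\<bar> + \<bar>P1\<bar>" using A0 by linarith
    obtain \<rho> where \<rho>: "\<rho> = 1 \<or> \<rho> = 2"
      and low: "\<And>r. \<rho> \<le> r \<Longrightarrow> r \<le> 3 / 2 * \<rho> \<Longrightarrow> (\<bar>P0\<bar> + \<bar>P1\<bar>) / 5 \<le> \<bar>P0 - r ^ 4 / 8 * P1\<bar>"
      by (rule separated_affine_lower_bound[OF P], rule that)
    obtain u :: "real^'n" where u: "norm u = 1" using vector_choose_size[of 1] by auto
    show ?thesis
    proof (rule main[OF u, of \<rho> _ 0])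
      fix \<eta> assume \<eta>: "\<eta> \<in> cone_shell u \<rho> (3 / 2 * \<rho>)"
      have "A / 10 \<le> \<bar>P0 - norm \<eta> ^ 4 / 8 * P1\<bar>" using low[of "norm \<eta>"] \<eta> B by (simp add: cone_shell_def)
      then have "(A / 10)\<^sup>2 \<le> \<bar>P0 - norm \<eta> ^ 4 / 8 * P1\<bar>\<^sup>2" using A0 by (intro power_mono) auto
      then have "(A / 10)\<^sup>2 * (cos (\<theta> \<eta>))\<^sup>2 \<le> (P0 - norm \<eta> ^ 4 / 8 * P1)\<^sup>2 * (cos (\<theta> \<eta>))\<^sup>2"
        unfolding power2_abs by (rule mult_right_mono) simp
      then show "A\<^sup>2 / 100 * (cos (\<theta> \<eta> + 0))\<^sup>2 \<le> (P0 - norm \<eta> ^ 4 / 8 * P1)\<^sup>2 * (cos (\<theta> \<eta>))\<^sup>2 + ((\<eta> \<bullet> M) / norm \<eta>)\<^sup>2 * (sin (\<theta> \<eta>))\<^sup>2"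
        by (simp add: power_divide add_increasing2)
    qed (use \<rho> in auto)
  qed
  then have "lower_const TYPE('n) * A\<^sup>2 \<le> (LINT \<eta>|lborel. g \<eta>)"
    unfolding lower_const_def V_def[symmetric] by (simp add: mult_ac)
  then show ?thesis unfolding I[symmetric] E_def A_def .
qed


text \<open>The number \<open>(2 * s + n) / (64 * \<mu>)\<close> is the mean of
  \<open>r ^ 4 / 8\<close> under the radial weight of density proportional to
  \<open>r powr (2 * s + n - 1) * exp (- 2 * \<mu> * r ^ 4)\<close>, so the mass of the combined
  datum is the mean amplitude of the cosine term. For a lower bound up to a constant, comparison
  with the three plain quantities is enough.\<close>

lemma A_lin_le:
  fixes v0 v1 :: "real^'n \<Rightarrow> real"
  assumes "integrable lborel v0" "integrable lborel v1" "0 < \<mu>" "0 \<le> s"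
  shows "A_lin \<mu> s v0 v1 \<le> (1 + (2 * s + real CARD('n)) / (64 * \<mu>)) * (\<bar>mass v0\<bar> + \<bar>mass v1\<bar> + norm (moment v1))"
proof -
  define k where "k = (2 * s + real CARD('n)) / (64 * \<mu>)"
  have k: "0 \<le> k" using assms by (simp add: k_def)
  have "mass (\<lambda>x. v0 x - k * v1 x) = mass v0 - k * mass v1"
    unfolding mass_def using assms by simp
  then have "A_lin \<mu> s v0 v1 = \<bar>mass v1\<bar> + \<bar>mass v0 - k * mass v1\<bar> + norm (moment v1)"
    unfolding A_lin_def k_def[symmetric] by simp
  also have "\<dots> \<le> \<bar>mass v1\<bar> + (\<bar>mass v0\<bar> + k * \<bar>mass v1\<bar>) + norm (moment v1)"
    using abs_triangle_ineq4[of "mass v0" "k * mass v1"] k by (simp add: abs_mult)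
  also have "\<dots> \<le> (1 + k) * (\<bar>mass v0\<bar> + \<bar>mass v1\<bar> + norm (moment v1))"
  proof -
    have "0 \<le> k * \<bar>mass v0\<bar>" "0 \<le> k * norm (moment v1)" using k by simp_all
    then show ?thesis by (simp add: algebra_simps)
  qed
  finally show ?thesis unfolding k_def .
qed

text \<open>The second profile is the difference of the two errors. If \<open>c\<close> bounds its
  scaled squared norm from below and that of the second error has dropped under
  \<open>c / 4\<close>, then \<open>c \<le> 2 * I1 + c / 2\<close> for the scaled squared norm
  \<open>I1\<close> of the first error, hence \<open>I1 \<ge> c / 4\<close>.\<close>

lemma err1_lower_bound:
  fixes v0 v1 :: "real^'n \<Rightarrow> real"
  assumes data: "v0 \<in> sobolev s" "integrable lborel v0" "v1 \<in> sobolev s" "v1 \<in> L11"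
    and \<mu>: "0 < \<mu>" "\<mu> < 1" and s: "0 \<le> s" and A: "0 < \<bar>mass v0\<bar> + \<bar>mass v1\<bar> + norm (moment v1)"
  shows "\<forall>\<^sub>F t in at_top. lower_const TYPE('n) / 4 * (\<bar>mass v0\<bar> + \<bar>mass v1\<bar> + norm (moment v1))\<^sup>2
    \<le> t powr ((2 * s + real CARD('n)) / 4) * (LINT \<xi>|lborel. norm \<xi> powr (2 * s) * (cmod (err1 \<mu> v0 v1 t \<xi>))\<^sup>2)"
proof -
  define c where "c = lower_const TYPE('n) * (\<bar>mass v0\<bar> + \<bar>mass v1\<bar> + norm (moment v1))\<^sup>2"
  define E where "E = (2 * s + real CARD('n)) / 4"
  have c: "0 < c" unfolding c_def using A by (intro mult_pos_pos lower_const_pos) auto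
  let ?Q = "phat2 \<mu> (mass v0) (mass v1) (moment v1)"
  let ?I = "\<lambda>F. LINT \<xi>|lborel. norm \<xi> powr (2 * s) * (cmod (F \<xi>))\<^sup>2"
  have e2: "\<forall>\<^sub>F t in at_top. t powr E * ?I (err2 \<mu> v0 v1 t) < c / 4"
    unfolding E_def using order_tendstoD(2)[OF err2_integral(2)[OF data \<mu> s], of "c / 4"] c by simp
  have a: "\<forall>\<^sub>F t::real in at_top. 10 \<le> t powr (3 / 4)" by real_asymp
  have b: "\<forall>\<^sub>F t::real in at_top. 448 * (t powr (1 / 4) / 2) \<le> t powr (3 / 4)" by real_asymp
  show ?thesis using e2 a b eventually_gt_at_top[of "0::real"]
  proof eventually_elim
    case (elim t)
    have i1: "integrable lborel (\<lambda>\<xi>. norm \<xi> powr (2 * s) * (cmod (err1 \<mu> v0 v1 t \<xi>))\<^sup>2)"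
      by (rule err1_integral(1)[OF data \<mu> s elim(4)])
    have i2: "integrable lborel (\<lambda>\<xi>. norm \<xi> powr (2 * s) * (cmod (err2 \<mu> v0 v1 t \<xi>))\<^sup>2)"
      by (rule err2_integral(1)[OF data \<mu> s elim(4)])
    have iq: "integrable lborel (\<lambda>\<xi>. norm \<xi> powr (2 * s) * (cmod (?Q t \<xi>))\<^sup>2)"
      by (rule phat2_integrable[OF \<mu>(1) s elim(4)])
    have "?I (?Q t) \<le> (LINT \<xi>|lborel. 2 * (norm \<xi> powr (2 * s) * (cmod (err1 \<mu> v0 v1 t \<xi>))\<^sup>2) + 2 * (norm \<xi> powr (2 * s) * (cmod (err2 \<mu> v0 v1 t \<xi>))\<^sup>2))"
    proof (rule integral_mono[OF iq])
      show "integrable lborel (\<lambda>\<xi>. 2 * (norm \<xi> powr (2 * s) * (cmod (err1 \<mu> v0 v1 t \<xi>))\<^sup>2) + 2 * (norm \<xi> powr (2 * s) * (cmod (err2 \<mu> v0 v1 t \<xi>))\<^sup>2))"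
        by (intro Bochner_Integration.integrable_add integrable_mult_right i1 i2)
      fix \<xi>
      have "?Q t \<xi> = err1 \<mu> v0 v1 t \<xi> - err2 \<mu> v0 v1 t \<xi>" by (simp add: err2_def)
      then have "(cmod (?Q t \<xi>))\<^sup>2 \<le> 2 * (cmod (err1 \<mu> v0 v1 t \<xi>))\<^sup>2 + 2 * (cmod (err2 \<mu> v0 v1 t \<xi>))\<^sup>2"
        using square_diff_le[of "err1 \<mu> v0 v1 t \<xi>" "err2 \<mu> v0 v1 t \<xi>"] by simp
      then have "norm \<xi> powr (2 * s) * (cmod (?Q t \<xi>))\<^sup>2
          \<le> norm \<xi> powr (2 * s) * (2 * (cmod (err1 \<mu> v0 v1 t \<xi>))\<^sup>2 + 2 * (cmod (err2 \<mu> v0 v1 t \<xi>))\<^sup>2)"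
        by (rule mult_left_mono) simp
      then show "norm \<xi> powr (2 * s) * (cmod (?Q t \<xi>))\<^sup>2
          \<le> 2 * (norm \<xi> powr (2 * s) * (cmod (err1 \<mu> v0 v1 t \<xi>))\<^sup>2) + 2 * (norm \<xi> powr (2 * s) * (cmod (err2 \<mu> v0 v1 t \<xi>))\<^sup>2)"
        by (simp add: distrib_left mult.left_commute)
    qed
    also have "\<dots> = 2 * ?I (err1 \<mu> v0 v1 t) + 2 * ?I (err2 \<mu> v0 v1 t)"
      using i1 i2 by (subst Bochner_Integration.integral_add) auto
    finally have "t powr E * ?I (?Q t) \<le> t powr E * (2 * ?I (err1 \<mu> v0 v1 t) + 2 * ?I (err2 \<mu> v0 v1 t))"
      by (rule mult_left_mono) simp
    also have "\<dots> = 2 * (t powr E * ?I (err1 \<mu> v0 v1 t)) + 2 * (t powr E * ?I (err2 \<mu> v0 v1 t))"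
      by (simp add: distrib_left mult.left_commute)
    finally have "t powr E * ?I (?Q t) \<le> 2 * (t powr E * ?I (err1 \<mu> v0 v1 t)) + 2 * (t powr E * ?I (err2 \<mu> v0 v1 t))" .
    moreover have "c \<le> t powr E * ?I (?Q t)"
      unfolding c_def E_def by (rule phat2_lower_bound[OF \<mu> s elim(4) elim(2) elim(3)])
    ultimately have "c / 4 \<le> t powr E * ?I (err1 \<mu> v0 v1 t)" using elim(1) by linarith
    then show ?case unfolding c_def E_def by simp
  qed
qed

section \<open>Optimal error estimates\<close>

text \<open>The constants and \<open>t0\<close> are quantified before the data and \<open>t1\<close>
  after them, as the two directions of the estimate demand. Membership in \<open>hom_sobolev\<close>
  is asserted along with the norm bounds, because the norm is meaningful only there.\<close>

theorem theorem3p2: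
  fixes \<mu> s :: real
  assumes "0 < \<mu>" and "\<mu> < 1" and "0 \<le> s"
  shows
    "(\<exists>c>0. \<exists>C>0. \<exists>t0>0. \<forall>(v0 :: real^'n \<Rightarrow> real) v1 v.
        v0 \<in> sobolev s \<inter> L1 \<longrightarrow> v1 \<in> sobolev s \<inter> L11 \<longrightarrow>
        boussinesq_solution \<mu> v0 v1 v \<longrightarrow> A_lin \<mu> s v0 v1 \<noteq> 0 \<longrightarrow>
          (\<forall>t\<ge>t0. (\<lambda>x. v t x - profile1 \<mu> v1 t x) \<in> hom_sobolev s \<and>
             hom_sobolev_norm s (\<lambda>x. v t x - profile1 \<mu> v1 t x)
               \<le> C * t powr (- (2 * s + real CARD('n)) / 8) * data_norm s v0 v1) \<and>
          (\<exists>t1\<ge>t0. \<forall>t\<ge>t1.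
             c * t powr (- (2 * s + real CARD('n)) / 8) * A_lin \<mu> s v0 v1
               \<le> hom_sobolev_norm s (\<lambda>x. v t x - profile1 \<mu> v1 t x)))
     \<and>
     (\<forall>(v0 :: real^'n \<Rightarrow> real) v1 v.
        v0 \<in> sobolev s \<inter> L1 \<longrightarrow> v1 \<in> sobolev s \<inter> L11 \<longrightarrow>
        boussinesq_solution \<mu> v0 v1 v \<longrightarrow>
          (\<forall>\<^sub>F t in at_top.
             (\<lambda>x. v t x - profile1 \<mu> v1 t x - profile2 \<mu> v0 v1 t x) \<in> hom_sobolev s) \<and>
          (\<lambda>t. hom_sobolev_norm s (\<lambda>x. v t x - profile1 \<mu> v1 t x - profile2 \<mu> v0 v1 t x))
            \<in> o[at_top](\<lambda>t. t powr (- (2 * s + real CARD('n)) / 8)))"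
proof -
  note \<mu> = assms(1,2) and s = assms(3)
  define E where "E = (2 * s + real CARD('n)) / 4"
  define k where "k = 1 + (2 * s + real CARD('n)) / (64 * \<mu>)"
  have k: "0 < k" unfolding k_def using \<mu> s by (intro add_pos_nonneg) auto
  define J where "J = psi_integral TYPE('n) \<mu> s"
  have J: "0 \<le> J" unfolding J_def psi_integral_def by (intro Bochner_Integration.integral_nonneg) auto
  define W where "W = (2 * pi) ^ CARD('n)"
  have W: "0 < W" by (simp add: W_def)
  define L where "L = lower_const TYPE('n)"
  have L: "0 < L" unfolding L_def by (rule lower_const_pos)
  \<comment> \<open>The integral estimates concern squared norms at the rate
    \<open>t powr (- E)\<close>; this converts them into the rate of the norms.\<close>
  have e8: "t powr (- (2 * s + real CARD('n)) / 8) = sqrt (t powr (- E))" if "0 < t" for t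
  proof -
    have "(t powr (- (2 * s + real CARD('n)) / 8))\<^sup>2 = t powr (- E)"
      unfolding power2_eq_square powr_add[symmetric] E_def by (intro arg_cong[where f="(powr) t"]) (simp add: field_simps)
    then show ?thesis by (metis powr_ge_zero real_sqrt_abs abs_of_nonneg)
  qed
  have pinv: "t powr E * t powr (- E) = 1" if "0 < t" for t using that by (simp add: powr_add[symmetric])
  have tE: "- (2 * s + real CARD('n)) / 4 = - E" by (simp add: E_def field_simps)
  let ?I = "\<lambda>F. LINT \<xi>|(lborel :: (real^'n) measure). norm \<xi> powr (2 * s) * (cmod (F \<xi>))\<^sup>2"
  have f1: "has_l2_fourier (\<lambda>x. v t x - profile1 \<mu> v1 t x) (err1 \<mu> v0 v1 t)"
    if "boussinesq_solution \<mu> v0 v1 v" "0 < t" for v0 v1 :: "real^'n \<Rightarrow> real" and v t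
  proof -
    have "has_l2_fourier (v t) (vhat \<mu> v0 v1 t)"
      using that unfolding boussinesq_solution_def vhat_def [abs_def] by simp
    then show ?thesis unfolding err1_def [abs_def] by (intro has_l2_fourier_diff has_l2_fourier_profile1 \<mu> that(2))
  qed
  have f2: "has_l2_fourier (\<lambda>x. v t x - profile1 \<mu> v1 t x - profile2 \<mu> v0 v1 t x) (err2 \<mu> v0 v1 t)"
    if "boussinesq_solution \<mu> v0 v1 v" "0 < t" for v0 v1 :: "real^'n \<Rightarrow> real" and v t
    unfolding err2_def [abs_def] by (intro has_l2_fourier_diff f1 that has_l2_fourier_profile2 \<mu>)
  have "((\<lambda>t. t powr E * (hf_rate \<mu> t)\<^sup>2) \<longlongrightarrow> 0) at_top" by (rule hf_rate_decay[OF \<mu>(1)])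
  then have "\<forall>\<^sub>F t in at_top. t powr E * (hf_rate \<mu> t)\<^sup>2 < 1" by (rule order_tendstoD(2)) simp
  \<comment> \<open>From \<open>T\<close> on the exponential high-frequency rate lies below the
    algebraic one. \<open>T\<close> depends on \<mu>, \<open>s\<close> and the dimension only, which
    makes \<open>t0\<close> uniform in the data.\<close>
  then obtain T where T: "\<And>t. T \<le> t \<Longrightarrow> t powr E * (hf_rate \<mu> t)\<^sup>2 < 1"
    unfolding eventually_at_top_linorder by blast
  define t0 where "t0 = max T 1"
  have hf: "(hf_rate \<mu> t)\<^sup>2 \<le> t powr (- E)" if "t0 \<le> t" for t
  proof -
    have t: "0 < t" "T \<le> t" using that by (auto simp: t0_def)
    have "t powr (- E) * (t powr E * (hf_rate \<mu> t)\<^sup>2) \<le> t powr (- E) * 1"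
      using T[OF t(2)] by (intro mult_left_mono) auto
    then show ?thesis using pinv[OF t(1)] by (simp add: mult.assoc[symmetric] mult.commute[of "t powr - E"])
  qed
  \<comment> \<open>\<open>L / 4\<close> is the constant of \<open>err1_lower_bound\<close>,
    \<open>W\<close> the Plancherel constant in the norm, and the division by \<open>k\<close> pays
    for passing to \<open>A_lin\<close>.\<close>
  define c where "c = sqrt (L / (4 * W)) / k"
  \<comment> \<open>In \<open>err1_integral\<close> the summand \<open>J\<close> stems from low
    frequencies; the summand \<open>W\<close> is the Plancherel factor of the high-frequency data
    once \<open>hf_rate\<close> has been absorbed.\<close>
  define C where "C = sqrt (4 * (J + W) / W)"
  have c0: "0 < c" unfolding c_def using L W k by (intro divide_pos_pos) auto
  have C0: "0 < C" unfolding C_def using J W by (intro real_sqrt_gt_zero divide_pos_pos) auto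
  show ?thesis
  proof (intro conjI)
    show "\<exists>c>0. \<exists>C>0. \<exists>t0>0. \<forall>(v0 :: real^'n \<Rightarrow> real) v1 v.
        v0 \<in> sobolev s \<inter> L1 \<longrightarrow> v1 \<in> sobolev s \<inter> L11 \<longrightarrow>
        boussinesq_solution \<mu> v0 v1 v \<longrightarrow> A_lin \<mu> s v0 v1 \<noteq> 0 \<longrightarrow>
          (\<forall>t\<ge>t0. (\<lambda>x. v t x - profile1 \<mu> v1 t x) \<in> hom_sobolev s \<and>
             hom_sobolev_norm s (\<lambda>x. v t x - profile1 \<mu> v1 t x)
               \<le> C * t powr (- (2 * s + real CARD('n)) / 8) * data_norm s v0 v1) \<and>
          (\<exists>t1\<ge>t0. \<forall>t\<ge>t1.
             c * t powr (- (2 * s + real CARD('n)) / 8) * A_lin \<mu> s v0 v1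
               \<le> hom_sobolev_norm s (\<lambda>x. v t x - profile1 \<mu> v1 t x))"
    proof (rule exI[of _ c], intro conjI c0, rule exI[of _ C], intro conjI C0, rule exI[of _ t0], intro conjI allI impI)
      show "0 < t0" by (simp add: t0_def)
    next
      fix v0 v1 :: "real^'n \<Rightarrow> real" and v t
      assume v0: "v0 \<in> sobolev s \<inter> L1" and v1: "v1 \<in> sobolev s \<inter> L11" and v: "boussinesq_solution \<mu> v0 v1 v"
        and t: "t0 \<le> t"
      have t': "0 < t" using t by (simp add: t0_def)
      have data: "v0 \<in> sobolev s" "integrable lborel v0" "v1 \<in> sobolev s" "v1 \<in> L11"
        using v0 v1 by (auto dest: L1D)
      note F = f1[OF v t'] and i = err1_integral[OF data \<mu> s t']
      define X where "X = data_norm s v0 v1"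
      have X: "0 \<le> X" unfolding X_def by (rule hf_data_integral(4)[OF data \<mu> s])
      show "(\<lambda>x. v t x - profile1 \<mu> v1 t x) \<in> hom_sobolev s"
        unfolding hom_sobolev_def using F i(1) by blast
      have "?I (err1 \<mu> v0 v1 t) \<le> 4 * (J * t powr (- E) + W * (hf_rate \<mu> t)\<^sup>2) * X\<^sup>2"
        using i(2) unfolding tE J_def W_def X_def .
      also have "\<dots> \<le> 4 * (J * t powr (- E) + W * t powr (- E)) * X\<^sup>2"
        using hf[OF t] W by (intro mult_right_mono mult_left_mono add_left_mono) auto
      also have "\<dots> = 4 * (J + W) * t powr (- E) * X\<^sup>2" by (simp add: algebra_simps)
      finally have "1 / W * ?I (err1 \<mu> v0 v1 t) \<le> 1 / W * (4 * (J + W) * t powr (- E) * X\<^sup>2)"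
        using W by (intro mult_left_mono) auto
      also have "\<dots> = 4 * (J + W) / W * t powr (- E) * X\<^sup>2" by simp
      finally have "hom_sobolev_norm s (\<lambda>x. v t x - profile1 \<mu> v1 t x) \<le> sqrt (4 * (J + W) / W * t powr (- E) * X\<^sup>2)"
        unfolding hom_sobolev_norm_eq[OF F] W_def[symmetric] by (rule real_sqrt_le_mono)
      also have "\<dots> = C * sqrt (t powr (- E)) * X"
        unfolding real_sqrt_mult C_def using X by simp
      finally show "hom_sobolev_norm s (\<lambda>x. v t x - profile1 \<mu> v1 t x) \<le> C * t powr (- (2 * s + real CARD('n)) / 8) * data_norm s v0 v1"
        unfolding e8[OF t'] X_def .
    next
      fix v0 v1 :: "real^'n \<Rightarrow> real" and v
      assume v0: "v0 \<in> sobolev s \<inter> L1" and v1: "v1 \<in> sobolev s \<inter> L11" and v: "boussinesq_solution \<mu> v0 v1 v"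
        and A: "A_lin \<mu> s v0 v1 \<noteq> 0"
      have data: "v0 \<in> sobolev s" "integrable lborel v0" "v1 \<in> sobolev s" "v1 \<in> L11"
        using v0 v1 by (auto dest: L1D)
      define B where "B = \<bar>mass v0\<bar> + \<bar>mass v1\<bar> + norm (moment v1)"
      have AB: "A_lin \<mu> s v0 v1 \<le> k * B"
        unfolding k_def B_def by (rule A_lin_le[OF data(2) L11D(1)[OF data(4)] \<mu>(1) s])
      \<comment> \<open>Together with \<open>AB\<close>, nonvanishing of \<open>A_lin\<close> forces
        the total size \<open>B\<close> to be positive, as the lower bound requires.\<close>
      have "0 \<le> A_lin \<mu> s v0 v1" unfolding A_lin_def by (intro add_nonneg_nonneg) auto
      then have "0 < k * B" using A AB by linarith
      then have B: "0 < B" using k by (simp add: zero_less_mult_iff)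
      have "\<forall>\<^sub>F t in at_top. L / 4 * B\<^sup>2 \<le> t powr E * ?I (err1 \<mu> v0 v1 t)"
        unfolding L_def B_def E_def by (rule err1_lower_bound[OF data \<mu> s B[unfolded B_def]])
      then obtain T1 where T1: "\<And>t. T1 \<le> t \<Longrightarrow> L / 4 * B\<^sup>2 \<le> t powr E * ?I (err1 \<mu> v0 v1 t)"
        unfolding eventually_at_top_linorder by blast
      show "\<exists>t1\<ge>t0. \<forall>t\<ge>t1. c * t powr (- (2 * s + real CARD('n)) / 8) * A_lin \<mu> s v0 v1
               \<le> hom_sobolev_norm s (\<lambda>x. v t x - profile1 \<mu> v1 t x)"
      proof (intro exI[of _ "max t0 T1"] conjI allI impI)
        fix t assume "max t0 T1 \<le> t"
        then have t: "0 < t" "T1 \<le> t" by (auto simp: t0_def)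
        have "t powr (- E) * (L / 4 * B\<^sup>2) \<le> t powr (- E) * (t powr E * ?I (err1 \<mu> v0 v1 t))"
          using T1[OF t(2)] by (intro mult_left_mono) auto
        also have "\<dots> = ?I (err1 \<mu> v0 v1 t)"
          using pinv[OF t(1)] by (simp only: mult.assoc[symmetric] mult.commute[of "t powr - E"] mult_1_left)
        finally have "1 / W * (t powr (- E) * (L / 4 * B\<^sup>2)) \<le> 1 / W * ?I (err1 \<mu> v0 v1 t)"
          using W by (intro mult_left_mono) auto
        then have "sqrt (1 / W * (t powr (- E) * (L / 4 * B\<^sup>2))) \<le> hom_sobolev_norm s (\<lambda>x. v t x - profile1 \<mu> v1 t x)"
          unfolding hom_sobolev_norm_eq[OF f1[OF v t(1)]] W_def[symmetric] by (rule real_sqrt_le_mono)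
        moreover have "sqrt (1 / W * (t powr (- E) * (L / 4 * B\<^sup>2))) = c * sqrt (t powr (- E)) * (k * B)"
        proof -
          have "1 / W * (t powr (- E) * (L / 4 * B\<^sup>2)) = L / (4 * W) * t powr (- E) * B\<^sup>2"
            by (simp add: mult_ac)
          then have "sqrt (1 / W * (t powr (- E) * (L / 4 * B\<^sup>2))) = sqrt (L / (4 * W)) * sqrt (t powr (- E)) * B"
            using B by (simp only: real_sqrt_mult real_sqrt_abs abs_of_pos)
          also have "sqrt (L / (4 * W)) = c * k" using k by (simp add: c_def)
          finally show ?thesis by simp
        qed
        moreover have "c * sqrt (t powr (- E)) * A_lin \<mu> s v0 v1 \<le> c * sqrt (t powr (- E)) * (k * B)"
          using AB c0 by (intro mult_left_mono) auto
        ultimately show "c * t powr (- (2 * s + real CARD('n)) / 8) * A_lin \<mu> s v0 v1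
               \<le> hom_sobolev_norm s (\<lambda>x. v t x - profile1 \<mu> v1 t x)"
          unfolding e8[OF t(1)] by linarith
      qed simp
    qed
  next
    show "\<forall>(v0 :: real^'n \<Rightarrow> real) v1 v.
        v0 \<in> sobolev s \<inter> L1 \<longrightarrow> v1 \<in> sobolev s \<inter> L11 \<longrightarrow>
        boussinesq_solution \<mu> v0 v1 v \<longrightarrow>
          (\<forall>\<^sub>F t in at_top.
             (\<lambda>x. v t x - profile1 \<mu> v1 t x - profile2 \<mu> v0 v1 t x) \<in> hom_sobolev s) \<and>
          (\<lambda>t. hom_sobolev_norm s (\<lambda>x. v t x - profile1 \<mu> v1 t x - profile2 \<mu> v0 v1 t x))
            \<in> o[at_top](\<lambda>t. t powr (- (2 * s + real CARD('n)) / 8))"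
    proof (intro allI impI conjI)
      fix v0 v1 :: "real^'n \<Rightarrow> real" and v
      assume v0: "v0 \<in> sobolev s \<inter> L1" and v1: "v1 \<in> sobolev s \<inter> L11" and v: "boussinesq_solution \<mu> v0 v1 v"
      have data: "v0 \<in> sobolev s" "integrable lborel v0" "v1 \<in> sobolev s" "v1 \<in> L11"
        using v0 v1 by (auto dest: L1D)
      show "\<forall>\<^sub>F t in at_top. (\<lambda>x. v t x - profile1 \<mu> v1 t x - profile2 \<mu> v0 v1 t x) \<in> hom_sobolev s"
        using eventually_gt_at_top[of "0::real"]
      proof eventually_elim
        case (elim t)
        then show ?case unfolding hom_sobolev_def using f2[OF v elim] err2_integral(1)[OF data \<mu> s elim] by blast
      qed
      have "((\<lambda>t. sqrt (1 / W * (t powr E * ?I (err2 \<mu> v0 v1 t)))) \<longlongrightarrow> sqrt (1 / W * 0)) at_top"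
        using err2_integral(2)[OF data \<mu> s] unfolding E_def by (intro tendsto_intros)
      then have lim: "((\<lambda>t. sqrt (1 / W * (t powr E * ?I (err2 \<mu> v0 v1 t)))) \<longlongrightarrow> 0) at_top" by simp
      show "(\<lambda>t. hom_sobolev_norm s (\<lambda>x. v t x - profile1 \<mu> v1 t x - profile2 \<mu> v0 v1 t x))
            \<in> o[at_top](\<lambda>t. t powr (- (2 * s + real CARD('n)) / 8))"
      proof (rule smalloI_tendsto)
        have "\<forall>\<^sub>F t in at_top. sqrt (1 / W * (t powr E * ?I (err2 \<mu> v0 v1 t)))
          = hom_sobolev_norm s (\<lambda>x. v t x - profile1 \<mu> v1 t x - profile2 \<mu> v0 v1 t x) / t powr (- (2 * s + real CARD('n)) / 8)"
          using eventually_gt_at_top[of "0::real"]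
        proof eventually_elim
          case (elim t)
          have "t powr E = 1 / t powr (- E)" using elim by (simp add: powr_minus inverse_eq_divide)
          then have "1 / W * (t powr E * ?I (err2 \<mu> v0 v1 t)) = (1 / W * ?I (err2 \<mu> v0 v1 t)) / t powr (- E)" by simp
          then show ?case
            unfolding hom_sobolev_norm_eq[OF f2[OF v elim]] e8[OF elim] W_def[symmetric] by (simp only: real_sqrt_divide)
        qed
        then show "((\<lambda>t. hom_sobolev_norm s (\<lambda>x. v t x - profile1 \<mu> v1 t x - profile2 \<mu> v0 v1 t x)
            / t powr (- (2 * s + real CARD('n)) / 8)) \<longlongrightarrow> 0) at_top"
          by (rule Lim_transform_eventually[OF lim])
        show "\<forall>\<^sub>F t in at_top. t powr (- (2 * s + real CARD('n)) / 8) \<noteq> 0"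
          using eventually_gt_at_top[of "0::real"] by eventually_elim simp
      qed
    qed
  qed
qed

end
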